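(* Let $K$ be an algebraically closed field of characteristic $0$ and let $(0)\neq I\subset K[x_1,\ldots,x_n]$ be a graded Cohen-Macaulay or almost-Cohen-Macaulay ideal with $\dim I=m>0$. Then $\operatorname{gT}(I)=\mathcal{W}_n^m$ as a fan.
   Context: $\dim I$ is the Krull dimension of $R_I=K[x_1,\ldots,x_n]/I$; $\operatorname{depth}(I)$ is the maximal length of a regular sequence of linear forms on $R_I$. $I$ is Cohen-Macaulay if $\operatorname{depth}(I)=\dim I$ and almost-Cohen-Macaulay if $\operatorname{depth}(I)=\dim I-1$. For $\omega\in\mathbb{R}^n$ the $\omega$-weight of a term $cx^\nu$ is $\omega\cdot\nu$; $\operatorname{in}_\omega(f)$ is the sum of the terms of $f$ of minimal $\omega$-weight; $\operatorname{in}_\omega(I)=(\operatorname{in}_\omega(f):f\in I)$. The Gröbner fan $\operatorname{GF}(I)$ is the complete fan in $\mathbb{R}^n$ in which $\omega,\omega'$ lie in the same relatively open cone iff $\operatorname{in}_\omega(I)=\operatorname{in}_{\omega'}(I)$. The tropical variety $T(I)=\{\omega\in\mathbb{R}^n:\operatorname{in}_\omega(I)\text{ contains no monomial}\}$ is a subfan of $\operatorname{GF}(I)$ with the induced fan structure. A matrix $g\in\operatorname{GL}_n(K)$ acts by $x_i\mapsto\sum_j g_{ji}x_j$. It is known that if $\dim I>0$ there is a nonempty Zariski-open $U\subset\operatorname{GL}_n(K)$ such that $T(g(I))$ is the same fan for all $g\in U$; this fan is the generic tropical variety $\operatorname{gT}(I)$. $\mathcal{W}_n$ is the complete fan in $\mathbb{R}^n$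 with cones $C_A=\{\omega\in\mathbb{R}^n:\omega_i=\min_k\omega_k\ \forall i\in A\}$, $\emptyset\neq A\subset\{1,\ldots,n\}$ ($\dim C_A=n-|A|+1$); $\mathcal{W}_n^m$ is the fan of all its cones of dimension at most $m$. *)

theory Defs
  imports
    "HOL-Analysis.Analysis"
    "HOL-Algebra.Algebraic_Closure_Type"
    "HOL-Library.Poly_Mapping"
    "HOL-Library.Extended_Nat"
begin

section \<open>Polynomials\<close>

text \<open>
  A polynomial over the coefficient ring \<open>'k\<close> in variables indexed by \<open>'x\<close> is a finitely supported
  map from exponent vectors to coefficients. For \<open>'x\<close> finite, \<open>CARD('x)\<close> is the number of variables.
\<close>

type_synonym ('x, 'k) mpoly = "('x \<Rightarrow>\<^sub>0 nat) \<Rightarrow>\<^sub>0 'k"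

abbreviation mpoly_ring :: "('x, 'k::comm_ring_1) mpoly ring"
  where "mpoly_ring \<equiv> ring_of_type_algebra"

definition const :: "'k::zero \<Rightarrow> ('x, 'k) mpoly"
  where "const c = Poly_Mapping.single 0 c"

definition var :: "'x \<Rightarrow> ('x, 'k::zero_neq_one) mpoly"
  where "var i = Poly_Mapping.single (Poly_Mapping.single i 1) 1"

definition monomial :: "('x \<Rightarrow>\<^sub>0 nat) \<Rightarrow> ('x, 'k::zero_neq_one) mpoly"
  where "monomial \<nu> = Poly_Mapping.single \<nu> 1"

text \<open>
  \<open>mpoly_eval h a f\<close> maps the coefficients of \<open>f\<close> by \<open>h\<close> and substitutes \<open>a i\<close> for the variable \<open>i\<close>.
\<close>

definition mpoly_eval ::
  "('k::zero \<Rightarrow> 'r::comm_semiring_1) \<Rightarrow> ('x::finite \<Rightarrow> 'r) \<Rightarrow> ('x, 'k) mpoly \<Rightarrow> 'r"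
  where "mpoly_eval h a f =
    (\<Sum>\<nu>\<in>Poly_Mapping.keys f.
      h (Poly_Mapping.lookup f \<nu>) * (\<Prod>i\<in>UNIV. a i ^ Poly_Mapping.lookup \<nu> i))"

definition terms_satisfying ::
  "(('x \<Rightarrow>\<^sub>0 nat) \<Rightarrow> bool) \<Rightarrow> ('x, 'k::comm_monoid_add) mpoly \<Rightarrow> ('x, 'k) mpoly"
  where "terms_satisfying P f =
    (\<Sum>\<nu>\<in>{\<nu> \<in> Poly_Mapping.keys f. P \<nu>}. Poly_Mapping.single \<nu> (Poly_Mapping.lookup f \<nu>))"

definition exp_degree :: "('x::finite \<Rightarrow>\<^sub>0 nat) \<Rightarrow> nat"
  where "exp_degree \<nu> = (\<Sum>i\<in>UNIV. Poly_Mapping.lookup \<nu> i)"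

text \<open>An ideal is graded iff it contains the homogeneous components of each of its elements.\<close>

definition graded :: "('x::finite, 'k::comm_monoid_add) mpoly set \<Rightarrow> bool"
  where "graded I \<longleftrightarrow> (\<forall>f\<in>I. \<forall>d. terms_satisfying (\<lambda>\<nu>. exp_degree \<nu> = d) f \<in> I)"

definition linear_form :: "('x::finite, 'k::zero) mpoly \<Rightarrow> bool"
  where "linear_form f \<longleftrightarrow> (\<forall>\<nu>\<in>Poly_Mapping.keys f. exp_degree \<nu> = 1)"


section \<open>Dimension and depth\<close>

text \<open>The supremum of the lengths of chains of prime ideals; the zero ring gets the value \<open>0\<close>.\<close>

definition krull_dim :: "('a, 'b) ring_scheme \<Rightarrow> enat"
  where "krull_dim R =
    (SUP k \<in> {k. \<exists>p :: nat \<Rightarrow> 'a set. (\<forall>i\<le>k. primeideal (p i) R) \<and> (\<forall>i<k. p i \<subset> p (Suc i))}. enat k)"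

text \<open>
  Each \<open>xs ! i\<close> is a non-zero-divisor modulo the ideal generated by its predecessors, and \<open>xs\<close> does not
  generate the unit ideal.
\<close>

definition regular_sequence :: "('a, 'b) ring_scheme \<Rightarrow> 'a list \<Rightarrow> bool"
  where "regular_sequence R xs \<longleftrightarrow>
    set xs \<subseteq> carrier R \<and>
    (\<forall>i<length xs. \<forall>a\<in>carrier R.
      xs ! i \<otimes>\<^bsub>R\<^esub> a \<in> Idl\<^bsub>R\<^esub> (set (take i xs)) \<longrightarrow> a \<in> Idl\<^bsub>R\<^esub> (set (take i xs))) \<and>
    Idl\<^bsub>R\<^esub> (set xs) \<noteq> carrier R"

definition ideal_dim :: "('x, 'k::comm_ring_1) mpoly set \<Rightarrow> enat"
  where "ideal_dim I = krull_dim (mpoly_ring Quot I)"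

definition ideal_depth :: "('x::finite, 'k::comm_ring_1) mpoly set \<Rightarrow> enat"
  where "ideal_depth I =
    (SUP ls \<in> {ls. (\<forall>l\<in>set ls. linear_form l) \<and>
                   regular_sequence (mpoly_ring Quot I) (map (\<lambda>l. I +>\<^bsub>mpoly_ring\<^esub> l) ls)}.
      enat (length ls))"

definition cohen_macaulay :: "('x::finite, 'k::comm_ring_1) mpoly set \<Rightarrow> bool"
  where "cohen_macaulay I \<longleftrightarrow> ideal_depth I = ideal_dim I"

text \<open>Written additively because subtraction on \<^typ>\<open>enat\<close> truncates at \<open>0\<close>.\<close>

definition almost_cohen_macaulay :: "('x::finite, 'k::comm_ring_1) mpoly set \<Rightarrow> bool"
  where "almost_cohen_macaulay I \<longleftrightarrow> ideal_depth I + 1 = ideal_dim I"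


section \<open>Initial ideals, Groebner fan and tropical variety\<close>

definition weight :: "real ^ 'x \<Rightarrow> ('x::finite \<Rightarrow>\<^sub>0 nat) \<Rightarrow> real"
  where "weight \<omega> \<nu> = (\<Sum>i\<in>UNIV. \<omega> $ i * real (Poly_Mapping.lookup \<nu> i))"

definition initial_form ::
  "real ^ 'x \<Rightarrow> ('x::finite, 'k::comm_monoid_add) mpoly \<Rightarrow> ('x, 'k) mpoly"
  where "initial_form \<omega> f =
    terms_satisfying (\<lambda>\<nu>. \<forall>\<mu>\<in>Poly_Mapping.keys f. weight \<omega> \<nu> \<le> weight \<omega> \<mu>) f"

definition initial_ideal ::
  "real ^ 'x \<Rightarrow> ('x::finite, 'k::comm_ring_1) mpoly set \<Rightarrow> ('x, 'k) mpoly set"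
  where "initial_ideal \<omega> I = Idl\<^bsub>mpoly_ring\<^esub> (initial_form \<omega> ` I)"

text \<open>
  A fan is represented by the set of its (closed) cones. The relatively open cones of the Groebner fan
  are the classes of weight vectors with the same initial ideal, so its cones are their closures.
\<close>

definition groebner_fan :: "('x::finite, 'k::comm_ring_1) mpoly set \<Rightarrow> (real ^ 'x) set set"
  where "groebner_fan I =
    {closure {\<omega>'. initial_ideal \<omega>' I = initial_ideal \<omega> I} | \<omega>. True}"

definition tropical_variety :: "('x::finite, 'k::comm_ring_1) mpoly set \<Rightarrow> (real ^ 'x) set"
  where "tropical_variety I = {\<omega>. \<forall>\<nu>. monomial \<nu> \<notin> initial_ideal \<omega> I}"

definition tropical_fan :: "('x::finite, 'k::comm_ring_1) mpoly set \<Rightarrow> (real ^ 'x) set set"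
  where "tropical_fan I = {\<sigma> \<in> groebner_fan I. \<sigma> \<subseteq> tropical_variety I}"


section \<open>Generic tropical variety\<close>

text \<open>The matrix \<open>g\<close> substitutes \<open>\<Sum>j. g\<^bsub>ji\<^esub> x\<^bsub>j\<^esub>\<close> for \<open>x\<^bsub>i\<^esub>\<close>.\<close>

definition gl_action :: "'k ^ 'x ^ 'x \<Rightarrow> ('x::finite, 'k::comm_ring_1) mpoly \<Rightarrow> ('x, 'k) mpoly"
  where "gl_action g = mpoly_eval const (\<lambda>i. \<Sum>j\<in>UNIV. const (g $ j $ i) * var j)"

text \<open>
  The Zariski topology on the general linear group is the subspace topology from the affine space of
  all matrices, whose coordinate ring has one variable for each matrix entry.
\<close>

definition zariski_open_GL :: "('k::field ^ 'x::finite ^ 'x) set \<Rightarrow> bool"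
  where "zariski_open_GL U \<longleftrightarrow>
    (\<exists>S :: ('x \<times> 'x, 'k) mpoly set.
      U = {g. invertible g \<and> (\<exists>f\<in>S. mpoly_eval id (\<lambda>(i, j). g $ i $ j) f \<noteq> 0)})"

definition is_generic_tropical_variety ::
  "('x::finite, 'k::field) mpoly set \<Rightarrow> (real ^ 'x) set set \<Rightarrow> bool"
  where "is_generic_tropical_variety I F \<longleftrightarrow>
    (\<exists>U. zariski_open_GL U \<and> U \<noteq> {} \<and> (\<forall>g\<in>U. tropical_fan (gl_action g ` I) = F))"

definition generic_tropical_variety ::
  "('x::finite, 'k::field) mpoly set \<Rightarrow> (real ^ 'x) set set"
  where "generic_tropical_variety I = (THE F. is_generic_tropical_variety I F)"


section \<open>The fan W and its skeleta\<close>

definition W_cone :: "'x set \<Rightarrow> (real ^ 'x::finite) set"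
  where "W_cone A = {\<omega>. \<forall>i\<in>A. \<omega> $ i = (MIN k. \<omega> $ k)}"

definition W_fan :: "(real ^ 'x::finite) set set"
  where "W_fan = {W_cone A | A. A \<noteq> {}}"

definition W_skeleton :: "nat \<Rightarrow> (real ^ 'x::finite) set set"
  where "W_skeleton m = {C \<in> W_fan. dim C \<le> m}"

end

theory Submission
  imports Defs
begin

text \<open>
  The dimension of a graded ideal is the least number of linear forms that together with it generate an
  ideal containing a power of the irrelevant ideal, and it is also the growth order of the Hilbert function; the regular
  sequence of \<open>m - 1\<close> linear forms given by the depth makes an \<open>(m - 1)\<close>-fold difference of the Hilbert
  function of \<open>I\<close> eventually constant. Therefore finitely many open conditions ensure that in generic
  coordinates any \<open>m\<close> variables are parameters and any \<open>m - 1\<close> variables cut the Hilbert function down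
  as a regular sequence does. If at most \<open>m - 1\<close> coordinates of \<open>\<omega>\<close> are not minimal, a comparison
  of Hilbert functions then shows that the initial ideal is generated by the elements of \<open>g(I)\<close> with the
  variables of these coordinates set to \<open>0\<close>. It depends only on the set of minimal coordinates, determines
  it, and contains no monomial since the dimension would drop otherwise. If at least \<open>m\<close> coordinates are
  not minimal, the remaining variables are nilpotent modulo these \<open>m\<close> parameters, so that a power of
  a variable is an initial form.
\<close>

section \<open>Polynomials\<close>

text \<open>Regularity of a sequence is a condition in infinitely many degrees, and it is not
  carried over from the given linear forms to the variables. What is carried over is an upper bound
  for the Hilbert function of the section, which is an open condition in each single degree.
  Finitely many degrees suffice: one further variable makes the section Artinian, so that its
  Hilbert function does not increase from some degree on, while the bound is eventually constant.
  Such an argument requires a section of dimension at most one, which is why depth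
  \<open>m - 1\<close> is enough. The primes of a Krull chain need not be graded. Their growth is
  therefore measured by a second Hilbert function, which counts polynomials of degree at most
  \<open>d\<close>. The variables modulo \<open>g(I)\<close> correspond to linear forms modulo
  \<open>I\<close> whose coefficients are entries of the inverse of \<open>g\<close>. The open
  conditions are thus polynomial in the inverse matrix and become conditions on \<open>g\<close> by
  clearing determinants.\<close>

abbreviation "lookup \<equiv> Poly_Mapping.lookup"
abbreviation "keys \<equiv> Poly_Mapping.keys"
abbreviation "single \<equiv> Poly_Mapping.single"

abbreviation homog_part :: "nat \<Rightarrow> ('x::finite, 'k::comm_monoid_add) mpoly \<Rightarrow> ('x, 'k) mpoly"
  where "homog_part d \<equiv> terms_satisfying (\<lambda>\<nu>. exp_degree \<nu> = d)"

lemma lookup_sum_single: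
  "lookup (\<Sum>\<nu>\<in>S. single \<nu> (c \<nu>)) \<mu> =
    (if \<mu> \<in> S \<and> finite S then c \<mu> else 0)"
  by (cases "finite S") (simp_all add: lookup_sum lookup_single when_def)

lemma lookup_terms_satisfying:
  "lookup (terms_satisfying P f) \<nu> = (if P \<nu> then lookup f \<nu> else 0)"
  unfolding terms_satisfying_def lookup_sum_single
  by (simp add: in_keys_iff)

lemma keys_terms_satisfying:
  "keys (terms_satisfying P f) = {\<nu>\<in>keys f. P \<nu>}"
  by (auto simp: in_keys_iff lookup_terms_satisfying split: if_splits)

lemma terms_satisfying_add:
  "terms_satisfying P (f + g) = terms_satisfying P f + terms_satisfying P g"
  by (rule poly_mapping_eqI) (simp add: lookup_terms_satisfying lookup_add)

lemma terms_satisfying_0 [simp]: "terms_satisfying P 0 = 0"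
  by (rule poly_mapping_eqI) (simp add: lookup_terms_satisfying)

lemma terms_satisfying_diff:
  fixes f :: "('x, 'k::ab_group_add) mpoly"
  shows "terms_satisfying P (f - g) = terms_satisfying P f - terms_satisfying P g"
  by (rule poly_mapping_eqI) (simp add: lookup_terms_satisfying lookup_minus)

lemma terms_satisfying_sum:
  "terms_satisfying P (\<Sum>i\<in>S. f i) = (\<Sum>i\<in>S. terms_satisfying P (f i))"
  by (rule poly_mapping_eqI) (simp add: lookup_terms_satisfying lookup_sum)

lemma terms_satisfying_id:
  "(\<And>\<nu>. \<nu> \<in> keys f \<Longrightarrow> P \<nu>) \<Longrightarrow> terms_satisfying P f = f"
  by (rule poly_mapping_eqI) (auto simp: lookup_terms_satisfying in_keys_iff)

lemma terms_satisfying_none: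
  "(\<And>\<nu>. \<nu> \<in> keys f \<Longrightarrow> \<not> P \<nu>) \<Longrightarrow> terms_satisfying P f = 0"
  by (rule poly_mapping_eqI) (auto simp: lookup_terms_satisfying in_keys_iff)

lemma terms_satisfying_cong:
  "(\<And>\<nu>. \<nu> \<in> keys f \<Longrightarrow> P \<nu> = Q \<nu>) \<Longrightarrow> terms_satisfying P f = terms_satisfying Q f"
  by (rule poly_mapping_eqI) (auto simp: lookup_terms_satisfying in_keys_iff)

lemma terms_satisfying_terms_satisfying:
  "terms_satisfying P (terms_satisfying Q f) = terms_satisfying (\<lambda>\<nu>. P \<nu> \<and> Q \<nu>) f"
  by (rule poly_mapping_eqI) (auto simp: lookup_terms_satisfying)

lemma const_0 [simp]: "const 0 = 0"
  by (simp add: const_def)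

lemma const_1 [simp]: "const 1 = 1"
  by (simp add: const_def)

lemma const_add: "const (a + b) = const a + const b"
  by (simp add: const_def single_add)

lemma const_mult: "const (a * b) = const a * const b"
  by (simp add: const_def mult_single)

lemma const_uminus: "const (- a) = - const a"
  by (simp add: const_def single_uminus)

lemma const_power: "const (a ^ n) = const a ^ n"
  by (induction n) (simp_all add: const_mult)

lemma lookup_const_mult:
  fixes p :: "('x, 'k::comm_semiring_1) mpoly"
  shows "lookup (const c * p) \<nu> = c * lookup p \<nu>"
  unfolding const_def mult_map_scale_conv_mult [symmetric]
  by (simp add: Poly_Mapping.map.rep_eq when_def)

lemma terms_satisfying_const_mult:
  fixes f :: "('x, 'k::comm_semiring_1) mpoly"
  shows "terms_satisfying P (const c * f) = const c * terms_satisfying P f"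
  by (rule poly_mapping_eqI) (simp add: lookup_terms_satisfying lookup_const_mult)

lemma const_mult_monomial:
  fixes c :: "'k::comm_semiring_1"
  shows "const c * monomial \<nu> = single \<nu> c"
  by (simp add: const_def monomial_def mult_single)

lemma monomial_0 [simp]: "monomial 0 = 1"
  by (simp add: monomial_def)

lemma monomial_add:
  "monomial (\<mu> + \<nu>) = (monomial \<mu> * monomial \<nu> :: ('x, 'k::comm_semiring_1) mpoly)"
  by (simp add: monomial_def mult_single)

lemma keys_monomial [simp]: "keys (monomial \<nu> :: ('x, 'k::zero_neq_one) mpoly) = {\<nu>}"
  by (simp add: monomial_def)

lemma monomial_nz [simp]: "(monomial \<nu> :: ('x, 'k::zero_neq_one) mpoly) \<noteq> 0"
  by (metis keys_monomial keys_zero empty_not_insert)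

lemma inj_monomial: "inj (monomial :: _ \<Rightarrow> ('x, 'k::zero_neq_one) mpoly)"
  by (metis injI keys_monomial singleton_inject)

lemma lookup_monomial:
  "lookup (monomial \<nu> :: ('x, 'k::zero_neq_one) mpoly) \<mu> = (if \<mu> = \<nu> then 1 else 0)"
  by (auto simp add: monomial_def lookup_single when_def)

lemma mpoly_expand:
  fixes p :: "('x, 'k::comm_semiring_1) mpoly"
  assumes "finite S" "keys p \<subseteq> S"
  shows "p = (\<Sum>\<nu>\<in>S. const (lookup p \<nu>) * monomial \<nu>)"
proof (rule poly_mapping_eqI)
  fix \<mu>
  show "lookup p \<mu>
      = lookup (\<Sum>\<nu>\<in>S. const (lookup p \<nu>) * monomial \<nu>) \<mu>"
    unfolding const_mult_monomial lookup_sum_single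
    using assms by (auto simp: in_keys_iff)
qed

lemma mpoly_expand_keys:
  fixes p :: "('x, 'k::comm_semiring_1) mpoly"
  shows "p = (\<Sum>\<nu>\<in>keys p. const (lookup p \<nu>) * monomial \<nu>)"
  by (rule mpoly_expand) auto

lemma mpoly_induct [case_names zero add]:
  fixes p :: "('x, 'k::comm_semiring_1) mpoly"
  assumes "P 0"
    and "\<And>c \<nu> p. P p \<Longrightarrow> P (const c * monomial \<nu> + p)"
  shows "P p"
proof -
  have "P (\<Sum>\<nu>\<in>S. const (lookup p \<nu>) * monomial \<nu>)" if "finite S" for S
    using that by (induction S) (simp_all add: assms)
  then show ?thesis
    by (subst mpoly_expand_keys) simp
qed

lemma monomial_eq_prod_var:
  fixes \<nu> :: "'x::finite \<Rightarrow>\<^sub>0 nat"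
  shows "(monomial \<nu> :: ('x, 'k::comm_semiring_1) mpoly) = (\<Prod>i\<in>UNIV. var i ^ lookup \<nu> i)"
proof -
  have 1: "(var i :: ('x, 'k) mpoly) ^ n = monomial (single i n)" for i n
  proof (induction n)
    case (Suc n)
    have e: "single i (Suc n) = single i 1 + single i n"
      unfolding single_add [symmetric] by simp
    show ?case
      unfolding e monomial_add power_Suc Suc by (simp add: var_def monomial_def)
  qed simp
  have 2: "(\<Prod>i\<in>S. monomial (f i) :: ('x, 'k) mpoly) = monomial (\<Sum>i\<in>S. f i)"
    for S and f :: "'x \<Rightarrow> 'x \<Rightarrow>\<^sub>0 nat"
    by (induction S rule: infinite_finite_induct) (simp_all add: monomial_add)
  have "(\<Sum>i\<in>UNIV. single i (lookup \<nu> i)) = \<nu>"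
    by (rule poly_mapping_eqI) (simp add: lookup_sum_single)
  then show ?thesis
    unfolding 1 2 by simp
qed

lemma var_eq_monomial: "var i = monomial (single i 1)"
  by (simp add: var_def monomial_def)

lemma monomial_times_var:
  "monomial (\<nu> + single i 1) = (monomial \<nu> * var i :: ('x, 'k::comm_semiring_1) mpoly)"
  by (simp add: var_eq_monomial monomial_add)

lemma finite_exponents_le:
  "finite {\<nu> :: 'x::finite \<Rightarrow>\<^sub>0 nat. \<forall>i. lookup \<nu> i \<le> d}"
proof (rule finite_imageD)
  have "lookup ` {\<nu> :: 'x \<Rightarrow>\<^sub>0 nat. \<forall>i. lookup \<nu> i \<le> d}
      \<subseteq> (UNIV :: 'x set) \<rightarrow>\<^sub>E {..d}"
    by (auto simp: PiE_def)
  then show "finite (lookup ` {\<nu> :: 'x \<Rightarrow>\<^sub>0 nat. \<forall>i. lookup \<nu> i \<le> d})"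
    by (rule finite_subset) (simp add: finite_PiE)
  show "inj_on lookup {\<nu> :: 'x \<Rightarrow>\<^sub>0 nat. \<forall>i. lookup \<nu> i \<le> d}"
    by (simp add: inj_on_def lookup_inject)
qed

lemma exp_degree_add: "exp_degree (\<mu> + \<nu>) = exp_degree \<mu> + exp_degree \<nu>"
  by (simp add: exp_degree_def lookup_add sum.distrib)

lemma exp_degree_0 [simp]: "exp_degree 0 = 0"
  by (simp add: exp_degree_def)

lemma exp_degree_single [simp]: "exp_degree (single i n) = n"
  by (simp add: exp_degree_def lookup_single when_def)

lemma exp_degree_eq_0_iff: "exp_degree \<nu> = 0 \<longleftrightarrow> \<nu> = 0"
  by (auto simp: exp_degree_def intro: poly_mapping_eqI)

lemma lookup_le_exp_degree: "lookup \<nu> i \<le> exp_degree \<nu>"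
  unfolding exp_degree_def by (rule member_le_sum) auto

lemma finite_exp_degree_le: "finite {\<nu> :: 'x::finite \<Rightarrow>\<^sub>0 nat. exp_degree \<nu> \<le> d}"
  by (rule finite_subset[OF _ finite_exponents_le[of d]]) (auto intro: order_trans[OF lookup_le_exp_degree])

subsection \<open>Evaluation\<close>

locale coeff_hom =
  fixes h :: "'k::comm_semiring_1 \<Rightarrow> 'r::comm_semiring_1"
  assumes h_0 [simp]: "h 0 = 0"
    and h_1 [simp]: "h 1 = 1"
    and h_add: "h (a + b) = h a + h b"
    and h_mult: "h (a * b) = h a * h b"
begin

lemma mpoly_eval_superset:
  assumes "finite S" "keys f \<subseteq> S"
  shows "mpoly_eval h a f =
    (\<Sum>\<nu>\<in>S. h (lookup f \<nu>) * (\<Prod>i\<in>UNIV. a i ^ lookup \<nu> i))"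
  unfolding mpoly_eval_def
  by (rule sum.mono_neutral_left) (use assms in \<open>auto simp: in_keys_iff\<close>)

lemma mpoly_eval_0 [simp]: "mpoly_eval h a 0 = 0"
  by (simp add: mpoly_eval_def)

lemma mpoly_eval_add: "mpoly_eval h a (f + g) = mpoly_eval h a f + mpoly_eval h a g"
proof -
  let ?S = "keys f \<union> keys g"
  have "finite ?S" "keys f \<subseteq> ?S" "keys g \<subseteq> ?S" "keys (f + g) \<subseteq> ?S"
    using keys_add[of f g] by auto
  then show ?thesis
    by (simp add: mpoly_eval_superset[of ?S] lookup_add h_add algebra_simps sum.distrib)
qed

lemma mpoly_eval_sum: "mpoly_eval h a (\<Sum>i\<in>S. f i) = (\<Sum>i\<in>S. mpoly_eval h a (f i))"
  by (induction S rule: infinite_finite_induct) (simp_all add: mpoly_eval_add)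

lemma mpoly_eval_single:
  "mpoly_eval h a (single \<nu> c) = h c * (\<Prod>i\<in>UNIV. a i ^ lookup \<nu> i)"
  by (simp add: mpoly_eval_def)

lemma mpoly_eval_const: "mpoly_eval h a (const c) = h c"
  by (simp add: const_def mpoly_eval_single)

lemma mpoly_eval_1 [simp]: "mpoly_eval h a 1 = 1"
  using mpoly_eval_const[of a 1] by simp

lemma mpoly_eval_monomial: "mpoly_eval h a (monomial \<nu>) = (\<Prod>i\<in>UNIV. a i ^ lookup \<nu> i)"
  by (simp add: monomial_def mpoly_eval_single)

lemma mpoly_eval_var: "mpoly_eval h a (var i) = a i"
proof -
  have "(\<Prod>j\<in>UNIV. a j ^ (1 when i = j)) = (\<Prod>j\<in>UNIV. if j = i then a j else 1)"
    by (rule prod.cong) (auto simp: when_def)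
  then show ?thesis
    by (simp add: var_eq_monomial mpoly_eval_monomial lookup_single)
qed

lemma mpoly_eval_mult: "mpoly_eval h a (f * g) = mpoly_eval h a f * mpoly_eval h a g"
proof -
  have 1: "mpoly_eval h a (const c * monomial \<nu> * (const d * monomial \<mu>))
      = mpoly_eval h a (const c * monomial \<nu>) * mpoly_eval h a (const d * monomial \<mu>)" for c d \<mu> \<nu>
    by (simp add: const_mult_monomial mult_single mpoly_eval_single lookup_add power_add
        prod.distrib h_mult algebra_simps)
  have 2: "mpoly_eval h a (const c * monomial \<nu> * g)
      = mpoly_eval h a (const c * monomial \<nu>) * mpoly_eval h a g" for c \<nu>
    by (induction g rule: mpoly_induct)
      (simp_all only: mpoly_eval_add 1 distrib_left mult_zero_right mpoly_eval_0)
  show ?thesis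
    by (induction f rule: mpoly_induct)
      (simp_all only: mpoly_eval_add 2 distrib_right mult_zero_left mpoly_eval_0)
qed

lemma mpoly_eval_comp:
  assumes "\<phi> 0 = 0" "\<phi> 1 = 1" "\<And>x y. \<phi> (x + y) = \<phi> x + \<phi> y" "\<And>x y. \<phi> (x * y) = \<phi> x * \<phi> y"
  shows "\<phi> (mpoly_eval h a f) = mpoly_eval (\<lambda>c. \<phi> (h c)) (\<lambda>i. \<phi> (a i)) f"
proof -
  have s: "\<phi> (\<Sum>i\<in>S. g i) = (\<Sum>i\<in>S. \<phi> (g i))" for S and g :: "_ \<Rightarrow> 'r"
    by (induction S rule: infinite_finite_induct) (simp_all add: assms)
  have p: "\<phi> (\<Prod>i\<in>S. g i) = (\<Prod>i\<in>S. \<phi> (g i))" for S and g :: "_ \<Rightarrow> 'r"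
    by (induction S rule: infinite_finite_induct) (simp_all add: assms)
  have e: "\<phi> (x ^ n) = \<phi> x ^ n" for x n
    by (induction n) (simp_all add: assms)
  show ?thesis
    unfolding mpoly_eval_def by (simp add: s p e assms)
qed

end

lemma coeff_hom_const: "coeff_hom (const :: 'k::comm_semiring_1 \<Rightarrow> ('x, 'k) mpoly)"
  by standard (simp_all add: const_add const_mult)

interpretation subst: coeff_hom "const :: 'k::comm_semiring_1 \<Rightarrow> ('x, 'k) mpoly"
  by (rule coeff_hom_const)

interpretation ev: coeff_hom "id :: 'k::comm_semiring_1 \<Rightarrow> 'k"
  by standard simp_all

interpretation evpoly: coeff_hom "\<lambda>c :: 'k::comm_semiring_1. [:c:]"
proof
  fix a b :: 'k
  show "[:a * b:] = [:a:] * [:b:]"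
    by simp (rule mult.commute)
qed (simp_all add: pCons_one)

lemma subst_diff:
  fixes f g :: "('x::finite, 'k::comm_ring_1) mpoly"
  shows "mpoly_eval const a (f - g) = mpoly_eval const a f - mpoly_eval const a g"
  using subst.mpoly_eval_add[of a "f - g" g] by simp

lemma subst_var_id: "mpoly_eval const var p = (p :: ('x::finite, 'k::comm_semiring_1) mpoly)"
  by (induction p rule: mpoly_induct)
    (simp_all add: subst.mpoly_eval_add subst.mpoly_eval_mult subst.mpoly_eval_const
      subst.mpoly_eval_monomial flip: monomial_eq_prod_var)

lemma subst_subst:
  fixes a b :: "'x::finite \<Rightarrow> ('x, 'k::comm_semiring_1) mpoly"
  shows "mpoly_eval const b (mpoly_eval const a p) = mpoly_eval const (\<lambda>i. mpoly_eval const b (a i)) p"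
proof -
  have "mpoly_eval const b (mpoly_eval const a p)
      = mpoly_eval (\<lambda>c. mpoly_eval const b (const c)) (\<lambda>i. mpoly_eval const b (a i)) p"
    by (rule subst.mpoly_eval_comp)
      (simp_all add: subst.mpoly_eval_add subst.mpoly_eval_mult)
  then show ?thesis
    by (simp add: subst.mpoly_eval_const)
qed

subsection \<open>Nonvanishing points\<close>

text \<open>The weights are powers of \<open>M\<close>, so that the weighted sum is a number written
  in base \<open>M\<close> and determines its digits. The new variable becomes the last digit, which
  is read off modulo \<open>M\<close>.\<close>

lemma base_weights_separate:
  fixes M :: nat
  assumes "finite F"
  shows "\<exists>w :: 'x \<Rightarrow> nat. \<forall>f g. (\<forall>i\<in>F. f i < M \<and> g i < M) \<longrightarrow>
    (\<Sum>i\<in>F. w i * f i) = (\<Sum>i\<in>F. w i * g i) \<longrightarrow> (\<forall>i\<in>F. f i = g i)"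
  using assms
proof (induction F)
  case (insert x F)
  then obtain w :: "'x \<Rightarrow> nat" where w: "\<And>f g. (\<forall>i\<in>F. f i < M \<and> g i < M) \<Longrightarrow>
    (\<Sum>i\<in>F. w i * f i) = (\<Sum>i\<in>F. w i * g i) \<Longrightarrow> (\<forall>i\<in>F. f i = g i)"
    by blast
  let ?w = "\<lambda>i. if i = x then 1 else M * w i"
  have eq: "(\<Sum>i\<in>insert x F. ?w i * f i) = f x + M * (\<Sum>i\<in>F. w i * f i)" for f
  proof -
    have "(\<Sum>i\<in>F. ?w i * f i) = (\<Sum>i\<in>F. M * (w i * f i))"
      by (rule sum.cong) (use insert in auto)
    then show ?thesis
      using insert by (simp add: sum_distrib_left)
  qed
  show ?case
  proof (intro exI[of _ ?w] allI impI)
    fix f g assume lt: "\<forall>i\<in>insert x F. f i < M \<and> g i < M"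
      and e: "(\<Sum>i\<in>insert x F. ?w i * f i) = (\<Sum>i\<in>insert x F. ?w i * g i)"
    define a b where "a = (\<Sum>i\<in>F. w i * f i)" and "b = (\<Sum>i\<in>F. w i * g i)"
    have e': "f x + M * a = g x + M * b"
      using e unfolding eq a_def b_def .
    have l: "f x < M" "g x < M" using lt by auto
    have "(f x + M * a) mod M = f x" "(g x + M * b) mod M = g x"
      using l by simp_all
    then have fx: "f x = g x" using e' by simp
    then have "a = b" using e' l by simp
    then have "\<forall>i\<in>F. f i = g i"
      using w lt unfolding a_def b_def by blast
    then show "\<forall>i\<in>insert x F. f i = g i" using fx by simp
  qed
qed simp

text \<open>Kronecker substitution $x_i \mapsto t^{w_i}$ keeps distinct monomials distinct.\<close>

lemma nonvanishing_point:
  fixes p :: "('x::finite, 'k::field_char_0) mpoly"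
  assumes "p \<noteq> 0"
  shows "\<exists>a. mpoly_eval id a p \<noteq> 0"
proof -
  let ?K = "keys p"
  \<comment> \<open>Larger than every exponent occurring in \<open>p\<close>, as the base of the
    substitution has to be.\<close>
  define M where "M = Suc (\<Sum>\<nu>\<in>?K. exp_degree \<nu>)"
  have lt: "lookup \<nu> i < M" if "\<nu> \<in> ?K" for \<nu> i
  proof -
    have "lookup \<nu> i \<le> exp_degree \<nu>" by (rule lookup_le_exp_degree)
    also have "\<dots> \<le> (\<Sum>\<nu>\<in>?K. exp_degree \<nu>)"
      using that by (intro member_le_sum) auto
    finally show ?thesis unfolding M_def by simp
  qed
  obtain w :: "'x \<Rightarrow> nat" where w: "\<And>f g. (\<forall>i\<in>UNIV. f i < M \<and> g i < M) \<Longrightarrow>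
    (\<Sum>i\<in>UNIV. w i * f i) = (\<Sum>i\<in>UNIV. w i * g i) \<Longrightarrow> (\<forall>i\<in>UNIV. f i = g i)"
    using base_weights_separate[of "UNIV :: 'x set" M] by auto
  define W where "W \<nu> = (\<Sum>i\<in>UNIV. w i * lookup \<nu> i)" for \<nu> :: "'x \<Rightarrow>\<^sub>0 nat"
  have inj: "\<mu> = \<nu>" if "\<mu> \<in> ?K" "\<nu> \<in> ?K" "W \<mu> = W \<nu>" for \<mu> \<nu>
    using w[of "lookup \<mu>" "lookup \<nu>"] that lt
    by (auto simp: W_def intro: poly_mapping_eqI)
  define q where "q = (\<Sum>\<nu>\<in>?K. Polynomial.monom (lookup p \<nu>) (W \<nu>))"
  obtain \<nu>\<^sub>0 where \<nu>0: "\<nu>\<^sub>0 \<in> ?K" using assms by (metis ex_in_conv keys_eq_empty)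
  have "Polynomial.coeff q (W \<nu>\<^sub>0) = (\<Sum>\<nu>\<in>?K. if \<nu> = \<nu>\<^sub>0 then lookup p \<nu> else 0)"
    unfolding q_def coeff_sum by (rule sum.cong) (use inj \<nu>0 in auto)
  then have "Polynomial.coeff q (W \<nu>\<^sub>0) \<noteq> 0"
    using \<nu>0 by (simp add: in_keys_iff)
  then have "q \<noteq> 0" by auto
  then have "finite {t. poly q t = 0}" by (rule poly_roots_finite)
  then obtain t where t: "poly q t \<noteq> 0"
    using infinite_UNIV_char_0 by (metis (mono_tags, lifting) ex_new_if_finite mem_Collect_eq)
  have "mpoly_eval id (\<lambda>i. t ^ w i) p = poly q t"
    unfolding q_def mpoly_eval_def poly_sum poly_monom W_def
    by (simp add: power_sum power_mult)
  then show ?thesis using t by metis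
qed

text \<open>Along the line joining a point for \<open>S\<close> to a point for \<open>j\<close>,
  each polynomial becomes a univariate one that is nonzero at one of the two ends. These have
  finitely many roots in all, and an infinite field leaves another parameter value. This is the
  irreducibility of affine space.\<close>

lemma common_nonvanishing_point:
  fixes f :: "'j \<Rightarrow> ('x::finite, 'k::field_char_0) mpoly"
  assumes "finite S" "\<And>j. j \<in> S \<Longrightarrow> \<exists>a. mpoly_eval id a (f j) \<noteq> 0"
  shows "\<exists>a. \<forall>j\<in>S. mpoly_eval id a (f j) \<noteq> 0"
  using assms
proof (induction S)
  case (insert j S)
  then obtain a b where a: "\<forall>j\<in>S. mpoly_eval id a (f j) \<noteq> 0" and b: "mpoly_eval id b (f j) \<noteq> 0"
    by (meson insertCI)
  define q where "q j = mpoly_eval (\<lambda>c. [:c:]) (\<lambda>i. [:a i, b i - a i:]) (f j)" for j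
  have q: "poly (q j) t = mpoly_eval id (\<lambda>i. a i + t * (b i - a i)) (f j)" for j t
    unfolding q_def
    by (subst evpoly.mpoly_eval_comp[of "\<lambda>p. poly p t"]) (simp_all add: id_def)
  have "q i \<noteq> 0" if "i \<in> insert j S" for i
  proof
    assume "q i = 0"
    then have "poly (q i) 0 = 0" "poly (q i) 1 = 0" by simp_all
    then show False using that a b by (auto simp: q)
  qed
  then have "finite (\<Union>i\<in>insert j S. {t. poly (q i) t = 0})"
    using insert(1) by (intro finite_UN_I) (auto intro: poly_roots_finite)
  then obtain t where "t \<notin> (\<Union>i\<in>insert j S. {t. poly (q i) t = 0})"
    using infinite_UNIV_char_0 ex_new_if_finite by metis
  then have "\<forall>i\<in>insert j S. mpoly_eval id (\<lambda>i. a i + t * (b i - a i)) (f i) \<noteq> 0"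
    by (auto simp: q)
  then show ?case by metis
qed simp

text \<open>At a common nonvanishing point of both factors the product does not vanish
  either.\<close>

lemma mpoly_mult_eq_0_iff:
  fixes p q :: "('x::finite, 'k::field_char_0) mpoly"
  shows "p * q = 0 \<longleftrightarrow> p = 0 \<or> q = 0"
proof (rule iffI, rule ccontr)
  assume pq: "p * q = 0" and "\<not> (p = 0 \<or> q = 0)"
  then obtain a where "\<forall>r\<in>{p, q}. mpoly_eval id a r \<noteq> 0"
    using common_nonvanishing_point[of "{p, q}" id] nonvanishing_point by auto
  then show False
    using pq ev.mpoly_eval_mult[of a p q] by simp
qed auto

section \<open>Codimension\<close>

locale codim_space = vector_space scale
  for scale :: "'a::field \<Rightarrow> 'b::ab_group_add \<Rightarrow> 'b" (infixr \<open>\<odot>\<close> 75)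
begin

text \<open>Linear independence of the classes in the quotient by \<open>V\<close>, expressed by
  representatives. Distinct members of \<open>T\<close> then have distinct classes.\<close>

definition indep_mod :: "'b set \<Rightarrow> 'b set \<Rightarrow> bool"
  where "indep_mod V T \<longleftrightarrow> finite T \<and> (\<forall>u. (\<Sum>t\<in>T. u t \<odot> t) \<in> V \<longrightarrow> (\<forall>t\<in>T. u t = 0))"

text \<open>The dimension of \<open>(V + W) / V\<close>; meaningful only if this is finite.\<close>

definition codim :: "'b set \<Rightarrow> 'b set \<Rightarrow> nat"
  where "codim W V = Max (card ` {T. T \<subseteq> W \<and> indep_mod V T})"

lemma indep_modD: "indep_mod V T \<Longrightarrow> (\<Sum>t\<in>T. u t \<odot> t) \<in> V \<Longrightarrow> \<forall>t\<in>T. u t = 0"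
  by (simp add: indep_mod_def)

lemma indep_mod_empty [simp]: "indep_mod V {}"
  by (simp add: indep_mod_def)

lemma indep_mod_antimono: "indep_mod V' T \<Longrightarrow> V \<subseteq> V' \<Longrightarrow> indep_mod V T"
  by (auto simp: indep_mod_def)

lemma indep_mod_diff:
  assumes "indep_mod V T" "t \<in> T" "t' \<in> T" "t - t' \<in> V"
  shows "t = t'"
proof (rule ccontr)
  assume ne: "t \<noteq> t'"
  have fin: "finite T" using assms(1) by (simp add: indep_mod_def)
  let ?u = "\<lambda>x. if x = t then (1::'a) else if x = t' then -1 else 0"
  have "(\<Sum>x\<in>T. ?u x \<odot> x) = (\<Sum>x\<in>T. (if x = t then x else 0) + (if x = t' then - x else 0))"
    by (rule sum.cong) (use ne in auto)
  also have "\<dots> = t - t'"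
    using fin assms(2,3) by (simp add: sum.distrib)
  finally have "(\<Sum>x\<in>T. ?u x \<odot> x) \<in> V" using assms(4) by metis
  then have "\<forall>x\<in>T. ?u x = 0" by (rule indep_modD[OF assms(1)])
  then show False using assms(2) by auto
qed

lemma span_Un_subspace:
  assumes "subspace V"
  shows "x \<in> span (V \<union> S) \<longleftrightarrow> (\<exists>v\<in>V. \<exists>s\<in>span S. x = v + s)"
proof -
  have "span V = V" using assms by simp
  then show ?thesis unfolding span_Un by blast
qed

text \<open>Steinitz exchange modulo \<open>V\<close>: each \<open>t\<close> is replaced by a
  congruent vector of \<open>span S\<close>. The replacements stay distinct and independent because
  a relation among them lifts to a combination of \<open>T\<close> in \<open>V\<close>.\<close>

lemma card_indep_mod_le:
  assumes V: "subspace V" and T: "indep_mod V T" and S: "finite S" and sub: "T \<subseteq> span (V \<union> S)"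
  shows "card T \<le> card S"
proof -
  have "\<forall>t\<in>T. \<exists>s. s \<in> span S \<and> t - s \<in> V"
    using sub unfolding span_Un_subspace[OF V] subset_iff by fastforce
  then obtain s where s: "\<And>t. t \<in> T \<Longrightarrow> s t \<in> span S" "\<And>t. t \<in> T \<Longrightarrow> t - s t \<in> V"
    by metis
  have fin: "finite T" using T by (simp add: indep_mod_def)
  have inj: "inj_on s T"
  proof (rule inj_onI)
    fix t t' assume t: "t \<in> T" "t' \<in> T" "s t = s t'"
    have "(t - s t) - (t' - s t') \<in> V"
      by (rule subspace_diff[OF V s(2)[OF t(1)] s(2)[OF t(2)]])
    then show "t = t'" using t T indep_mod_diff by auto
  qed
  have "independent (s ` T)"
  proof (rule independent_if_scalars_zero)
    fix f x assume 0: "(\<Sum>x\<in>s ` T. f x \<odot> x) = 0" and x: "x \<in> s ` T"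
    have "(\<Sum>t\<in>T. f (s t) \<odot> s t) = 0"
      using 0 inj by (simp add: sum.reindex)
    then have "(\<Sum>t\<in>T. f (s t) \<odot> t) = (\<Sum>t\<in>T. f (s t) \<odot> (t - s t))"
      by (simp add: scale_right_diff_distrib sum_subtractf)
    also have "\<dots> \<in> V" using V s by (intro subspace_sum subspace_scale) auto
    finally have "\<forall>t\<in>T. f (s t) = 0"
      using indep_modD[OF T, of "\<lambda>t. f (s t)"] by simp
    then show "f x = 0" using x by auto
  qed (use fin in simp)
  moreover have "s ` T \<subseteq> span S" using s by auto
  ultimately have "card (s ` T) \<le> card S"
    using independent_span_bound S by blast
  then show ?thesis using inj by (simp add: card_image)
qed

lemma indep_mod_insert:
  assumes V: "subspace V" and T: "indep_mod V T" and w: "w \<notin> span (V \<union> T)"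
  shows "indep_mod V (insert w T)"
proof -
  have fin: "finite T" using T by (simp add: indep_mod_def)
  have wT: "w \<notin> T" using w span_base[of w "V \<union> T"] by blast
  have "\<forall>t\<in>insert w T. u t = 0" if u: "(\<Sum>t\<in>insert w T. u t \<odot> t) \<in> V" for u
  proof -
    let ?s = "\<Sum>t\<in>T. u t \<odot> t"
    have e: "u w \<odot> w + ?s \<in> V" using u fin wT by simp
    have s: "?s \<in> span (V \<union> T)" by (intro span_sum span_scale span_base) auto
    have "u w \<odot> w = (u w \<odot> w + ?s) - ?s" by simp
    also have "\<dots> \<in> span (V \<union> T)"
      by (rule span_diff[OF _ s]) (use e in \<open>auto intro: span_base\<close>)
    finally have "u w \<odot> w \<in> span (V \<union> T)" .
    then have "inverse (u w) \<odot> (u w \<odot> w) \<in> span (V \<union> T)" by (rule span_scale)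
    then have "u w = 0" using w by (cases "u w = 0") auto
    moreover from this have "?s \<in> V" using e by simp
    ultimately show ?thesis using indep_modD[OF T, of u] by simp
  qed
  then show ?thesis using fin unfolding indep_mod_def by blast
qed

text \<open>A member of largest size exists because the sizes are bounded, and a vector outside its
  span would enlarge it. \<open>G\<close> is only a set, so that a basis can be selected among given
  generators or monomials.\<close>

lemma maximal_indep_mod:
  assumes V: "subspace V" and b: "\<And>T. T \<subseteq> G \<Longrightarrow> indep_mod V T \<Longrightarrow> card T \<le> b"
  obtains T where "T \<subseteq> G" "indep_mod V T" "G \<subseteq> span (V \<union> T)"
    "\<And>T'. T' \<subseteq> G \<Longrightarrow> indep_mod V T' \<Longrightarrow> card T' \<le> card T"
proof -
  let ?P = "\<lambda>T. T \<subseteq> G \<and> indep_mod V T"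
  have "?P {}" by simp
  moreover have "\<forall>T. ?P T \<longrightarrow> card T < Suc b" using b by (simp add: less_Suc_eq_le)
  ultimately obtain T where T: "?P T" "\<And>T'. ?P T' \<Longrightarrow> card T' \<le> card T"
    using ex_has_greatest_nat[of ?P "{}" card "Suc b"] by blast
  have "x \<in> span (V \<union> T)" if "x \<in> G" for x
  proof (rule ccontr)
    assume x: "x \<notin> span (V \<union> T)"
    then have "indep_mod V (insert x T)" using V T indep_mod_insert by blast
    then have "card (insert x T) \<le> card T" using T that by blast
    moreover have "x \<notin> T" using x span_base[of x "V \<union> T"] by blast
    moreover have "finite T" using T by (simp add: indep_mod_def)
    ultimately show False by simp
  qed
  then show ?thesis using that T by blast
qed

lemma codim_basis:
  assumes V: "subspace V" and S: "finite S" "W \<subseteq> span (V \<union> S)"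
  obtains T where "T \<subseteq> W" "indep_mod V T" "card T = codim W V" "W \<subseteq> span (V \<union> T)"
proof -
  have b: "card T \<le> card S" if "T \<subseteq> W" "indep_mod V T" for T
    using card_indep_mod_le[OF V that(2) S(1)] that S by blast
  obtain T where T: "T \<subseteq> W" "indep_mod V T" "W \<subseteq> span (V \<union> T)"
    "\<And>T'. T' \<subseteq> W \<Longrightarrow> indep_mod V T' \<Longrightarrow> card T' \<le> card T"
    using maximal_indep_mod[OF V b] by blast
  have "codim W V = card T"
    unfolding codim_def
  proof (rule Max_eqI)
    have "card ` {T. T \<subseteq> W \<and> indep_mod V T} \<subseteq> {..card S}" using b by auto
    then show "finite (card ` {T. T \<subseteq> W \<and> indep_mod V T})" using finite_subset by blast
  qed (use T in auto)
  then show ?thesis using that T by simp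
qed

lemma card_le_codim:
  assumes V: "subspace V" and S: "finite S" "W \<subseteq> span (V \<union> S)" and T: "T \<subseteq> W" "indep_mod V T"
  shows "card T \<le> codim W V"
proof -
  obtain T' where T': "T' \<subseteq> W" "indep_mod V T'" "card T' = codim W V" "W \<subseteq> span (V \<union> T')"
    by (rule codim_basis[OF V S])
  then have "finite T'" by (simp add: indep_mod_def)
  from card_indep_mod_le[OF V T(2) this order_trans[OF T(1) T'(4)]] T'(3) show ?thesis by simp
qed

lemma codim_le_card:
  assumes V: "subspace V" and S: "finite S" "W \<subseteq> span (V \<union> S)"
  shows "codim W V \<le> card S"
proof -
  obtain T where T: "T \<subseteq> W" "indep_mod V T" "card T = codim W V" "W \<subseteq> span (V \<union> T)"
    by (rule codim_basis[OF V S])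
  then show ?thesis using card_indep_mod_le[OF V T(2) S(1) order_trans[OF T(1) S(2)]] by simp
qed

lemma codim_mono:
  assumes "subspace V" "finite S" "W' \<subseteq> span (V \<union> S)" "W \<subseteq> W'"
  shows "codim W V \<le> codim W' V"
proof -
  have W: "W \<subseteq> span (V \<union> S)" using assms by blast
  obtain T where T: "T \<subseteq> W" "indep_mod V T" "card T = codim W V" "W \<subseteq> span (V \<union> T)"
    by (rule codim_basis[OF assms(1,2) W])
  then show ?thesis using card_le_codim[OF assms(1,2,3) order_trans[OF T(1) assms(4)] T(2)] by simp
qed

lemma codim_antimono:
  assumes "subspace V" "subspace V'" "finite S" "W \<subseteq> span (V \<union> S)" "V \<subseteq> V'"
  shows "codim W V' \<le> codim W V"
proof -
  obtain T where T: "T \<subseteq> W" "indep_mod V T" "card T = codim W V" "W \<subseteq> span (V \<union> T)"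
    by (rule codim_basis[OF assms(1,3,4)])
  have "span (V \<union> T) \<subseteq> span (V' \<union> T)" using assms(5) by (intro span_mono) auto
  then have "W \<subseteq> span (V' \<union> T)" using T(4) by blast
  moreover have "finite T" using T(2) by (simp add: indep_mod_def)
  ultimately show ?thesis
    using codim_le_card[OF assms(2), of T W] T(3) by simp
qed

text \<open>This turns an equality of Hilbert functions into an equality of ideals. A basis
  \<open>T\<close> of \<open>W\<close> modulo \<open>V'\<close> is independent modulo
  \<open>V\<close> as well, hence already maximal there. So \<open>x = v + s\<close> with
  \<open>s\<close> in the span of \<open>T\<close>, and as \<open>s\<close> lies in
  \<open>V'\<close>, independence forces \<open>s = 0\<close>.\<close>

lemma codim_le_imp_subset:
  assumes V: "subspace V" "subspace V'" and S: "finite S" "W \<subseteq> span (V \<union> S)"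
    and sub: "V \<subseteq> V'" and le: "codim W V \<le> codim W V'"
  shows "W \<inter> V' \<subseteq> V"
proof
  fix x assume x: "x \<in> W \<inter> V'"
  have "span (V \<union> S) \<subseteq> span (V' \<union> S)" using sub by (intro span_mono) auto
  then have S': "W \<subseteq> span (V' \<union> S)" using S by blast
  obtain T where T: "T \<subseteq> W" "indep_mod V' T" "card T = codim W V'" "W \<subseteq> span (V' \<union> T)"
    by (rule codim_basis[OF V(2) S(1) S'])
  have TV: "indep_mod V T" using T sub indep_mod_antimono by blast
  have fin: "finite T" using T by (simp add: indep_mod_def)
  have "x \<in> span (V \<union> T)"
  proof (rule ccontr)
    assume nx: "x \<notin> span (V \<union> T)"
    then have "indep_mod V (insert x T)" using indep_mod_insert[OF V(1) TV] by blast
    then have "card (insert x T) \<le> codim W V"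
      using card_le_codim[OF V(1) S] T(1) x by blast
    moreover have "x \<notin> T" using nx span_base[of x "V \<union> T"] by blast
    ultimately show False using le fin T(3) by simp
  qed
  then obtain v s where vs: "v \<in> V" "s \<in> span T" "x = v + s"
    unfolding span_Un_subspace[OF V(1)] by blast
  then obtain u where u: "s = (\<Sum>t\<in>T. u t \<odot> t)"
    using fin by (auto simp: span_finite)
  have "x - v \<in> V'" using V(2) x vs sub by (intro subspace_diff) auto
  then have "s \<in> V'" using vs by simp
  then have "\<forall>t\<in>T. u t = 0" using indep_modD[OF T(2), of u] u by simp
  then have "s = 0" using u by simp
  then show "x \<in> V" using vs by simp
qed

text \<open>Left half of an exact sequence \<open>W'/P -> W/P -> W/Q\<close>: the map
  \<open>f\<close>, later multiplication by a non-zero-divisor, is injective modulo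
  \<open>P\<close>. The images of a basis of \<open>W'\<close> modulo \<open>P\<close> lie in
  \<open>Q\<close> and therefore stay independent together with a basis of \<open>W\<close> modulo
  \<open>Q\<close>.\<close>

lemma codim_exact_ge:
  assumes lin: "\<And>x y. f (x + y) = f x + f y" "\<And>c x. f (c \<odot> x) = c \<odot> f x"
    and P: "subspace P" and Q: "subspace Q" "P \<subseteq> Q" and W': "subspace W'"
    and S: "finite S" "W \<subseteq> span (P \<union> S)" and S': "finite S'" "W' \<subseteq> span (P \<union> S')"
    and fW: "f ` W' \<subseteq> W" and fQ: "\<And>x. x \<in> W' \<Longrightarrow> f x \<in> Q"
    and reg: "\<And>x. x \<in> W' \<Longrightarrow> f x \<in> P \<Longrightarrow> x \<in> P"
  shows "codim W Q + codim W' P \<le> codim W P"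
proof -
  have "span (P \<union> S) \<subseteq> span (Q \<union> S)" using Q(2) by (intro span_mono) auto
  then have SQ: "W \<subseteq> span (Q \<union> S)" using S by blast
  obtain T where T: "T \<subseteq> W" "indep_mod Q T" "card T = codim W Q" "W \<subseteq> span (Q \<union> T)"
    by (rule codim_basis[OF Q(1) S(1) SQ])
  obtain T' where T': "T' \<subseteq> W'" "indep_mod P T'" "card T' = codim W' P" "W' \<subseteq> span (P \<union> T')"
    by (rule codim_basis[OF P S'])
  have fin: "finite T" "finite T'" using T T' by (simp_all add: indep_mod_def)
  have f0: "f 0 = 0" using lin(2)[of 0 0] by simp
  have fs: "f (\<Sum>t\<in>A. u t \<odot> t) = (\<Sum>t\<in>A. u t \<odot> f t)" for A u
    by (induction A rule: infinite_finite_induct) (simp_all add: lin f0)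
  have fd: "f (x - y) = f x - f y" for x y
    using lin(1)[of "x - y" y] by (simp add: algebra_simps)
  have inj: "inj_on f T'"
  proof (rule inj_onI)
    fix x y assume xy: "x \<in> T'" "y \<in> T'" "f x = f y"
    then have "f (x - y) \<in> P" using fd P subspace_0 by simp
    moreover have "x - y \<in> W'" using xy T' W' subspace_diff by blast
    ultimately have "x - y \<in> P" using reg by blast
    then show "x = y" using indep_mod_diff[OF T'(2)] xy by blast
  qed
  have dis: "T \<inter> f ` T' = {}"
  proof (rule ccontr)
    assume "T \<inter> f ` T' \<noteq> {}"
    then obtain t where t: "t \<in> T" "t \<in> f ` T'" by blast
    then have "t \<in> Q" using fQ T' by blast
    moreover have "(\<Sum>x\<in>T. (if x = t then 1 else 0) \<odot> x) = (\<Sum>x\<in>T. if x = t then x else 0)"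
      by (rule sum.cong) auto
    then have "(\<Sum>x\<in>T. (if x = t then 1 else 0) \<odot> x) = t"
      using fin t by simp
    ultimately have "(\<Sum>x\<in>T. (if x = t then 1 else 0) \<odot> x) \<in> Q" by simp
    then have "\<forall>x\<in>T. (if x = t then 1 else 0) = (0::'a)"
      by (rule indep_modD[OF T(2)])
    then show False using t by auto
  qed
  have "indep_mod P (T \<union> f ` T')"
    unfolding indep_mod_def
  proof (intro conjI allI impI)
    fix u assume "(\<Sum>t\<in>T \<union> f ` T'. u t \<odot> t) \<in> P"
    then have e: "(\<Sum>t\<in>T. u t \<odot> t) + (\<Sum>t\<in>T'. u (f t) \<odot> f t) \<in> P"
      using fin dis inj by (simp add: sum.union_disjoint sum.reindex)
    let ?y = "\<Sum>t\<in>T'. u (f t) \<odot> t"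
    have y: "?y \<in> W'" using T' W' by (intro subspace_sum subspace_scale) auto
    have "(\<Sum>t\<in>T'. u (f t) \<odot> f t) = f ?y" by (simp add: fs)
    with e have e': "(\<Sum>t\<in>T. u t \<odot> t) + f ?y \<in> P" by simp
    then have "((\<Sum>t\<in>T. u t \<odot> t) + f ?y) - f ?y \<in> Q"
      using Q fQ[OF y] by (intro subspace_diff) auto
    then have 1: "\<forall>t\<in>T. u t = 0" using indep_modD[OF T(2), of u] by simp
    then have "f ?y \<in> P" using e' by simp
    then have "?y \<in> P" using reg y by blast
    then have "\<forall>t\<in>T'. u (f t) = 0"
      using indep_modD[OF T'(2), of "\<lambda>t. u (f t)"] by simp
    then show "\<forall>t\<in>T \<union> f ` T'. u t = 0" using 1 by auto
  qed (use fin in auto)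
  moreover have "T \<union> f ` T' \<subseteq> W" using T(1) T'(1) fW by blast
  ultimately have "card (T \<union> f ` T') \<le> codim W P"
    using card_le_codim[OF P S] by blast
  then show ?thesis
    using T T' fin dis inj by (simp add: card_Un_disjoint card_image)
qed

text \<open>Right half of a sequence \<open>W'/P' -> W/P -> W/Q\<close>: by \<open>dec\<close> the
  part of \<open>Q\<close> in \<open>W\<close> comes from \<open>P\<close> and the image of
  \<open>f\<close>, so the images of a basis of \<open>W'\<close> modulo \<open>P'\<close> and a
  basis of \<open>W\<close> modulo \<open>Q\<close> together span. \<open>P'\<close> may be larger
  than \<open>P\<close>, as for elements that \<open>f\<close> multiplies into
  \<open>P\<close>.\<close>

lemma codim_exact_le:
  assumes lin: "\<And>x y. f (x + y) = f x + f y" "\<And>c x. f (c \<odot> x) = c \<odot> f x"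
    and P: "subspace P" and P': "subspace P'" and Q: "subspace Q" and W: "subspace W"
    and S: "finite S" "W \<subseteq> span (Q \<union> S)" and S': "finite S'" "W' \<subseteq> span (P' \<union> S')"
    and fP: "\<And>x. x \<in> P' \<Longrightarrow> f x \<in> P"
    and dec: "\<And>x. x \<in> Q \<Longrightarrow> x \<in> W \<Longrightarrow> \<exists>p\<in>P. \<exists>g\<in>W'. x = p + f g"
  shows "codim W P \<le> codim W' P' + codim W Q"
proof -
  obtain T where T: "T \<subseteq> W" "indep_mod Q T" "card T = codim W Q" "W \<subseteq> span (Q \<union> T)"
    by (rule codim_basis[OF Q S])
  obtain T' where T': "T' \<subseteq> W'" "indep_mod P' T'" "card T' = codim W' P'" "W' \<subseteq> span (P' \<union> T')"
    by (rule codim_basis[OF P' S'])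
  have fin: "finite T" "finite T'" using T T' by (simp_all add: indep_mod_def)
  have f0: "f 0 = 0" using lin(2)[of 0 0] by simp
  have fspan: "f x \<in> span (f ` A)" if "x \<in> span A" for x A
    using that
    by (induction rule: span_induct_alt) (auto simp: f0 lin intro: span_zero span_add span_scale span_base)
  have "W \<subseteq> span (P \<union> (f ` T' \<union> T))"
  proof
    fix x assume x: "x \<in> W"
    then obtain q t where q: "q \<in> Q" "t \<in> span T" "x = q + t"
      using T(4) unfolding span_Un_subspace[OF Q] subset_iff by blast
    have "t \<in> W" using q(2) T(1) W span_minimal by blast
    then have "x - t \<in> W" using x W subspace_diff by blast
    then obtain p g where pg: "p \<in> P" "g \<in> W'" "q = p + f g" using dec q by force
    then obtain p' t' where p': "p' \<in> P'" "t' \<in> span T'" "g = p' + t'"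
      using T'(4) unfolding span_Un_subspace[OF P'] subset_iff by blast
    have 1: "p + f p' \<in> P" using pg p' fP P subspace_add by blast
    have "f t' \<in> span (f ` T' \<union> T)" "t \<in> span (f ` T' \<union> T)"
      using fspan[OF p'(2)] q(2) span_mono[of "f ` T'" "f ` T' \<union> T"] span_mono[of T "f ` T' \<union> T"] by auto
    then have "f t' + t \<in> span (f ` T' \<union> T)" by (rule span_add)
    moreover have "x = (p + f p') + (f t' + t)" using q pg p' by (simp add: lin algebra_simps)
    ultimately show "x \<in> span (P \<union> (f ` T' \<union> T))"
      using 1 unfolding span_Un_subspace[OF P] by blast
  qed
  then have "codim W P \<le> card (f ` T' \<union> T)"
    using codim_le_card[OF P, of "f ` T' \<union> T" W] fin by simp
  also have "\<dots> \<le> card T' + card T"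
    using card_Un_le[of "f ` T'" T] card_image_le[OF fin(2), of f] by linarith
  finally show ?thesis using T T' by simp
qed

end

section \<open>Graded ideals and Hilbert functions\<close>

interpretation vs: codim_space "\<lambda>(c :: 'k::field) (p :: ('x, 'k) mpoly). const c * p"
  by unfold_locales (simp_all add: algebra_simps const_add const_mult)

text \<open>A ring is a module over itself with the ideals as submodules, and
  \<open>idl.span\<close> is the generated ideal. The preceding \<open>vs\<close> treats the same
  polynomials as vectors over the coefficient field.\<close>

interpretation idl: Modules.module "(*) :: 'a::comm_ring_1 \<Rightarrow> 'a \<Rightarrow> 'a"
  by unfold_locales (simp_all add: algebra_simps)

declare idl.scale_scale [simp del] vs.scale_scale [simp del]

lemma ideal_subspace: "idl.subspace J \<Longrightarrow> vs.subspace J"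
  by (simp add: idl.subspace_def vs.subspace_def)

lemma idl_mult_right: "idl.subspace J \<Longrightarrow> x \<in> J \<Longrightarrow> x * y \<in> J"
  using idl.subspace_scale[of J x y] by (simp add: mult.commute)

lemma idl_span_Un_single:
  assumes "idl.subspace J"
  shows "x \<in> idl.span (J \<union> {l}) \<longleftrightarrow> (\<exists>j\<in>J. \<exists>q. x = j + q * l)"
proof -
  have e: "idl.span J = J" using assms by simp
  show ?thesis
    unfolding idl.span_Un idl.span_singleton e by auto
qed

lemma idl_span_Un_span: "idl.span (idl.span (J \<union> F) \<union> G) = idl.span (J \<union> (F \<union> G))"
proof -
  have "idl.span (J \<union> F) \<subseteq> idl.span (J \<union> (F \<union> G))" by (intro idl.span_mono) auto
  moreover have "G \<subseteq> idl.span (J \<union> (F \<union> G))" by (auto intro: idl.span_base)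
  ultimately have "idl.span (idl.span (J \<union> F) \<union> G) \<subseteq> idl.span (J \<union> (F \<union> G))"
    by (intro idl.span_minimal) auto
  moreover have "J \<union> (F \<union> G) \<subseteq> idl.span (J \<union> F) \<union> G"
    using idl.span_superset[of "J \<union> F"] by auto
  then have "idl.span (J \<union> (F \<union> G)) \<subseteq> idl.span (idl.span (J \<union> F) \<union> G)"
    by (rule idl.span_mono)
  ultimately show ?thesis by blast
qed

section \<open>Polynomials with prescribed exponents and graded ideals\<close>

definition polys_on :: "('x \<Rightarrow>\<^sub>0 nat) set \<Rightarrow> ('x, 'k::zero) mpoly set"
  where "polys_on E = {p. keys p \<subseteq> E}"

abbreviation homog :: "nat \<Rightarrow> ('x::finite, 'k::zero) mpoly set"
  where "homog d \<equiv> polys_on {\<nu>. exp_degree \<nu> = d}"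

abbreviation deg_le :: "nat \<Rightarrow> ('x::finite, 'k::zero) mpoly set"
  where "deg_le d \<equiv> polys_on {\<nu>. exp_degree \<nu> \<le> d}"

lemma linear_form_iff: "linear_form f \<longleftrightarrow> f \<in> homog 1"
  by (auto simp: linear_form_def polys_on_def)

lemma subspace_polys_on: "vs.subspace (polys_on E :: ('x, 'k::field) mpoly set)"
proof (rule vs.subspaceI)
  fix x y :: "('x, 'k) mpoly" and c :: 'k
  assume x: "x \<in> polys_on E"
  show "const c * x \<in> polys_on E"
    using x by (auto simp: polys_on_def in_keys_iff lookup_const_mult)
  assume y: "y \<in> polys_on E"
  show "x + y \<in> polys_on E"
    using x y keys_add[of x y] by (auto simp: polys_on_def)
qed (simp add: polys_on_def)

lemma polys_on_0 [simp]: "0 \<in> polys_on E"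
  by (simp add: polys_on_def)

lemma polys_on_mono: "E \<subseteq> Y \<Longrightarrow> polys_on E \<subseteq> polys_on Y"
  by (auto simp: polys_on_def)

lemma monomial_in_polys_on [simp]:
  "(monomial \<nu> :: ('x, 'k::zero_neq_one) mpoly) \<in> polys_on E \<longleftrightarrow> \<nu> \<in> E"
  by (simp add: polys_on_def)

lemma var_in_homog: "(var i :: ('x::finite, 'k::comm_semiring_1) mpoly) \<in> homog 1"
  by (simp add: var_eq_monomial)

lemma polys_on_span: "(polys_on E :: ('x, 'k::field) mpoly set) \<subseteq> vs.span (monomial ` E)"
proof
  fix p :: "('x, 'k) mpoly" assume "p \<in> polys_on E"
  then have "keys p \<subseteq> E" by (simp add: polys_on_def)
  then have "(\<Sum>\<nu>\<in>keys p. const (lookup p \<nu>) * monomial \<nu>)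
      \<in> vs.span (monomial ` E)"
    by (intro vs.span_sum vs.span_scale vs.span_base) auto
  then show "p \<in> vs.span (monomial ` E)"
    using mpoly_expand_keys[of p] by simp
qed

lemma polys_on_subset_span: "polys_on E \<subseteq> vs.span (V \<union> monomial ` E)"
  using polys_on_span vs.span_mono[of "monomial ` E" "V \<union> monomial ` E"] by blast

lemma polys_on_subset_subspace:
  assumes "vs.subspace V" "\<And>\<nu>. \<nu> \<in> E \<Longrightarrow> monomial \<nu> \<in> V"
  shows "polys_on E \<subseteq> V"
  using polys_on_span[of E] vs.span_minimal[of "monomial ` E" V] assms by blast

lemma polys_on_mult:
  assumes "p \<in> polys_on E" "q \<in> polys_on Y" "\<And>\<mu> \<nu>. \<mu> \<in> E \<Longrightarrow> \<nu> \<in> Y \<Longrightarrow> \<mu> + \<nu> \<in> Z"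
  shows "p * q \<in> polys_on Z"
  using keys_mult[of p q] assms unfolding polys_on_def by blast

lemma homog_mult: "p \<in> homog a \<Longrightarrow> q \<in> homog b \<Longrightarrow> p * q \<in> homog (a + b)"
  by (erule polys_on_mult) (auto simp: exp_degree_add)

lemma finite_exp_degree_eq: "finite {\<nu> :: 'x::finite \<Rightarrow>\<^sub>0 nat. exp_degree \<nu> = d}"
  by (rule finite_subset[OF _ finite_exp_degree_le[of d]]) auto

lemma const_in_homog: "const c \<in> homog 0"
  by (simp add: const_def polys_on_def)

lemma homog_power: "(p :: ('x::finite, 'k::comm_ring_1) mpoly) \<in> homog a \<Longrightarrow> p ^ n \<in> homog (a * n)"
proof (induction n)
  case 0
  then show ?case using const_in_homog[of "1 :: 'k"] by simp
next
  case (Suc n)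
  then show ?case using homog_mult[of p a "p ^ n" "a * n"] by simp
qed

lemma homog_prod:
  assumes "\<And>i. i \<in> S \<Longrightarrow> (f i :: ('x::finite, 'k::comm_ring_1) mpoly) \<in> homog (a i)"
  shows "(\<Prod>i\<in>S. f i) \<in> homog (\<Sum>i\<in>S. a i)"
  using assms
proof (induction S rule: infinite_finite_induct)
  case (insert x F)
  then show ?case using homog_mult[of "f x" "a x" "\<Prod>i\<in>F. f i" "\<Sum>i\<in>F. a i"] by simp
qed (use const_in_homog[of "1 :: 'k"] in simp_all)

lemma terms_satisfying_in_polys_on: "terms_satisfying P f \<in> polys_on {\<nu>. P \<nu>}"
  by (auto simp: polys_on_def keys_terms_satisfying)

lemma terms_satisfying_polys_on:
  "f \<in> polys_on E \<Longrightarrow> (\<And>\<nu>. \<nu> \<in> E \<Longrightarrow> P \<nu>) \<Longrightarrow> terms_satisfying P f = f"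
  by (rule terms_satisfying_id) (auto simp: polys_on_def)

text \<open>Multiplication by a form of degree \<open>e\<close> shifts all degrees by
  \<open>e\<close>. The predicate \<open>Q\<close> is left open so that components of degree
  \<open>d\<close> and truncations to degree at most \<open>d\<close> are covered alike.\<close>

lemma terms_satisfying_homog_mult:
  fixes q l :: "('x::finite, 'k::comm_ring_1) mpoly"
  assumes "l \<in> homog e"
  shows "terms_satisfying (\<lambda>\<nu>. Q (exp_degree \<nu>)) (q * l) =
    terms_satisfying (\<lambda>\<nu>. Q (exp_degree \<nu> + e)) q * l"
proof (induction q rule: mpoly_induct)
  case (add c \<mu> p)
  have deg: "exp_degree \<nu> = exp_degree \<mu> + e"
    if nu: "\<nu> \<in> keys (monomial \<mu> * l)" for \<nu>
  proof -
    obtain a b where "\<nu> = a + b" "a \<in> keys (monomial \<mu> :: ('x, 'k) mpoly)" "b \<in> keys l"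
      using nu keys_mult[of "monomial \<mu>" l] by blast
    then show ?thesis using assms by (auto simp: polys_on_def exp_degree_add)
  qed
  have m: "terms_satisfying (\<lambda>\<nu>. Q (exp_degree \<nu>)) (monomial \<mu> * l) =
      terms_satisfying (\<lambda>\<nu>. Q (exp_degree \<nu> + e)) (monomial \<mu>) * l"
  proof (cases "Q (exp_degree \<mu> + e)")
    case True
    then have "terms_satisfying (\<lambda>\<nu>. Q (exp_degree \<nu>)) (monomial \<mu> * l) = monomial \<mu> * l"
      by (intro terms_satisfying_id) (simp add: deg)
    moreover have "terms_satisfying (\<lambda>\<nu>. Q (exp_degree \<nu> + e)) (monomial \<mu> :: ('x, 'k) mpoly) = monomial \<mu>"
      using True by (intro terms_satisfying_id) simp
    ultimately show ?thesis by simp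
  next
    case False
    then have "terms_satisfying (\<lambda>\<nu>. Q (exp_degree \<nu>)) (monomial \<mu> * l) = 0"
      by (intro terms_satisfying_none) (simp add: deg)
    moreover have "terms_satisfying (\<lambda>\<nu>. Q (exp_degree \<nu> + e)) (monomial \<mu> :: ('x, 'k) mpoly) = 0"
      using False by (intro terms_satisfying_none) simp
    ultimately show ?thesis by simp
  qed
  show ?case
    unfolding distrib_right terms_satisfying_add terms_satisfying_const_mult mult.assoc add m ..
qed simp

lemma graded_terms_satisfying:
  fixes f :: "('x::finite, 'k::field) mpoly"
  assumes "graded J" "vs.subspace J" "f \<in> J"
  shows "terms_satisfying (\<lambda>\<nu>. Q (exp_degree \<nu>)) f \<in> J"
proof -
  let ?D = "{d \<in> exp_degree ` keys f. Q d}"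
  have "terms_satisfying (\<lambda>\<nu>. Q (exp_degree \<nu>)) f = (\<Sum>d\<in>?D. homog_part d f)"
  proof (rule poly_mapping_eqI)
    fix \<nu>
    show "lookup (terms_satisfying (\<lambda>\<nu>. Q (exp_degree \<nu>)) f) \<nu> =
        lookup (\<Sum>d\<in>?D. homog_part d f) \<nu>"
      unfolding lookup_sum lookup_terms_satisfying
      by (cases "\<nu> \<in> keys f") (auto simp: in_keys_iff)
  qed
  also have "\<dots> \<in> J"
    using assms by (intro vs.subspace_sum) (auto simp: graded_def)
  finally show ?thesis .
qed

lemma sum_homog_components:
  fixes f :: "('x::finite, 'k::field) mpoly"
  shows "f = (\<Sum>d\<in>exp_degree ` keys f. homog_part d f)"
proof (rule poly_mapping_eqI)
  fix \<nu>
  show "lookup f \<nu> =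
      lookup (\<Sum>d\<in>exp_degree ` keys f. homog_part d f) \<nu>"
    unfolding lookup_sum lookup_terms_satisfying
    by (cases "\<nu> \<in> keys f") (auto simp: in_keys_iff)
qed

lemma graded_span_homog:
  fixes S :: "('x::finite, 'k::field) mpoly set"
  assumes "\<And>s d. s \<in> S \<Longrightarrow> homog_part d s \<in> idl.span S"
  shows "graded (idl.span S)"
  unfolding graded_def
proof (intro ballI allI)
  fix f d assume "f \<in> idl.span S"
  then show "homog_part d f \<in> idl.span S"
  proof (induction rule: idl.span_induct_alt)
    case base
    then show ?case by (simp add: idl.span_zero)
  next
    case (step c x y)
    let ?h = "\<lambda>e. homog_part e x"
    have x: "x = (\<Sum>e\<in>exp_degree ` keys x. ?h e)"
      by (rule sum_homog_components)
    have "homog_part d (c * x)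
        = (\<Sum>e\<in>exp_degree ` keys x. homog_part d (c * ?h e))"
      by (subst x) (simp add: sum_distrib_left terms_satisfying_sum)
    also have "\<dots> = (\<Sum>e\<in>exp_degree ` keys x.
        terms_satisfying (\<lambda>\<nu>. exp_degree \<nu> + e = d) c * ?h e)"
      by (rule sum.cong)
        (auto intro!: terms_satisfying_homog_mult[where Q = "\<lambda>n. n = d"] terms_satisfying_in_polys_on)
    also have "\<dots> \<in> idl.span S"
      using step(1) assms by (intro idl.span_sum idl.span_scale) auto
    finally show ?case
      using step by (simp add: terms_satisfying_add idl.span_add)
  qed
qed

lemma graded_add_homog:
  fixes J :: "('x::finite, 'k::field) mpoly set"
  assumes "graded J" "\<And>f. f \<in> F \<Longrightarrow> f \<in> homog (e f)"
  shows "graded (idl.span (J \<union> F))"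
proof (rule graded_span_homog)
  fix s d assume "s \<in> J \<union> F"
  then show "homog_part d s \<in> idl.span (J \<union> F)"
  proof
    assume "s \<in> J"
    then show ?thesis using assms(1) by (auto simp: graded_def intro: idl.span_base)
  next
    assume s: "s \<in> F"
    show ?thesis
    proof (cases "e s = d")
      case True
      then have "homog_part d s = s"
        using assms(2)[OF s] by (intro terms_satisfying_id) (auto simp: polys_on_def)
      then show ?thesis using s by (auto intro: idl.span_base)
    next
      case False
      then have "homog_part d s = 0"
        using assms(2)[OF s] by (intro terms_satisfying_none) (auto simp: polys_on_def)
      then show ?thesis by (simp add: idl.span_zero)
    qed
  qed
qed

lemma exp_degree_SucE:
  assumes "exp_degree \<nu> = Suc d"
  obtains \<mu> i where "\<nu> = \<mu> + single i 1" "exp_degree \<mu> = d"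
proof -
  have "\<exists>i. lookup \<nu> i \<noteq> 0"
  proof (rule ccontr)
    assume "\<not> ?thesis"
    then have "exp_degree \<nu> = 0" by (simp add: exp_degree_def)
    then show False using assms by simp
  qed
  then obtain i where i: "lookup \<nu> i \<noteq> 0" by blast
  define \<mu> where "\<mu> = \<nu> - single i 1"
  have e: "\<nu> = \<mu> + single i 1"
    unfolding \<mu>_def
    by (rule poly_mapping_eqI) (use i in \<open>auto simp: lookup_add lookup_minus lookup_single when_def\<close>)
  have "exp_degree \<mu> = d" using assms by (simp add: e exp_degree_add)
  then show ?thesis using that e by blast
qed

lemma homog_subset_ideal_mono:
  fixes J :: "('x::finite, 'k::field) mpoly set"
  assumes J: "idl.subspace J" and N: "homog N \<subseteq> J" and le: "N \<le> d"
  shows "homog d \<subseteq> J"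
  using le
proof (induction d rule: dec_induct)
  case (step d)
  show ?case
  proof (rule polys_on_subset_subspace[OF ideal_subspace[OF J]])
    fix \<nu> :: "'x \<Rightarrow>\<^sub>0 nat" assume nu: "\<nu> \<in> {\<nu>. exp_degree \<nu> = Suc d}"
    then obtain \<mu> i where e: "\<nu> = \<mu> + single i 1" and "exp_degree \<mu> = d"
      using exp_degree_SucE by blast
    then have "monomial \<mu> \<in> J" by (intro subsetD[OF step.IH]) simp
    then have "monomial \<mu> * var i \<in> J" by (rule idl_mult_right[OF J])
    then show "monomial \<nu> \<in> J" unfolding e monomial_times_var .
  qed
qed (rule N)

section \<open>Hilbert functions and exact sequences\<close>

definition hilb :: "('x::finite, 'k::field) mpoly set \<Rightarrow> nat \<Rightarrow> nat"
  where "hilb J d = vs.codim (homog d) J"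

text \<open>The affine Hilbert function, which filters by degree instead of grading. It is
  meaningful for ideals that are not graded, such as the primes of an arbitrary chain.\<close>

definition ahilb :: "('x::finite, 'k::field) mpoly set \<Rightarrow> nat \<Rightarrow> nat"
  where "ahilb J d = vs.codim (deg_le d) J"

lemmas hilb_fin = finite_imageI[OF finite_exp_degree_eq] polys_on_subset_span
lemmas ahilb_fin = finite_imageI[OF finite_exp_degree_le] polys_on_subset_span

lemma hilb_antimono: "idl.subspace J \<Longrightarrow> idl.subspace J' \<Longrightarrow> J \<subseteq> J' \<Longrightarrow> hilb J' d \<le> hilb J d"
  unfolding hilb_def by (intro vs.codim_antimono[OF _ _ hilb_fin] ideal_subspace)

lemma ahilb_antimono: "idl.subspace J \<Longrightarrow> idl.subspace J' \<Longrightarrow> J \<subseteq> J' \<Longrightarrow> ahilb J' d \<le> ahilb J d"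
  unfolding ahilb_def by (intro vs.codim_antimono[OF _ _ ahilb_fin] ideal_subspace)

lemma ahilb_mono: "idl.subspace J \<Longrightarrow> d \<le> e \<Longrightarrow> ahilb J d \<le> ahilb J e"
  unfolding ahilb_def by (intro vs.codim_mono[OF _ ahilb_fin] ideal_subspace polys_on_mono) auto

text \<open>Write \<open>x = j + q * l\<close> and keep the terms of the degrees selected by
  \<open>Q\<close>: gradedness leaves the first summand in \<open>J\<close>, and \<open>q\<close> is
  cut to the degrees shifted by \<open>e\<close>. This is the exactness that
  \<open>codim_mult_le\<close> asks for.\<close>

lemma in_span_single_terms:
  fixes J :: "('x::finite, 'k::field) mpoly set"
  assumes J: "idl.subspace J" "graded J" and l: "l \<in> homog e" and x: "x \<in> idl.span (J \<union> {l})"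
    and xQ: "x \<in> polys_on {\<nu>. Q (exp_degree \<nu>)}"
  shows "\<exists>p\<in>J. \<exists>g\<in>polys_on {\<nu>. Q (exp_degree \<nu> + e)}. x = p + l * g"
proof -
  obtain j q where jq: "j \<in> J" "x = j + q * l"
    using x idl_span_Un_single[OF J(1)] by blast
  have "x = terms_satisfying (\<lambda>\<nu>. Q (exp_degree \<nu>)) x"
    using xQ by (intro terms_satisfying_polys_on[symmetric]) auto
  also have "\<dots> = terms_satisfying (\<lambda>\<nu>. Q (exp_degree \<nu>)) j + terms_satisfying (\<lambda>\<nu>. Q (exp_degree \<nu> + e)) q * l"
    unfolding jq(2) terms_satisfying_add terms_satisfying_homog_mult[OF l] ..
  finally show ?thesis
    using graded_terms_satisfying[OF J(2) ideal_subspace[OF J(1)] jq(1)]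
      terms_satisfying_in_polys_on by (metis mult.commute)
qed

lemma codim_zero: "vs.subspace V \<Longrightarrow> vs.codim {0} V = 0"
  using vs.codim_le_card[of V "{}" "{0}"] by (simp add: vs.subspace_0)

lemma codim_mult_le:
  fixes P P' Q :: "('x, 'k::field) mpoly set"
  assumes "idl.subspace P" "idl.subspace P'" "idl.subspace Q"
    and "finite S" "polys_on E \<subseteq> vs.span (Q \<union> S)" "finite S'" "W' \<subseteq> vs.span (P' \<union> S')"
    and "\<And>x. x \<in> P' \<Longrightarrow> f * x \<in> P"
    and "\<And>x. x \<in> Q \<Longrightarrow> x \<in> polys_on E \<Longrightarrow> \<exists>p\<in>P. \<exists>g\<in>W'. x = p + f * g"
  shows "vs.codim (polys_on E) P \<le> vs.codim W' P' + vs.codim (polys_on E) Q"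
  by (rule vs.codim_exact_le[OF distrib_left mult.left_commute ideal_subspace[OF assms(1)]
        ideal_subspace[OF assms(2)] ideal_subspace[OF assms(3)] subspace_polys_on assms(4-)])

lemma codim_mult_ge:
  fixes P Q :: "('x, 'k::field) mpoly set"
  assumes "idl.subspace P" "idl.subspace Q" "P \<subseteq> Q"
    and "finite S" "W \<subseteq> vs.span (P \<union> S)" "finite S'" "polys_on E \<subseteq> vs.span (P \<union> S')"
    and "\<And>x. x \<in> polys_on E \<Longrightarrow> f * x \<in> W" "f \<in> Q"
    and "\<And>x. f * x \<in> P \<Longrightarrow> x \<in> P"
  shows "vs.codim W Q + vs.codim (polys_on E) P \<le> vs.codim W P"
  by (rule vs.codim_exact_ge[OF distrib_left mult.left_commute ideal_subspace[OF assms(1)]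
        ideal_subspace[OF assms(2)] assms(3) subspace_polys_on assms(4-7) image_subsetI[OF assms(8)]
        idl_mult_right[OF assms(2,9)] assms(10)])

context
  fixes J :: "('x::finite, 'k::field) mpoly set" and l :: "('x, 'k) mpoly"
  assumes J: "idl.subspace J" "graded J" and l: "l \<in> homog 1"
begin

text \<open>In degree 0 a multiple of a linear form contributes nothing, so the source of the
  multiplication is the zero space.\<close>

lemma hilb_0_le: "hilb J 0 \<le> hilb (idl.span (J \<union> {l})) 0"
proof -
  have "vs.codim (homog 0) J \<le> vs.codim {0} J + vs.codim (homog 0) (idl.span (J \<union> {l}))"
  proof (rule codim_mult_le[where f = l, OF J(1) J(1) idl.subspace_span hilb_fin finite.emptyI])
    show "{0} \<subseteq> vs.span (J \<union> {})" by (simp add: vs.span_zero)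
    fix x assume x: "x \<in> idl.span (J \<union> {l})" "x \<in> homog 0"
    obtain p g where "p \<in> J" "g \<in> polys_on {\<nu>. exp_degree \<nu> + 1 = 0}" "x = p + l * g"
      using in_span_single_terms[OF J l x(1), where Q = "\<lambda>n. n = 0"] x(2) by auto
    then show "\<exists>p\<in>J. \<exists>g\<in>{0}. x = p + l * g"
      by (auto simp: polys_on_def)
  qed (rule idl.subspace_scale[OF J(1)])
  then show ?thesis
    by (simp add: hilb_def codim_zero[OF ideal_subspace[OF J(1)]])
qed

text \<open>Multiplication by \<open>l\<close> maps degree \<open>d\<close> of the quotient by
  \<open>J\<close> onto the kernel of the projection in degree \<open>d + 1\<close>.\<close>

lemma hilb_Suc_le: "hilb J (Suc d) \<le> hilb J d + hilb (idl.span (J \<union> {l})) (Suc d)"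
  unfolding hilb_def
proof (rule codim_mult_le[where f = l, OF J(1) J(1) idl.subspace_span hilb_fin hilb_fin])
  fix x assume x: "x \<in> idl.span (J \<union> {l})" "x \<in> homog (Suc d)"
  show "\<exists>p\<in>J. \<exists>g\<in>homog d. x = p + l * g"
    using in_span_single_terms[OF J l x(1), where Q = "\<lambda>n. n = Suc d"] x(2) by auto
qed (rule idl.subspace_scale[OF J(1)])

lemma ahilb_0_le: "ahilb J 0 \<le> ahilb (idl.span (J \<union> {l})) 0"
  using hilb_0_le by (simp add: hilb_def ahilb_def)

lemma ahilb_Suc_le: "ahilb J (Suc d) \<le> ahilb J d + ahilb (idl.span (J \<union> {l})) (Suc d)"
  unfolding ahilb_def
proof (rule codim_mult_le[where f = l, OF J(1) J(1) idl.subspace_span ahilb_fin ahilb_fin])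
  fix x assume x: "x \<in> idl.span (J \<union> {l})" "x \<in> deg_le (Suc d)"
  show "\<exists>p\<in>J. \<exists>g\<in>deg_le d. x = p + l * g"
    using in_span_single_terms[OF J l x(1), where Q = "\<lambda>n. n \<le> Suc d"] x(2) by auto
qed (rule idl.subspace_scale[OF J(1)])

lemma hilb_le_sum: "hilb J d \<le> (\<Sum>e\<le>d. hilb (idl.span (J \<union> {l})) e)"
proof (induction d)
  case (Suc d)
  then show ?case using hilb_Suc_le[of d] by simp
qed (use hilb_0_le in simp)

lemma ahilb_le_sum: "ahilb J d \<le> (\<Sum>e\<le>d. ahilb (idl.span (J \<union> {l})) e)"
proof (induction d)
  case (Suc d)
  then show ?case using ahilb_Suc_le[of d] by simp
qed (use ahilb_0_le in simp)

end

text \<open>Multiplication by \<open>a\<close> is well defined on the quotient by \<open>J\<close>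
  and \<open>b\<close>, since \<open>a * b\<close> lies in \<open>J\<close>. Its image is the kernel
  of the passage from the quotient by \<open>J\<close> to that by \<open>J\<close> and
  \<open>a\<close>.\<close>

lemma ahilb_product_le:
  fixes J :: "('x::finite, 'k::field) mpoly set"
  assumes J: "idl.subspace J" "graded J" and a: "a \<in> homog e" and ab: "a * b \<in> J"
  shows "ahilb J d \<le> ahilb (idl.span (J \<union> {b})) d + ahilb (idl.span (J \<union> {a})) d"
  unfolding ahilb_def
proof (rule codim_mult_le[where f = a, OF J(1) idl.subspace_span idl.subspace_span ahilb_fin ahilb_fin])
  fix x assume x: "x \<in> idl.span (J \<union> {a})" "x \<in> deg_le d"
  obtain p g where pg: "p \<in> J" "g \<in> polys_on {\<nu>. exp_degree \<nu> + e \<le> d}" "x = p + a * g"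
    using in_span_single_terms[OF J a x(1), where Q = "\<lambda>n. n \<le> d"] x(2) by auto
  have "polys_on {\<nu>. exp_degree \<nu> + e \<le> d} \<subseteq> (deg_le d :: ('x, 'k) mpoly set)"
    by (rule polys_on_mono) auto
  then show "\<exists>p\<in>J. \<exists>g\<in>deg_le d. x = p + a * g" using pg by blast
next
  fix x assume "x \<in> idl.span (J \<union> {b})"
  then obtain j q where jq: "j \<in> J" "x = j + q * b" using idl_span_Un_single[OF J(1)] by blast
  have "a * j + q * (a * b) \<in> J"
    by (intro idl.subspace_add[OF J(1)] idl.subspace_scale[OF J(1)] jq ab)
  then show "a * x \<in> J" using jq(2) by (simp add: algebra_simps)
qed

text \<open>Multiplication by \<open>f\<close> embeds degree at most \<open>d\<close> modulo
  \<open>P\<close> into the kernel of the projection to \<open>Q\<close> in degree at most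
  \<open>d + e\<close>. The ideals are arbitrary, which allows two successive primes of a
  chain.\<close>

lemma ahilb_regular:
  fixes P Q :: "('x::finite, 'k::field) mpoly set"
  assumes P: "idl.subspace P" and Q: "idl.subspace Q" "P \<subseteq> Q" and f: "f \<in> Q" "f \<in> deg_le e"
    and reg: "\<And>x. f * x \<in> P \<Longrightarrow> x \<in> P"
  shows "ahilb Q (d + e) + ahilb P d \<le> ahilb P (d + e)"
  unfolding ahilb_def
proof (rule codim_mult_ge[where f = f, OF P Q ahilb_fin ahilb_fin _ f(1) reg])
  fix x :: "('x, 'k) mpoly" assume "x \<in> deg_le d"
  then show "f * x \<in> deg_le (d + e)"
    by (rule polys_on_mult[OF f(2)]) (auto simp: exp_degree_add)
qed

lemma hilb_regular:
  fixes P Q :: "('x::finite, 'k::field) mpoly set"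
  assumes P: "idl.subspace P" and Q: "idl.subspace Q" "P \<subseteq> Q" and f: "f \<in> Q" "f \<in> homog 1"
    and reg: "\<And>x. f * x \<in> P \<Longrightarrow> x \<in> P"
  shows "hilb Q (Suc d) + hilb P d \<le> hilb P (Suc d)"
  unfolding hilb_def
proof (rule codim_mult_ge[where f = f, OF P Q hilb_fin hilb_fin _ f(1) reg])
  fix x :: "('x, 'k) mpoly" assume "x \<in> homog d"
  then show "f * x \<in> homog (Suc d)"
    using homog_mult[OF f(2)] by fastforce
qed

text \<open>The inequality \<open>hilb_regular\<close> telescopes; degree 0 is covered by
  monotonicity.\<close>

lemma hilb_regular_sum:
  fixes P Q :: "('x::finite, 'k::field) mpoly set"
  assumes P: "idl.subspace P" and Q: "idl.subspace Q" "P \<subseteq> Q" and f: "f \<in> Q" "f \<in> homog 1"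
    and reg: "\<And>x. f * x \<in> P \<Longrightarrow> x \<in> P"
  shows "(\<Sum>e\<le>d. hilb Q e) \<le> hilb P d"
proof (induction d)
  case 0
  then show ?case using hilb_antimono[OF P Q] by simp
next
  case (Suc d)
  then show ?case using hilb_regular[OF P Q f reg, of d] by simp
qed

section \<open>Systems of parameters and growth\<close>

text \<open>Linear systems of parameters: the quotient by \<open>J\<close> and \<open>F\<close>
  vanishes in some degree, hence in all larger ones. Since at most \<open>k\<close> forms are asked
  for, the property is monotone in \<open>k\<close>.\<close>

definition params :: "('x::finite, 'k::field) mpoly set \<Rightarrow> nat \<Rightarrow> bool"
  where "params J k \<longleftrightarrow> (\<exists>F. finite F \<and> card F \<le> k \<and> F \<subseteq> homog 1 \<and>
    (\<exists>N. homog N \<subseteq> idl.span (J \<union> F)))"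

text \<open>The base \<open>d + 1\<close> is positive, so that a larger exponent always gives a
  weaker bound, also at \<open>d = 0\<close>.\<close>

definition growth_le :: "('x::finite, 'k::field) mpoly set \<Rightarrow> nat \<Rightarrow> bool"
  where "growth_le J k \<longleftrightarrow> (\<exists>C. \<forall>d. ahilb J d \<le> C * (d + 1) ^ k)"

lemma params_mono: "params J k \<Longrightarrow> k \<le> k' \<Longrightarrow> params J k'"
  unfolding params_def by (meson le_trans)

lemma params_add_form:
  assumes "params (idl.span (J \<union> {l})) k" "l \<in> homog 1"
  shows "params J (Suc k)"
proof -
  obtain F N where F: "finite F" "card F \<le> k" "F \<subseteq> homog 1" "homog N \<subseteq> idl.span (idl.span (J \<union> {l}) \<union> F)"
    using assms(1) unfolding params_def by blast
  then have "homog N \<subseteq> idl.span (J \<union> insert l F)"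
    unfolding idl_span_Un_span by simp
  moreover have "card (insert l F) \<le> Suc k"
    using F by (simp add: card_insert_if)
  moreover have "finite (insert l F)" "insert l F \<subseteq> homog 1" using F assms(2) by simp_all
  ultimately show ?thesis unfolding params_def by blast
qed

lemma growth_le_antimono:
  assumes "growth_le J k" "idl.subspace J" "idl.subspace J'" "J \<subseteq> J'"
  shows "growth_le J' k"
  using assms(1) ahilb_antimono[OF assms(2-4)] unfolding growth_le_def by (meson le_trans)

lemma graded_add_form:
  fixes J :: "('x::finite, 'k::field) mpoly set"
  assumes "graded J" "F \<subseteq> homog e"
  shows "graded (idl.span (J \<union> F))"
  using assms(2) by (intro graded_add_homog[OF assms(1), of F "\<lambda>_. e"]) blast

text \<open>Without parameters the quotient has finite dimension. Each parameter bounds the affine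
  Hilbert function by a sum of \<open>d + 1\<close> values for the larger ideal, which costs one
  power of \<open>d + 1\<close>.\<close>

lemma params_imp_growth:
  fixes J :: "('x::finite, 'k::field) mpoly set"
  assumes "idl.subspace J" "graded J" "params J k"
  shows "growth_le J k"
proof -
  have main: "growth_le J (card F)"
    if "finite F" "idl.subspace J" "graded J" "F \<subseteq> homog 1" "homog N \<subseteq> idl.span (J \<union> F)"
    for F :: "('x, 'k) mpoly set" and J N
    using that
  proof (induction F arbitrary: J)
    case empty
    have e: "idl.span (J \<union> {}) = J" using empty.prems(1) by simp
    have N: "homog N \<subseteq> J" using empty.prems(4) unfolding e .
    \<comment> \<open>Monomials of degree above \<open>N\<close> lie in \<open>J\<close>, so these
      finitely many span everything modulo \<open>J\<close>.\<close>
    let ?M = "monomial ` {\<nu>. exp_degree \<nu> \<le> N} :: ('x, 'k) mpoly set"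
    have "ahilb J d \<le> card ?M" for d
      unfolding ahilb_def
    proof (rule vs.codim_le_card)
      show "deg_le d \<subseteq> vs.span (J \<union> ?M)"
      proof (rule polys_on_subset_subspace)
        fix \<nu> :: "'x \<Rightarrow>\<^sub>0 nat"
        show "monomial \<nu> \<in> vs.span (J \<union> ?M)"
        proof (cases "exp_degree \<nu> \<le> N")
          case False
          then have "homog (exp_degree \<nu>) \<subseteq> J"
            using homog_subset_ideal_mono[OF empty.prems(1) N] by simp
          then have "monomial \<nu> \<in> J" by (rule subsetD) simp
          then show ?thesis by (intro vs.span_base) simp
        qed (intro vs.span_base, simp)
      qed simp
    qed (use empty.prems(1) in \<open>simp_all add: ideal_subspace finite_exp_degree_le\<close>)
    then show ?case unfolding growth_le_def by (intro exI[of _ "card ?M"]) simp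
  next
    case (insert l F)
    let ?J = "idl.span (J \<union> {l})"
    have "J \<union> insert l F = J \<union> ({l} \<union> F)" by simp
    then have "homog N \<subseteq> idl.span (?J \<union> F)"
      unfolding idl_span_Un_span using insert.prems by simp
    moreover have "graded ?J" using insert.prems by (intro graded_add_form) auto
    ultimately obtain C where C: "\<And>d. ahilb ?J d \<le> C * (d + 1) ^ card F"
      using insert.IH[of ?J] insert.prems unfolding growth_le_def by auto
    have "ahilb J d \<le> C * (d + 1) ^ card (insert l F)" for d
    proof -
      have "ahilb J d \<le> (\<Sum>e\<le>d. ahilb ?J e)"
        by (rule ahilb_le_sum) (use insert.prems in auto)
      also have "\<dots> \<le> (\<Sum>e\<le>d. C * (d + 1) ^ card F)"
      proof (rule sum_mono)
        fix e assume "e \<in> {..d}"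
        then have "(e + 1) ^ card F \<le> (d + 1) ^ card F" by (intro power_mono) auto
        then show "ahilb ?J e \<le> C * (d + 1) ^ card F"
          using C[of e] mult_le_mono2[of "(e + 1) ^ card F" "(d + 1) ^ card F" C] by linarith
      qed
      also have "\<dots> = C * (d + 1) ^ card (insert l F)"
        using insert.hyps by (simp add: mult_ac)
      finally show ?thesis .
    qed
    then show ?case unfolding growth_le_def by blast
  qed
  obtain F N where F: "finite F" "card F \<le> k" "F \<subseteq> homog 1" "homog N \<subseteq> idl.span (J \<union> F)"
    using assms(3) unfolding params_def by blast
  obtain C where C: "\<And>d. ahilb J d \<le> C * (d + 1) ^ card F"
    using main[OF F(1) assms(1,2) F(3,4)] unfolding growth_le_def by blast
  have "ahilb J d \<le> C * (d + 1) ^ k" for d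
  proof -
    have "(d + 1) ^ card F \<le> (d + 1) ^ k" by (rule power_increasing) (use F in auto)
    then show ?thesis using C[of d] mult_le_mono2 le_trans by blast
  qed
  then show ?thesis unfolding growth_le_def by blast
qed

section \<open>Substitution of linear forms\<close>

lemma idl_prod_cong:
  fixes f g :: "'i \<Rightarrow> 'a::comm_ring_1"
  assumes K: "idl.subspace K" and "\<And>i. i \<in> S \<Longrightarrow> f i - g i \<in> K"
  shows "(\<Prod>i\<in>S. f i) - (\<Prod>i\<in>S. g i) \<in> K"
  using assms(2)
proof (induction S rule: infinite_finite_induct)
  case (insert x S)
  have "f x * ((\<Prod>i\<in>S. f i) - (\<Prod>i\<in>S. g i)) + (\<Prod>i\<in>S. g i) * (f x - g x) \<in> K"
    using insert by (intro idl.subspace_add[OF K] idl.subspace_scale[OF K]) auto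
  then show ?case using insert.hyps by (simp add: algebra_simps)
qed (use K in \<open>simp_all add: idl.subspace_0\<close>)

lemma idl_power_cong:
  fixes x y :: "'a::comm_ring_1"
  assumes "idl.subspace K" "x - y \<in> K"
  shows "x ^ n - y ^ n \<in> K"
  using idl_prod_cong[OF assms(1), of "{..<n}" "\<lambda>_. x" "\<lambda>_. y"] assms(2) by simp

lemma idl_subst_cong:
  fixes p :: "('x::finite, 'k::field) mpoly"
  assumes K: "idl.subspace K" and ab: "\<And>i. a i - b i \<in> K"
  shows "mpoly_eval const a p - mpoly_eval const b p \<in> K"
proof -
  have "mpoly_eval const a p - mpoly_eval const b p = (\<Sum>\<nu>\<in>keys p.
      const (lookup p \<nu>) * ((\<Prod>i\<in>UNIV. a i ^ lookup \<nu> i) - (\<Prod>i\<in>UNIV. b i ^ lookup \<nu> i)))"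
    unfolding mpoly_eval_def by (simp add: sum_subtractf right_diff_distrib)
  also have "\<dots> \<in> K"
    by (intro idl.subspace_sum[OF K] idl.subspace_scale[OF K] idl_prod_cong[OF K] idl_power_cong[OF K] ab)
  finally show ?thesis .
qed

lemma subst_homog:
  fixes p :: "('x::finite, 'k::field) mpoly" and l :: "'x \<Rightarrow> ('x, 'k) mpoly"
  assumes l: "\<And>i. l i \<in> homog 1" and p: "p \<in> homog d"
  shows "mpoly_eval const l p \<in> homog d"
  unfolding mpoly_eval_def
proof (rule vs.subspace_sum[OF subspace_polys_on], rule vs.subspace_scale[OF subspace_polys_on])
  fix \<nu> assume "\<nu> \<in> keys p"
  then have nu: "exp_degree \<nu> = d" using p by (auto simp: polys_on_def)
  have "l i ^ lookup \<nu> i \<in> homog (lookup \<nu> i)" for i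
    using homog_power[OF l, of i "lookup \<nu> i"] by simp
  then have "(\<Prod>i\<in>UNIV. l i ^ lookup \<nu> i) \<in> homog (\<Sum>i\<in>UNIV. lookup \<nu> i)"
    by (intro homog_prod)
  then show "(\<Prod>i\<in>UNIV. l i ^ lookup \<nu> i) \<in> homog d"
    using nu by (simp add: exp_degree_def)
qed

lemma homog_disjoint:
  "p \<in> homog a \<Longrightarrow> a \<noteq> d \<Longrightarrow> homog_part d p = 0"
  by (rule terms_satisfying_none) (auto simp: polys_on_def)

lemma subst_homog_component:
  fixes p :: "('x::finite, 'k::field) mpoly" and l :: "'x \<Rightarrow> ('x, 'k) mpoly"
  assumes l: "\<And>i. l i \<in> homog 1"
  shows "homog_part d (mpoly_eval const l p)
    = mpoly_eval const l (homog_part d p)"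
proof -
  let ?h = "\<lambda>e p. homog_part e (p :: ('x, 'k) mpoly)"
  have h: "?h d q = (if e = d then q else 0)" if "q \<in> homog e" for q :: "('x, 'k) mpoly" and e
    using that homog_disjoint[OF that] by (auto intro: terms_satisfying_polys_on)
  have hp: "?h e p \<in> homog e" for e
    by (rule terms_satisfying_in_polys_on)
  define D where "D = exp_degree ` keys p"
  have p: "p = (\<Sum>e\<in>D. ?h e p)"
    unfolding D_def by (rule sum_homog_components)
  have "?h d (mpoly_eval const l p) = ?h d (mpoly_eval const l (\<Sum>e\<in>D. ?h e p))"
    using p by simp
  also have "\<dots> = (\<Sum>e\<in>D. ?h d (mpoly_eval const l (?h e p)))"
    by (simp only: subst.mpoly_eval_sum terms_satisfying_sum)
  also have "\<dots> = (\<Sum>e\<in>D. mpoly_eval const l (?h d (?h e p)))"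
  proof (rule sum.cong)
    fix e
    show "?h d (mpoly_eval const l (?h e p)) = mpoly_eval const l (?h d (?h e p))"
      unfolding h[OF subst_homog[OF l hp]] h[OF hp] by simp
  qed simp
  also have "\<dots> = mpoly_eval const l (?h d (\<Sum>e\<in>D. ?h e p))"
    by (simp only: subst.mpoly_eval_sum terms_satisfying_sum)
  finally show ?thesis using p by simp
qed

section \<open>Independent parameters and lower bounds for the growth\<close>

lemma card_exponents_box:
  "card {\<nu> :: 'x::finite \<Rightarrow>\<^sub>0 nat. (\<forall>i\<in>B. lookup \<nu> i \<le> e) \<and> (\<forall>i. i \<notin> B \<longrightarrow> lookup \<nu> i = 0)}
    = (e + 1) ^ card B"
  (is "card ?E = _")
proof -
  have "bij_betw (\<lambda>\<nu>. restrict (lookup \<nu>) B) ?E (B \<rightarrow>\<^sub>E {..e})"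
  proof (rule bij_betw_byWitness[where f' = "\<lambda>f. Abs_poly_mapping (\<lambda>i. if i \<in> B then f i else 0)"])
    show "\<forall>\<nu>\<in>?E. Abs_poly_mapping (\<lambda>i. if i \<in> B then restrict (lookup \<nu>) B i else 0) = \<nu>"
      by (auto intro!: poly_mapping_eqI)
    show "\<forall>f\<in>B \<rightarrow>\<^sub>E {..e}. restrict (lookup (Abs_poly_mapping (\<lambda>i. if i \<in> B then f i else 0))) B = f"
      by (auto simp: PiE_def extensional_def fun_eq_iff)
    show "(\<lambda>\<nu>. restrict (lookup \<nu>) B) ` ?E \<subseteq> B \<rightarrow>\<^sub>E {..e}"
      by auto
    show "(\<lambda>f. Abs_poly_mapping (\<lambda>i. if i \<in> B then f i else 0)) ` (B \<rightarrow>\<^sub>E {..e}) \<subseteq> ?E"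
      by (auto simp: PiE_def Pi_def)
  qed
  then have "card ?E = card (B \<rightarrow>\<^sub>E {..e})" by (rule bij_betw_same_card)
  then show ?thesis by (simp add: card_PiE)
qed

definition supported :: "'x set \<Rightarrow> ('x \<Rightarrow>\<^sub>0 nat) set"
  where "supported B = {\<nu>. \<forall>i. i \<notin> B \<longrightarrow> lookup \<nu> i = 0}"

text \<open>The \<open>(e + 1) ^ card B\<close> monomials with exponents at most \<open>e\<close> in
  the forms \<open>l i\<close> are independent modulo \<open>J\<close> and have degree at most
  \<open>card B * e\<close>. Gradedness reduces their independence to homogeneous relations, which
  \<open>inj\<close> excludes.\<close>

lemma ahilb_lower_bound:
  fixes J :: "('x::finite, 'k::field) mpoly set" and l :: "'x \<Rightarrow> ('x, 'k) mpoly" and B :: "'x set"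
  assumes J: "idl.subspace J" "graded J" and l: "\<And>i. l i \<in> homog 1"
    and inj: "\<And>p d. p \<in> homog d \<Longrightarrow> p \<in> polys_on (supported B) \<Longrightarrow> mpoly_eval const l p \<in> J \<Longrightarrow> p = 0"
  shows "(e + 1) ^ card B \<le> ahilb J (card B * e)"
proof -
  define E :: "('x \<Rightarrow>\<^sub>0 nat) set" where "E = {\<nu>. (\<forall>i\<in>B. lookup \<nu> i \<le> e) \<and> (\<forall>i. i \<notin> B \<longrightarrow> lookup \<nu> i = 0)}"
  have cardE: "card E = (e + 1) ^ card B" unfolding E_def by (rule card_exponents_box)
  then have finE: "finite E" by (metis card.infinite power_eq_0_iff add_is_0 one_neq_zero)
  have Es: "E \<subseteq> supported B" by (auto simp: E_def supported_def)
  have inj': "p = 0" if p: "p \<in> polys_on E" and pJ: "mpoly_eval const l p \<in> J" for p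
  proof -
    have "homog_part d p = 0" for d
    proof (rule inj)
      show "homog_part d p \<in> homog d"
        by (rule terms_satisfying_in_polys_on)
      show "homog_part d p \<in> polys_on (supported B)"
        using p Es by (auto simp: polys_on_def keys_terms_satisfying)
      have "homog_part d (mpoly_eval const l p) \<in> J"
        using J(2) pJ by (simp add: graded_def)
      then show "mpoly_eval const l (homog_part d p) \<in> J"
        by (simp only: subst_homog_component[OF l])
    qed
    then show ?thesis using sum_homog_components[of p] by simp
  qed
  let ?f = "\<lambda>\<nu>. mpoly_eval const l (monomial \<nu>)"
  have inj_f: "inj_on ?f E"
  proof (rule inj_onI)
    fix \<mu> \<nu> assume *: "\<mu> \<in> E" "\<nu> \<in> E" "?f \<mu> = ?f \<nu>"
    have "monomial \<mu> - monomial \<nu> \<in> (polys_on E :: ('x, 'k) mpoly set)"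
      using * by (intro vs.subspace_diff subspace_polys_on) simp_all
    moreover have "mpoly_eval const l (monomial \<mu> - monomial \<nu>) \<in> J"
      using * J(1) by (simp add: subst_diff idl.subspace_0)
    ultimately have "monomial \<mu> - monomial \<nu> = (0 :: ('x, 'k) mpoly)" by (rule inj')
    then show "\<mu> = \<nu>" using inj_monomial[where 'k = 'k] by (auto dest: injD)
  qed
  have "vs.indep_mod J (?f ` E)"
    unfolding vs.indep_mod_def
  proof (intro conjI allI impI)
    fix u assume "(\<Sum>t\<in>?f ` E. const (u t) * t) \<in> J"
    then have J': "(\<Sum>\<nu>\<in>E. const (u (?f \<nu>)) * ?f \<nu>) \<in> J"
      by (simp add: sum.reindex[OF inj_f])
    define p where "p = (\<Sum>\<nu>\<in>E. const (u (?f \<nu>)) * monomial \<nu>)"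
    have "p \<in> polys_on E"
      unfolding p_def by (intro vs.subspace_sum[OF subspace_polys_on] vs.subspace_scale[OF subspace_polys_on]) simp
    moreover have "mpoly_eval const l p \<in> J"
      using J' unfolding p_def subst.mpoly_eval_sum subst.mpoly_eval_mult subst.mpoly_eval_const .
    ultimately have "p = 0" by (rule inj')
    have "u (?f \<nu>) = 0" if "\<nu> \<in> E" for \<nu>
    proof -
      have "lookup p \<nu> = u (?f \<nu>)"
        unfolding p_def const_mult_monomial lookup_sum_single using finE that by simp
      then show ?thesis using \<open>p = 0\<close> by simp
    qed
    then show "\<forall>t\<in>?f ` E. u t = 0" by simp
  qed (use finE in simp)
  moreover have "?f ` E \<subseteq> deg_le (card B * e)"
  proof clarify
    fix \<nu> assume nu: "\<nu> \<in> E"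
    have "exp_degree \<nu> = (\<Sum>i\<in>B. lookup \<nu> i)"
      unfolding exp_degree_def by (rule sum.mono_neutral_right) (use nu in \<open>auto simp: E_def\<close>)
    also have "\<dots> \<le> card B * e"
      using sum_bounded_above[of B "lookup \<nu>" e] nu by (simp add: E_def)
    finally have "exp_degree \<nu> \<le> card B * e" .
    then have "homog (exp_degree \<nu>) \<subseteq> (deg_le (card B * e) :: ('x, 'k) mpoly set)"
      by (intro polys_on_mono) auto
    moreover have "?f \<nu> \<in> homog (exp_degree \<nu>)"
      by (rule subst_homog[OF l]) simp
    ultimately show "?f \<nu> \<in> deg_le (card B * e)" by blast
  qed
  ultimately have "card (?f ` E) \<le> ahilb J (card B * e)"
    unfolding ahilb_def by (intro vs.card_le_codim[OF ideal_subspace[OF J(1)] ahilb_fin])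
  then show ?thesis by (simp add: card_image[OF inj_f] cardE)
qed

lemma exp_degree_splitE:
  assumes "exp_degree \<nu> = a + b"
  obtains \<mu> \<mu>' where "\<nu> = \<mu> + \<mu>'" "exp_degree \<mu> = a" "exp_degree \<mu>' = b"
  using assms
proof (induction a arbitrary: \<nu> thesis)
  case 0
  then show ?case by (metis add_0 exp_degree_0)
next
  case (Suc a)
  have "exp_degree \<nu> = Suc (a + b)" using Suc.prems(2) by simp
  then obtain \<mu> i where 1: "\<nu> = \<mu> + single i 1" "exp_degree \<mu> = a + b"
    by (rule exp_degree_SucE)
  obtain \<mu>1 \<mu>2 where 2: "\<mu> = \<mu>1 + \<mu>2" "exp_degree \<mu>1 = a" "exp_degree \<mu>2 = b"
    using Suc.IH[OF _ 1(2)] by blast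
  show ?case
  proof (rule Suc.prems(1))
    show "\<nu> = (\<mu>1 + single i 1) + \<mu>2" using 1 2 by (simp add: add_ac)
    show "exp_degree (\<mu>1 + single i 1) = Suc a" using 2 by (simp add: exp_degree_add)
  qed (rule 2)
qed

text \<open>A monomial of degree \<open>N * t\<close> is a product of \<open>t\<close> monomials of
  degree \<open>N\<close>, each of which is a multiple of \<open>y\<close> modulo
  \<open>K\<close>.\<close>

lemma homog_subset_power:
  fixes K :: "('x::finite, 'k::field) mpoly set"
  assumes K: "idl.subspace K" and N: "homog N \<subseteq> idl.span (K \<union> {y})"
  shows "homog (N * t) \<subseteq> idl.span (K \<union> {y ^ t})"
proof (induction t)
  case 0
  have "idl.span (K \<union> {1}) = UNIV"
  proof -
    have "x * 1 \<in> idl.span (K \<union> {1})" for x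
      by (intro idl.span_scale idl.span_base) simp
    then show ?thesis by auto
  qed
  then show ?case by simp
next
  case (Suc t)
  show ?case
  proof (rule polys_on_subset_subspace[OF ideal_subspace[OF idl.subspace_span]])
    fix \<nu> :: "'x \<Rightarrow>\<^sub>0 nat" assume "\<nu> \<in> {\<nu>. exp_degree \<nu> = N * Suc t}"
    then have "exp_degree \<nu> = N + N * t" by simp
    then obtain \<mu> \<mu>' where s: "\<nu> = \<mu> + \<mu>'" "exp_degree \<mu> = N" "exp_degree \<mu>' = N * t"
      using exp_degree_splitE by blast
    have "monomial \<mu> \<in> idl.span (K \<union> {y})" using s by (intro subsetD[OF N]) simp
    then obtain j q where jq: "j \<in> K" "monomial \<mu> = j + q * y"
      using idl_span_Un_single[OF K] by blast
    have "monomial \<mu>' \<in> idl.span (K \<union> {y ^ t})" using s by (intro subsetD[OF Suc.IH]) simp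
    then obtain j' q' where jq': "j' \<in> K" "monomial \<mu>' = j' + q' * y ^ t"
      using idl_span_Un_single[OF K] by blast
    have "(monomial \<nu> :: ('x, 'k) mpoly) = (j + q * y) * (j' + q' * y ^ t)"
      unfolding s(1) monomial_add jq(2) jq'(2) ..
    also have "\<dots> = (j * (j' + q' * y ^ t) + j' * (q * y)) + (q * q') * y ^ Suc t"
      by (simp add: algebra_simps)
    finally show "monomial \<nu> \<in> idl.span (K \<union> {y ^ Suc t})"
      unfolding idl_span_Un_single[OF K]
      using idl.subspace_add[OF K idl_mult_right[OF K jq(1)] idl_mult_right[OF K jq'(1)]] by blast
  qed
qed

text \<open>Noether normalization: a relation among the parameters, evaluated at a point where it does not
  vanish, makes a power of one parameter redundant, so that the number of parameters is not minimal.\<close>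

lemma noether_injective:
  fixes J :: "('x::finite, 'k::field_char_0) mpoly set" and l :: "'x \<Rightarrow> ('x, 'k) mpoly" and B :: "'x set"
  assumes J: "idl.subspace J" and nparams: "\<not> params J (card B - 1)"
    and l: "\<And>i. l i \<in> homog 1" "\<And>i. i \<notin> B \<Longrightarrow> l i = 0"
    and N: "homog N \<subseteq> idl.span (J \<union> l ` B)"
    and p: "p \<in> homog d" "p \<in> polys_on (supported B)" and pJ: "mpoly_eval const l p \<in> J"
  shows "p = 0"
proof (rule ccontr)
  assume p0: "p \<noteq> 0"
  then obtain c where c: "mpoly_eval id c p \<noteq> 0" using nonvanishing_point by blast
  \<comment> \<open>The coordinates outside \<open>B\<close> do not occur in \<open>p\<close> and
    are set to 0, matching \<open>l i = 0\<close> there.\<close>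
  define c' where "c' i = (if i \<in> B then c i else 0)" for i
  have "mpoly_eval id c' p = mpoly_eval id c p"
    unfolding mpoly_eval_def
  proof (rule sum.cong)
    fix \<nu> assume "\<nu> \<in> keys p"
    then have nu: "lookup \<nu> i = 0" if "i \<notin> B" for i
      using p(2) that by (auto simp: polys_on_def supported_def)
    have "(\<Prod>i\<in>UNIV. c' i ^ lookup \<nu> i) = (\<Prod>i\<in>UNIV. c i ^ lookup \<nu> i)"
      by (rule prod.cong) (use nu in \<open>auto simp: c'_def\<close>)
    then show "id (lookup p \<nu>) * (\<Prod>i\<in>UNIV. c' i ^ lookup \<nu> i)
        = id (lookup p \<nu>) * (\<Prod>i\<in>UNIV. c i ^ lookup \<nu> i)" by simp
  qed simp
  with c have c': "mpoly_eval id c' p \<noteq> 0" by simp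
  have sc: "const (1 / a) * (const a * x) = x" if "a \<noteq> 0" for a and x :: "('x, 'k) mpoly"
    using that by (simp flip: mult.assoc const_mult)
  have F: False
    if "finite F" "card F \<le> card B - 1" "F \<subseteq> homog 1" "homog M \<subseteq> idl.span (J \<union> F)" for F M
    using nparams that unfolding params_def by blast
  show False
  proof (cases "\<exists>j\<in>B. c j \<noteq> 0")
    \<comment> \<open>All coordinates of \<open>c'\<close> are 0, so the homogeneous
      \<open>p\<close>, having a nonzero value there, is a constant. Then \<open>J\<close> is the
      unit ideal, and the empty set of parameters contradicts \<open>nparams\<close>.\<close>
    case False
    then have c0: "c' i = 0" for i by (auto simp: c'_def)
    have "d = 0"
    proof (rule ccontr)
      assume d: "d \<noteq> 0"
      have "mpoly_eval id c' p = 0"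
        unfolding mpoly_eval_def
      proof (rule sum.neutral, rule ballI)
        fix \<nu> assume "\<nu> \<in> keys p"
        then have "exp_degree \<nu> \<noteq> 0" using p(1) d by (auto simp: polys_on_def)
        then obtain i where "lookup \<nu> i \<noteq> 0"
          unfolding exp_degree_def by (meson sum.neutral)
        then have "c' i ^ lookup \<nu> i = 0" using c0 by simp
        then have "(\<Prod>i\<in>UNIV. c' i ^ lookup \<nu> i) = 0"
          by (intro prod_zero) auto
        then show "id (lookup p \<nu>) * (\<Prod>i\<in>UNIV. c' i ^ lookup \<nu> i) = 0" by simp
      qed
      then show False using c' by simp
    qed
    then have k: "keys p \<subseteq> {0}" using p(1) by (auto simp: polys_on_def exp_degree_eq_0_iff)
    define a where "a = lookup p 0"
    have pa: "p = const a"
      using mpoly_expand[OF _ k] by (simp add: a_def)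
    then have "a \<noteq> 0" using p0 by auto
    moreover have "const a * 1 \<in> J" using pJ pa by (simp add: subst.mpoly_eval_const)
    then have "const (1 / a) * (const a * 1) \<in> J" by (rule idl.subspace_scale[OF J])
    ultimately have "1 \<in> J" using sc[of a 1] by metis
    then have "x * 1 \<in> J" for x by (rule idl.subspace_scale[OF J])
    then have "homog 0 \<subseteq> idl.span (J \<union> {})" using idl.span_base by fastforce
    then show False by (intro F[of "{}" 0]) auto
  next
    case True
    then obtain j where j: "j \<in> B" "c j \<noteq> 0" by blast
    \<comment> \<open>Modulo the differences \<open>l i - c' i * y\<close>, of which the one for
      \<open>j\<close> is 0, every \<open>l i\<close> becomes a multiple of the single form
      \<open>y\<close>, and the value of \<open>p\<close> at \<open>l\<close> becomes a nonzero
      constant times \<open>y ^ d\<close>.\<close>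
    define y where "y = const (1 / c j) * l j"
    have ly: "l j = const (c j) * y"
      unfolding y_def using sc[of "1 / c j" "l j"] j(2) by simp
    define b where "b i = const (c' i) * y" for i
    define K where "K = idl.span (J \<union> (\<lambda>i. l i - b i) ` (B - {j}))"
    have K: "idl.subspace K" by (simp add: K_def)
    have JK: "J \<subseteq> K" unfolding K_def by (auto intro: idl.span_base)
    have lb: "l i - b i \<in> K" for i
    proof (cases "i \<in> B - {j}")
      case True
      then show ?thesis unfolding K_def by (intro idl.span_base) simp
    next
      case False
      then have "l i - b i = 0" using j l(2) ly by (auto simp: b_def c'_def)
      then show ?thesis using K idl.subspace_0 by metis
    qed
    have "mpoly_eval const b p = (\<Sum>\<nu>\<in>keys p.
        const (id (lookup p \<nu>) * (\<Prod>i\<in>UNIV. c' i ^ lookup \<nu> i)) * y ^ d)"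
      unfolding mpoly_eval_def
    proof (rule sum.cong)
      fix \<nu> assume "\<nu> \<in> keys p"
      then have "exp_degree \<nu> = d" using p(1) by (auto simp: polys_on_def)
      then have "(\<Prod>i\<in>UNIV. y ^ lookup \<nu> i) = y ^ d"
        by (simp add: exp_degree_def flip: power_sum)
      moreover have "const (\<Prod>i\<in>S. f i) = (\<Prod>i\<in>S. const (f i) :: ('x, 'k) mpoly)" for S :: "'x set" and f
        by (induction S rule: infinite_finite_induct) (simp_all add: const_mult)
      ultimately show "const (lookup p \<nu>) * (\<Prod>i\<in>UNIV. b i ^ lookup \<nu> i) =
          const (id (lookup p \<nu>) * (\<Prod>i\<in>UNIV. c' i ^ lookup \<nu> i)) * y ^ d"
        by (simp add: b_def power_mult_distrib prod.distrib const_mult const_power mult.assoc)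
    qed simp
    also have "\<dots> = const (mpoly_eval id c' p) * y ^ d"
    proof -
      have cs: "const (\<Sum>\<nu>\<in>S. f \<nu>) = (\<Sum>\<nu>\<in>S. const (f \<nu>) :: ('x, 'k) mpoly)" for S :: "('x \<Rightarrow>\<^sub>0 nat) set" and f
        by (induction S rule: infinite_finite_induct) (simp_all add: const_add)
      show ?thesis unfolding mpoly_eval_def cs sum_distrib_right ..
    qed
    finally have sb: "mpoly_eval const b p = const (mpoly_eval id c' p) * y ^ d" .
    have "mpoly_eval const l p - (mpoly_eval const l p - mpoly_eval const b p) \<in> K"
      using pJ JK by (intro idl.subspace_diff[OF K] idl_subst_cong[OF K lb]) auto
    then have "const (mpoly_eval id c' p) * y ^ d \<in> K" unfolding sb[symmetric] by simp
    then have "const (1 / mpoly_eval id c' p) * (const (mpoly_eval id c' p) * y ^ d) \<in> K"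
      by (rule idl.subspace_scale[OF K])
    then have yd: "y ^ d \<in> K" using sc[OF c'] by simp
    have "idl.span (J \<union> l ` B) \<subseteq> idl.span (K \<union> {y})"
    proof (rule idl.span_minimal)
      show "J \<union> l ` B \<subseteq> idl.span (K \<union> {y})"
      proof (rule Un_least)
        show "J \<subseteq> idl.span (K \<union> {y})" using JK by (auto intro: idl.span_base)
        show "l ` B \<subseteq> idl.span (K \<union> {y})"
        proof clarify
          fix i
          have "(l i - b i) + const (c' i) * y \<in> idl.span (K \<union> {y})"
            by (intro idl.span_add idl.span_scale idl.span_base) (use lb in auto)
          then show "l i \<in> idl.span (K \<union> {y})" by (simp add: b_def)
        qed
      qed
    qed simp
    \<comment> \<open>As \<open>y ^ d\<close> lies in \<open>K\<close>, the differences are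
      parameters by themselves. They number at most \<open>card B - 1\<close>, against
      \<open>nparams\<close>.\<close>
    then have "homog (N * d) \<subseteq> idl.span (K \<union> {y ^ d})"
      using N by (intro homog_subset_power[OF K]) blast
    also have "\<dots> = K"
      using yd K by (metis Un_insert_right idl.span_eq_iff insert_absorb sup_bot_right)
    finally have "homog (N * d) \<subseteq> K" .
    then show False
      unfolding K_def
    proof (rule F[rotated 3])
      show "finite ((\<lambda>i. l i - b i) ` (B - {j}))" by simp
      show "card ((\<lambda>i. l i - b i) ` (B - {j})) \<le> card B - 1"
        using card_image_le[of "B - {j}" "\<lambda>i. l i - b i"] j by simp
      show "(\<lambda>i. l i - b i) ` (B - {j}) \<subseteq> homog 1"
        unfolding b_def y_def
        by (auto intro!: vs.subspace_diff[OF subspace_polys_on] vs.subspace_scale[OF subspace_polys_on] l simp del: One_nat_def)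
    qed
  qed
qed

lemma params_card:
  fixes J :: "('x::finite, 'k::field) mpoly set"
  shows "params J CARD('x)"
proof -
  have "homog 1 \<subseteq> idl.span (J \<union> range var)"
  proof (rule polys_on_subset_subspace[OF ideal_subspace[OF idl.subspace_span]])
    fix \<nu> :: "'x \<Rightarrow>\<^sub>0 nat" assume "\<nu> \<in> {\<nu>. exp_degree \<nu> = 1}"
    then have "exp_degree \<nu> = Suc 0" by simp
    then obtain \<mu> i where "\<nu> = \<mu> + single i 1" "exp_degree \<mu> = 0" by (rule exp_degree_SucE)
    then have "monomial \<nu> = (var i :: ('x, 'k) mpoly)" by (simp add: exp_degree_eq_0_iff var_eq_monomial)
    then show "(monomial \<nu> :: ('x, 'k) mpoly) \<in> idl.span (J \<union> range var)" by (auto intro: idl.span_base)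
  qed
  moreover have "card (range (var :: 'x \<Rightarrow> ('x, 'k) mpoly)) \<le> CARD('x)" by (rule card_image_le) simp
  moreover have "range var \<subseteq> (homog 1 :: ('x, 'k) mpoly set)" using var_in_homog by blast
  moreover have "finite (range (var :: 'x \<Rightarrow> ('x, 'k) mpoly))" by simp
  ultimately show ?thesis unfolding params_def by (intro exI[of _ "range var"] conjI exI[of _ 1])
qed

text \<open>A system of parameters of least size admits no relation, by
  \<open>noether_injective\<close>. Its members are indexed by a set \<open>B\<close> of variables
  so that relations among them are polynomials in the given ring; \<open>params_card\<close>
  guarantees that there are enough variables for this.\<close>

lemma minimal_params:
  fixes J :: "('x::finite, 'k::field_char_0) mpoly set"
  assumes J: "idl.subspace J" and k: "\<not> params J k"
  obtains B :: "'x set" and l :: "'x \<Rightarrow> ('x, 'k) mpoly" and N where "k < card B" "\<And>i. l i \<in> homog 1" "\<And>i. i \<notin> B \<Longrightarrow> l i = 0"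
    "homog N \<subseteq> idl.span (J \<union> l ` B)"
    "\<And>p d. p \<in> homog d \<Longrightarrow> p \<in> polys_on (supported B) \<Longrightarrow> mpoly_eval const l p \<in> J \<Longrightarrow> p = 0"
proof -
  define k' where "k' = (LEAST k. params J k)"
  have k': "params J k'" unfolding k'_def by (rule LeastI[of "params J"]) (rule params_card)
  have le: "k' \<le> CARD('x)" unfolding k'_def by (rule Least_le) (rule params_card)
  have kk: "k < k'" using k k' params_mono by (meson not_le)
  have np: "\<not> params J (k' - 1)" using kk unfolding k'_def by (intro not_less_Least) auto
  obtain F N where F: "finite F" "card F \<le> k'" "F \<subseteq> homog 1" "homog N \<subseteq> idl.span (J \<union> F)"
    using k' unfolding params_def by blast
  have cF: "card F = k'"
  proof (rule ccontr)
    assume "card F \<noteq> k'"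
    then have "card F \<le> k' - 1" using F by simp
    then show False using np F unfolding params_def by blast
  qed
  obtain B :: "'x set" where B: "card B = k'" using obtain_subset_with_card_n[OF le] by metis
  have "finite B" by simp
  then obtain h where h: "bij_betw h B F" using finite_same_card_bij F(1) B cF by metis
  define l where "l i = (if i \<in> B then h i else 0)" for i
  have lB: "l ` B = F" using h by (auto simp: l_def bij_betw_def)
  have lh: "l i \<in> homog 1" for i
  proof (cases "i \<in> B")
    case True
    then show ?thesis using lB F(3) by blast
  qed (simp add: l_def)
  have N: "homog N \<subseteq> idl.span (J \<union> l ` B)" using F(4) lB by simp
  show ?thesis
  proof (rule that[of B l N])
    show "p = 0" if "p \<in> homog d" "p \<in> polys_on (supported B)" "mpoly_eval const l p \<in> J" for p d
      by (rule noether_injective[OF J _ lh _ N that]) (use np B in \<open>auto simp: l_def\<close>)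
  qed (use kk B lh N in \<open>auto simp: l_def\<close>)
qed

lemma growth_lower_contradiction:
  fixes C k k' :: nat
  assumes "k < k'" and le: "\<And>e. (e + 1) ^ k' \<le> C * (k' * e + 1) ^ k"
  shows False
proof -
  \<comment> \<open>With this value the right-hand side is at most \<open>(e + 1) ^ k * e\<close>,
    since \<open>k' * e + 1 \<le> k' * (e + 1)\<close>, whereas the left-hand side is at least
    \<open>(e + 1) ^ Suc k\<close>.\<close>
  define e where "e = C * k' ^ k"
  have "(e + 1) ^ k * (e + 1) = (e + 1) ^ Suc k" by simp
  also have "\<dots> \<le> (e + 1) ^ k'" using assms(1) by (intro power_increasing) auto
  also have "\<dots> \<le> C * (k' * e + 1) ^ k" by (rule le)
  also have "\<dots> \<le> C * (k' * (e + 1)) ^ k" using assms(1) by (intro mult_le_mono2 power_mono) auto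
  also have "\<dots> = (e + 1) ^ k * e" unfolding e_def power_mult_distrib by (simp only: mult_ac)
  finally show False by simp
qed

text \<open>If \<open>k\<close> parameters did not suffice, a least system would have more than
  \<open>k\<close> independent members, and their monomials would grow faster than the power
  \<open>k\<close>.\<close>

lemma growth_imp_params:
  fixes J :: "('x::finite, 'k::field_char_0) mpoly set"
  assumes J: "idl.subspace J" "graded J" and g: "growth_le J k"
  shows "params J k"
proof (rule ccontr)
  assume np: "\<not> params J k"
  obtain B :: "'x set" and l :: "'x \<Rightarrow> ('x, 'k) mpoly" and N where B: "k < card B" "\<And>i. l i \<in> homog 1"
    "\<And>i. i \<notin> B \<Longrightarrow> l i = 0" "homog N \<subseteq> idl.span (J \<union> l ` B)"
    "\<And>p d. p \<in> homog d \<Longrightarrow> p \<in> polys_on (supported B) \<Longrightarrow> mpoly_eval const l p \<in> J \<Longrightarrow> p = 0"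
    using minimal_params[OF J(1) np] by metis
  obtain C where C: "\<And>d. ahilb J d \<le> C * (d + 1) ^ k" using g unfolding growth_le_def by blast
  have "(e + 1) ^ card B \<le> C * (card B * e + 1) ^ k" for e
  proof -
    have "(e + 1) ^ card B \<le> ahilb J (card B * e)"
      by (rule ahilb_lower_bound[OF J, where l = l], rule B(2), rule B(5))
    then show ?thesis using C[of "card B * e"] by linarith
  qed
  then show False by (rule growth_lower_contradiction[OF B(1)])
qed

section \<open>Growth modulo a non-zero-divisor and modulo a monomial\<close>

lemma ahilb_pos:
  fixes J :: "('x::finite, 'k::field) mpoly set"
  assumes J: "idl.subspace J" and "1 \<notin> J"
  shows "0 < ahilb J 0"
proof -
  have "vs.indep_mod J {1}"
    unfolding vs.indep_mod_def
  proof (intro conjI allI impI)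
    fix u :: "('x, 'k) mpoly \<Rightarrow> 'k" assume "(\<Sum>t\<in>{1}. const (u t) * t) \<in> J"
    then have "const (u 1) \<in> J" by simp
    then have "const (1 / u 1) * const (u 1) \<in> J" by (rule idl.subspace_scale[OF J])
    then show "\<forall>t\<in>{1}. u t = 0" using assms(2) by (cases "u 1 = 0") (auto simp flip: const_mult)
  qed simp
  moreover have "{1} \<subseteq> (deg_le 0 :: ('x, 'k) mpoly set)"
    using const_in_homog[of "1 :: 'k"] by simp
  ultimately have "card {1 :: ('x, 'k) mpoly} \<le> ahilb J 0"
    unfolding ahilb_def by (intro vs.card_le_codim[OF ideal_subspace[OF J] ahilb_fin])
  then show ?thesis by simp
qed

lemma deg_le_exists: "\<exists>e. f \<in> deg_le e"
proof
  have "exp_degree \<nu> \<le> (\<Sum>\<nu>\<in>keys f. exp_degree \<nu>)" if "\<nu> \<in> keys f" for \<nu>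
    using that by (intro member_le_sum) auto
  then show "f \<in> deg_le (\<Sum>\<nu>\<in>keys f. exp_degree \<nu>)"
    by (auto simp: polys_on_def)
qed

text \<open>Applied \<open>n\<close> times, \<open>ahilb_regular\<close> gives
  \<open>n * ahilb Q d \<le> ahilb P (d + n * e)\<close>. For \<open>n = d + 1\<close> the argument
  on the right is still linear in \<open>d\<close>, and division by \<open>d + 1\<close> lowers the
  exponent by one.\<close>

lemma growth_drop:
  fixes P Q :: "('x::finite, 'k::field) mpoly set"
  assumes P: "idl.subspace P" and Q: "idl.subspace Q" "P \<subseteq> Q" "1 \<notin> Q" and f: "f \<in> Q"
    and reg: "\<And>x. f * x \<in> P \<Longrightarrow> x \<in> P" and g: "growth_le P k"
  shows "\<exists>k'. k = Suc k' \<and> growth_le Q k'"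
proof -
  obtain e where e: "f \<in> deg_le e" using deg_le_exists by blast
  obtain C where C: "\<And>d. ahilb P d \<le> C * (d + 1) ^ k" using g unfolding growth_le_def by blast
  have 1: "n * ahilb Q d \<le> ahilb P (d + n * e)" for n d
  proof (induction n)
    case (Suc n)
    have "ahilb Q d \<le> ahilb Q (d + n * e + e)" by (rule ahilb_mono[OF Q(1)]) simp
    then have "ahilb Q d + n * ahilb Q d \<le> ahilb P (d + n * e + e)"
      using ahilb_regular[OF P Q(1,2) f e reg, of "d + n * e"] Suc by linarith
    moreover have "d + n * e + e = d + Suc n * e" by simp
    ultimately show ?case by (metis mult_Suc)
  qed simp
  have 2: "(d + 1) * ahilb Q d \<le> C * ((d + 1) * (e + 1)) ^ k" for d
  proof -
    have "(d + 1) * ahilb Q d \<le> ahilb P (d + (d + 1) * e)" by (rule 1)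
    also have "\<dots> \<le> C * (d + (d + 1) * e + 1) ^ k" by (rule C)
    also have "d + (d + 1) * e + 1 = (d + 1) * (e + 1)" by simp
    finally show ?thesis .
  qed
  show ?thesis
  proof (cases k)
    case 0
    \<comment> \<open>For \<open>k = 0\<close> the right-hand side is just \<open>C\<close>, which
      \<open>C + 1\<close> copies of the positive number \<open>ahilb Q 0\<close> exceed.\<close>
    have "(C + 1) * ahilb Q 0 \<le> C * (0 + (C + 1) * e + 1) ^ k"
      using 1[of "C + 1" 0] C[of "0 + (C + 1) * e"] by linarith
    then have "(C + 1) * ahilb Q 0 \<le> C" using 0 by simp
    moreover have "1 \<le> ahilb Q 0" using ahilb_pos[OF Q(1,3)] by simp
    then have "(C + 1) * 1 \<le> (C + 1) * ahilb Q 0" by (rule mult_le_mono2)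
    ultimately show ?thesis by simp
  next
    case (Suc k')
    have "ahilb Q d \<le> (C * (e + 1) ^ k) * (d + 1) ^ k'" for d
    proof -
      have "(d + 1) * ahilb Q d \<le> (d + 1) * ((C * (e + 1) ^ k) * (d + 1) ^ k')"
        using 2[of d] Suc by (simp only: power_mult_distrib power_Suc mult_ac)
      then show ?thesis by (simp only: mult_le_cancel1)
    qed
    then show ?thesis using Suc unfolding growth_le_def by blast
  qed
qed

text \<open>A variable is split off the monomial: if its product with \<open>b\<close> lies in
  \<open>J\<close>, then \<open>ahilb_product_le\<close> bounds the growth by those for
  \<open>J\<close> with the variable and for \<open>J\<close> with \<open>b\<close>, where
  \<open>b\<close> has smaller degree. Geometrically, the zero set of \<open>J\<close> is covered by
  the coordinate hyperplanes of the variables in \<open>\<nu>\<close>.\<close>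

lemma growth_le_monomial:
  fixes J :: "('x::finite, 'k::field) mpoly set"
  assumes "idl.subspace J" "graded J" "monomial \<nu> \<in> J"
    and "\<And>i. lookup \<nu> i \<noteq> 0 \<Longrightarrow> growth_le (idl.span (J \<union> {var i})) k"
  shows "growth_le J k"
  using assms
proof (induction "exp_degree \<nu>" arbitrary: J \<nu>)
  case 0
  then have "1 \<in> J" by (simp add: exp_degree_eq_0_iff flip: monomial_0)
  then have "x * 1 \<in> J" for x by (rule idl.subspace_scale[OF 0(2)])
  then have UN: "x \<in> J" for x by simp
  have "ahilb J d \<le> card ({} :: ('x, 'k) mpoly set)" for d
    unfolding ahilb_def
    by (rule vs.codim_le_card[OF ideal_subspace[OF 0(2)]]) (auto intro: vs.span_base UN)
  then show ?case unfolding growth_le_def by simp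
next
  case (Suc n)
  obtain \<mu> i where e: "\<nu> = \<mu> + single i 1" "exp_degree \<mu> = n"
    using exp_degree_SucE[OF Suc(2)[symmetric]] by blast
  let ?b = "monomial \<mu> :: ('x, 'k) mpoly"
  let ?J = "idl.span (J \<union> {?b})"
  have "growth_le ?J k"
  proof (rule Suc(1))
    show "graded ?J"
      by (rule graded_add_form[OF Suc(4), where e = n]) (use e in simp)
    show "?b \<in> ?J" by (intro idl.span_base) simp
    fix j assume "lookup \<mu> j \<noteq> 0"
    then have "lookup \<nu> j \<noteq> 0" using e by (simp add: lookup_add)
    then have "growth_le (idl.span (J \<union> {var j})) k" by (rule Suc(6))
    moreover have "idl.span (J \<union> {var j}) \<subseteq> idl.span (?J \<union> {var j})"
      unfolding idl_span_Un_span by (rule idl.span_mono) auto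
    ultimately show "growth_le (idl.span (?J \<union> {var j})) k"
      by (rule growth_le_antimono[OF _ idl.subspace_span idl.subspace_span])
  qed (use e in simp_all)
  then obtain C where C: "\<And>d. ahilb ?J d \<le> C * (d + 1) ^ k" unfolding growth_le_def by blast
  have "growth_le (idl.span (J \<union> {var i})) k" by (rule Suc(6)) (simp add: e lookup_add)
  then obtain C' where C': "\<And>d. ahilb (idl.span (J \<union> {var i})) d \<le> C' * (d + 1) ^ k"
    unfolding growth_le_def by blast
  have "var i * ?b \<in> J" using Suc(5) unfolding e monomial_times_var by (simp only: mult.commute)
  then have "ahilb J d \<le> (C + C') * (d + 1) ^ k" for d
    using ahilb_product_le[OF Suc(3,4) var_in_homog, of i ?b d] C[of d] C'[of d]
    unfolding distrib_right by linarith
  then show ?case unfolding growth_le_def by blast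
qed

section \<open>Krull dimension and depth\<close>

subsection \<open>Ideals of the quotient ring\<close>

lemma ring_of_type_algebra_simps [simp]:
  "carrier (ring_of_type_algebra :: 'a::comm_ring_1 ring) = UNIV"
  "x \<otimes>\<^bsub>(ring_of_type_algebra :: 'a ring)\<^esub> y = x * y"
  "x \<oplus>\<^bsub>(ring_of_type_algebra :: 'a ring)\<^esub> y = x + y"
  "\<zero>\<^bsub>(ring_of_type_algebra :: 'a ring)\<^esub> = 0"
  "\<one>\<^bsub>(ring_of_type_algebra :: 'a ring)\<^esub> = 1"
  by (simp_all add: ring_of_type_algebra_def)

text \<open>Bridge from ideals of a ring with a carrier to submodules; it makes the calculus of
  \<open>idl\<close> available for \<open>mpoly_ring\<close>.\<close>

lemma ideal_type_algebra_iff: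
  "ideal J (ring_of_type_algebra :: 'a::comm_ring_1 ring) \<longleftrightarrow> idl.subspace J"
proof
  assume "ideal J (ring_of_type_algebra :: 'a ring)"
  then interpret ideal J "ring_of_type_algebra :: 'a ring" .
  show "idl.subspace J"
    using additive_subgroup.a_closed[OF is_additive_subgroup] I_l_closed
      additive_subgroup.zero_closed[OF is_additive_subgroup]
    by (intro idl.subspaceI) auto
next
  interpret ring "ring_of_type_algebra :: 'a ring" by (rule ring_from_type_algebra)
  assume J: "idl.subspace J"
  have neg: "\<ominus>\<^bsub>(ring_of_type_algebra :: 'a ring)\<^esub> x = - x" for x :: 'a
    by (rule minus_equality) simp_all
  show "ideal J (ring_of_type_algebra :: 'a ring)"
  proof (rule idealI)
    show "subgroup J (add_monoid (ring_of_type_algebra :: 'a ring))"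
      by (rule subgroup.intro)
        (use J neg[unfolded a_inv_def] in \<open>simp_all add: idl.subspace_add idl.subspace_0 idl.subspace_neg\<close>)
  qed (use J in \<open>simp_all add: ring_axioms idl.subspace_scale idl_mult_right\<close>)
qed

lemma genideal_type_algebra: "Idl\<^bsub>(ring_of_type_algebra :: 'a::comm_ring_1 ring)\<^esub> S = idl.span S"
  unfolding genideal_def ideal_type_algebra_iff
  by (auto intro: idl.span_base dest: subsetD[OF idl.span_minimal])

locale quotient =
  fixes I :: "'a::comm_ring_1 set"
  assumes I: "idl.subspace I"
begin

definition coset :: "'a \<Rightarrow> 'a set"
  where "coset x = I +>\<^bsub>ring_of_type_algebra\<^esub> x"

abbreviation "Q \<equiv> ring_of_type_algebra Quot I"

sublocale R: cring "ring_of_type_algebra :: 'a ring"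
  by (rule cring_from_type_algebra)

sublocale I: ideal I "ring_of_type_algebra :: 'a ring"
  using I ideal_type_algebra_iff by blast

sublocale Q: cring Q
  by (rule I.quotient_is_cring) (rule R.is_cring)

lemma coset_eq_iff: "coset x = coset y \<longleftrightarrow> x - y \<in> I"
proof -
  have "x \<ominus>\<^bsub>(ring_of_type_algebra :: 'a ring)\<^esub> y = x - y"
    unfolding a_minus_def
    using R.minus_equality[of "- y" y] by simp
  then show ?thesis
    using R.quotient_eq_iff_same_a_r_cos[OF I.is_ideal, of x y] by (simp add: coset_def)
qed

lemma carrier_Q: "carrier Q = range coset"
  unfolding FactRing_def coset_def using A_RCOSETS_def'[of "ring_of_type_algebra :: 'a ring" I] by auto

lemma coset_add: "coset (x + y) = coset x \<oplus>\<^bsub>Q\<^esub> coset y"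
  using ring_hom_add[OF I.rcos_ring_hom, of x y] by (simp add: coset_def)

lemma coset_mult: "coset (x * y) = coset x \<otimes>\<^bsub>Q\<^esub> coset y"
  using ring_hom_mult[OF I.rcos_ring_hom, of x y] by (simp add: coset_def)

lemma coset_0: "coset 0 = \<zero>\<^bsub>Q\<^esub>"
  unfolding coset_def FactRing_def using R.a_coset_add_zero[of I] by simp

lemma coset_image_iff:
  assumes "idl.subspace J" "I \<subseteq> J"
  shows "coset x \<in> coset ` J \<longleftrightarrow> x \<in> J"
proof
  assume "coset x \<in> coset ` J"
  then obtain j where "j \<in> J" "x - j \<in> I" using coset_eq_iff by auto
  then have "(x - j) + j \<in> J" using assms by (intro idl.subspace_add) auto
  then show "x \<in> J" by simp
qed auto

lemma ideal_image: "idl.subspace J \<Longrightarrow> ideal (coset ` J) Q"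
  using R.ring_ideal_imp_quot_ideal[OF I.is_ideal, of J] unfolding ideal_type_algebra_iff coset_def .

lemma ideal_vimage:
  assumes "ideal q Q"
  shows "idl.subspace (coset -` q)" "I \<subseteq> coset -` q"
proof -
  interpret q: ideal q Q by fact
  have z: "coset 0 \<in> q" unfolding coset_0 by (rule additive_subgroup.zero_closed[OF q.is_additive_subgroup])
  show "idl.subspace (coset -` q)"
  proof (rule idl.subspaceI)
    show "c * x \<in> coset -` q" if "x \<in> coset -` q" for c x
      using that q.I_l_closed[of "coset x" "coset c"] by (auto simp: coset_mult carrier_Q)
  qed (use z additive_subgroup.a_closed[OF q.is_additive_subgroup] in \<open>auto simp: coset_add\<close>)
  show "I \<subseteq> coset -` q"
  proof
    fix x assume "x \<in> I"
    then have "coset x = coset 0" using coset_eq_iff by simp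
    then show "x \<in> coset -` q" using z by simp
  qed
qed

lemma genideal_quotient: "Idl\<^bsub>Q\<^esub> (coset ` F) = coset ` idl.span (I \<union> F)"
proof
  have "coset ` F \<subseteq> coset ` idl.span (I \<union> F)" by (auto intro: idl.span_base)
  then show "Idl\<^bsub>Q\<^esub> (coset ` F) \<subseteq> coset ` idl.span (I \<union> F)"
    by (intro Q.genideal_minimal ideal_image) simp_all
  have F: "coset ` F \<subseteq> carrier Q" by (auto simp: carrier_Q)
  then have id: "ideal (Idl\<^bsub>Q\<^esub> (coset ` F)) Q" by (rule Q.genideal_ideal)
  have "F \<subseteq> coset -` (Idl\<^bsub>Q\<^esub> (coset ` F))" using Q.genideal_self[OF F] by auto
  then have "idl.span (I \<union> F) \<subseteq> coset -` (Idl\<^bsub>Q\<^esub> (coset ` F))"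
    using ideal_vimage[OF id] by (intro idl.span_minimal) auto
  then show "coset ` idl.span (I \<union> F) \<subseteq> Idl\<^bsub>Q\<^esub> (coset ` F)" by auto
qed

end

definition prime_idl :: "'a::comm_ring_1 set \<Rightarrow> bool"
  where "prime_idl P \<longleftrightarrow> idl.subspace P \<and> 1 \<notin> P \<and> (\<forall>a b. a * b \<in> P \<longrightarrow> a \<in> P \<or> b \<in> P)"

context quotient
begin

lemma prime_image:
  assumes P: "prime_idl P" and IP: "I \<subseteq> P"
  shows "primeideal (coset ` P) Q"
proof (rule primeidealI)
  have P': "idl.subspace P" using P by (simp add: prime_idl_def)
  show "ideal (coset ` P) Q" using ideal_image[OF P'] .
  have "coset 1 \<notin> coset ` P" using P by (simp add: coset_image_iff[OF P' IP] prime_idl_def)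
  then show "carrier Q \<noteq> coset ` P" unfolding carrier_Q by blast
  fix a b assume ab: "a \<in> carrier Q" "b \<in> carrier Q" "a \<otimes>\<^bsub>Q\<^esub> b \<in> coset ` P"
  then obtain x y where xy: "a = coset x" "b = coset y" unfolding carrier_Q by blast
  then have "x * y \<in> P" using ab(3) coset_image_iff[OF P' IP] by (simp flip: coset_mult)
  then show "a \<in> coset ` P \<or> b \<in> coset ` P" using P xy unfolding prime_idl_def by blast
qed (rule Q.is_cring)

lemma prime_vimage:
  assumes "primeideal q Q"
  shows "prime_idl (coset -` q)"
proof -
  interpret q: primeideal q Q by fact
  have id: "idl.subspace (coset -` q)" by (rule ideal_vimage(1)[OF q.is_ideal])
  have "1 \<notin> coset -` q"
  proof
    assume "1 \<in> coset -` q"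
    then have "x * 1 \<in> coset -` q" for x by (rule idl.subspace_scale[OF id])
    then have "carrier Q \<subseteq> q" by (auto simp: carrier_Q)
    then show False using q.I_notcarr q.a_subset by blast
  qed
  moreover have "a \<in> coset -` q \<or> b \<in> coset -` q" if "a * b \<in> coset -` q" for a b
    using that q.I_prime[of "coset a" "coset b"] by (auto simp: coset_mult carrier_Q)
  ultimately show ?thesis using id by (simp add: prime_idl_def)
qed

text \<open>Primes are moved by preimages and images under the coset map. Strictness passes to
  preimages because the map is onto, and to images because the ideals contain
  \<open>I\<close>.\<close>

lemma prime_chain_quotient_iff:
  "(\<exists>p :: nat \<Rightarrow> 'a set set. (\<forall>i\<le>k. primeideal (p i) Q) \<and> (\<forall>i<k. p i \<subset> p (Suc i))) \<longleftrightarrow>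
   (\<exists>p :: nat \<Rightarrow> 'a set. (\<forall>i\<le>k. prime_idl (p i) \<and> I \<subseteq> p i) \<and> (\<forall>i<k. p i \<subset> p (Suc i)))"
proof
  assume "\<exists>p :: nat \<Rightarrow> 'a set set. (\<forall>i\<le>k. primeideal (p i) Q) \<and> (\<forall>i<k. p i \<subset> p (Suc i))"
  then obtain p :: "nat \<Rightarrow> 'a set set" where p: "\<forall>i\<le>k. primeideal (p i) Q" "\<forall>i<k. p i \<subset> p (Suc i)" by blast
  have id: "ideal (p i) Q" if "i \<le> k" for i
    using p(1) that by (simp add: primeideal.axioms(1))
  have "coset -` p i \<subset> coset -` p (Suc i)" if i: "i < k" for i
  proof -
    obtain a where a: "a \<in> p (Suc i)" "a \<notin> p i" using p(2) i by blast
    have "p (Suc i) \<subseteq> carrier Q"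
      using id[of "Suc i"] i by (simp add: additive_subgroup.a_subset ideal.axioms(1))
    then obtain x where "a = coset x" using a(1) carrier_Q by blast
    then have "x \<in> coset -` p (Suc i)" "x \<notin> coset -` p i" using a by auto
    moreover have "coset -` p i \<subseteq> coset -` p (Suc i)" using p(2) i by blast
    ultimately show ?thesis by blast
  qed
  then show "\<exists>p :: nat \<Rightarrow> 'a set. (\<forall>i\<le>k. prime_idl (p i) \<and> I \<subseteq> p i) \<and> (\<forall>i<k. p i \<subset> p (Suc i))"
    by (intro exI[of _ "\<lambda>i. coset -` p i"] conjI allI impI prime_vimage ideal_vimage(2) id)
      (use p(1) in simp_all)
next
  assume "\<exists>p :: nat \<Rightarrow> 'a set. (\<forall>i\<le>k. prime_idl (p i) \<and> I \<subseteq> p i) \<and> (\<forall>i<k. p i \<subset> p (Suc i))"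
  then obtain p :: "nat \<Rightarrow> 'a set" where p: "\<forall>i\<le>k. prime_idl (p i) \<and> I \<subseteq> p i" "\<forall>i<k. p i \<subset> p (Suc i)" by blast
  have "coset ` p i \<subset> coset ` p (Suc i)" if i: "i < k" for i
  proof -
    obtain x where x: "x \<in> p (Suc i)" "x \<notin> p i" using p(2) i by blast
    have "idl.subspace (p i)" "I \<subseteq> p i" using p(1) i by (auto simp: prime_idl_def)
    then have "coset x \<notin> coset ` p i" using x coset_image_iff by simp
    moreover have "coset x \<in> coset ` p (Suc i)" using x by blast
    moreover have "coset ` p i \<subseteq> coset ` p (Suc i)" using p(2) i by blast
    ultimately show ?thesis by blast
  qed
  then show "\<exists>p :: nat \<Rightarrow> 'a set set. (\<forall>i\<le>k. primeideal (p i) Q) \<and> (\<forall>i<k. p i \<subset> p (Suc i))"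
    by (intro exI[of _ "\<lambda>i. coset ` p i"] conjI allI impI prime_image) (use p(1) in simp_all)
qed

lemma regular_sequence_quotientD:
  assumes "regular_sequence Q (map coset ls)"
  shows "\<And>i a. i < length ls \<Longrightarrow> ls ! i * a \<in> idl.span (I \<union> set (take i ls)) \<Longrightarrow> a \<in> idl.span (I \<union> set (take i ls))"
    and "1 \<notin> idl.span (I \<union> set ls)"
proof -
  have sub: "I \<subseteq> idl.span (I \<union> F)" for F by (auto intro: idl.span_base)
  have eq: "Idl\<^bsub>Q\<^esub> (set (take i (map coset ls))) = coset ` idl.span (I \<union> set (take i ls))" for i
    by (simp add: take_map genideal_quotient)
  show "a \<in> idl.span (I \<union> set (take i ls))"
    if i: "i < length ls" and a: "ls ! i * a \<in> idl.span (I \<union> set (take i ls))" for i a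
  proof -
    have "coset (ls ! i) \<otimes>\<^bsub>Q\<^esub> coset a \<in> coset ` idl.span (I \<union> set (take i ls))"
      using a unfolding coset_mult[symmetric] by blast
    then have "coset a \<in> coset ` idl.span (I \<union> set (take i ls))"
      using assms i unfolding regular_sequence_def eq by (simp add: carrier_Q)
    then show ?thesis by (simp add: coset_image_iff[OF idl.subspace_span sub])
  qed
  show "1 \<notin> idl.span (I \<union> set ls)"
  proof
    assume 1: "1 \<in> idl.span (I \<union> set ls)"
    have "x * 1 \<in> idl.span (I \<union> set ls)" for x by (rule idl.span_scale[OF 1])
    then have "carrier Q = coset ` idl.span (I \<union> set ls)" by (auto simp: carrier_Q)
    then show False using assms unfolding regular_sequence_def by (simp add: genideal_quotient)
  qed
qed

end

subsection \<open>Dimension\<close>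

lemma growth_le_mono: "growth_le J k \<Longrightarrow> k \<le> k' \<Longrightarrow> growth_le J k'"
proof -
  assume "growth_le J k" and le: "k \<le> k'"
  then obtain C where C: "\<And>d. ahilb J d \<le> C * (d + 1) ^ k" unfolding growth_le_def by blast
  have "ahilb J d \<le> C * (d + 1) ^ k'" for d
  proof -
    have "(d + 1) ^ k \<le> (d + 1) ^ k'" by (rule power_increasing) (use le in auto)
    then show ?thesis using C[of d] mult_le_mono2 le_trans by blast
  qed
  then show ?thesis unfolding growth_le_def by blast
qed

text \<open>An element of the next prime outside the present one is a non-zero-divisor modulo the
  latter, so every inclusion of the chain costs one order of growth.\<close>

lemma prime_chain_length_le:
  fixes p :: "nat \<Rightarrow> ('x::finite, 'k::field) mpoly set"
  assumes I: "idl.subspace I" "growth_le I m"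
    and p: "\<And>i. i \<le> k \<Longrightarrow> prime_idl (p i)" "\<And>i. i < k \<Longrightarrow> p i \<subset> p (Suc i)" "I \<subseteq> p 0"
  shows "k \<le> m"
proof -
  have "\<exists>k'. m = i + k' \<and> growth_le (p i) k'" if "i \<le> k" for i
    using that
  proof (induction i)
    case 0
    have "growth_le (p 0) m"
      by (rule growth_le_antimono[OF I(2,1) _ p(3)]) (use p(1)[of 0] in \<open>simp add: prime_idl_def\<close>)
    then show ?case by simp
  next
    case (Suc i)
    then obtain k' where k': "m = i + k'" "growth_le (p i) k'" by auto
    obtain f where f: "f \<in> p (Suc i)" "f \<notin> p i" using p(2)[of i] Suc by auto
    have pr: "prime_idl (p i)" "prime_idl (p (Suc i))" using p(1) Suc by auto
    have "\<exists>k''. k' = Suc k'' \<and> growth_le (p (Suc i)) k''"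
    proof (rule growth_drop[OF _ _ _ _ f(1) _ k'(2)])
      show "x \<in> p i" if "f * x \<in> p i" for x using that f(2) pr(1) unfolding prime_idl_def by blast
    qed (use pr p(2)[of i] Suc in \<open>auto simp: prime_idl_def\<close>)
    then show ?case using k' by auto
  qed
  from this[of k] show ?thesis by auto
qed

section \<open>Homogeneous primes and the construction of prime chains\<close>

definition irrelevant_ideal :: "('x::finite, 'k::field) mpoly set"
  where "irrelevant_ideal = {f. mpoly_eval id (\<lambda>_. 0) f = 0}"

lemma prime_irrelevant_ideal: "prime_idl irrelevant_ideal"
  by (simp add: prime_idl_def irrelevant_ideal_def idl.subspace_def ev.mpoly_eval_add ev.mpoly_eval_mult)

lemma subspace_irrelevant_ideal: "idl.subspace irrelevant_ideal"
  and one_notin_irrelevant_ideal: "1 \<notin> irrelevant_ideal"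
  using prime_irrelevant_ideal unfolding prime_idl_def by blast+

lemma eval_0_eq_lookup:
  fixes f :: "('x::finite, 'a::field) mpoly"
  shows "mpoly_eval id (\<lambda>_. 0) f = lookup f 0"
proof (induction f rule: mpoly_induct)
  case (add c \<nu> p)
  have m: "mpoly_eval id (\<lambda>_. 0) (monomial \<nu> :: ('x, 'a) mpoly) = lookup (monomial \<nu> :: ('x, 'a) mpoly) 0"
  proof (cases "\<nu> = 0")
    case False
    then obtain i where "lookup \<nu> i \<noteq> 0" by (metis lookup_zero poly_mapping_eqI)
    then have "(0::'a) ^ lookup \<nu> i = 0" by simp
    then have "(\<Prod>i\<in>UNIV. (0::'a) ^ lookup \<nu> i) = 0" by (intro prod_zero) auto
    then show ?thesis using False by (simp add: ev.mpoly_eval_monomial lookup_monomial)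
  qed simp
  show ?case
    unfolding ev.mpoly_eval_add ev.mpoly_eval_mult ev.mpoly_eval_const lookup_add lookup_const_mult add m
    by simp
qed (simp only: ev.mpoly_eval_0 lookup_zero)

text \<open>The constant term of an element is its component of degree 0 and hence lies in
  \<open>J\<close>; a nonzero constant would generate the unit ideal.\<close>

lemma proper_graded_subset_irrelevant:
  fixes J :: "('x::finite, 'k::field) mpoly set"
  assumes J: "idl.subspace J" "graded J" "1 \<notin> J"
  shows "J \<subseteq> irrelevant_ideal"
proof
  fix f assume f: "f \<in> J"
  let ?a = "lookup f 0"
  have "homog_part 0 f = const ?a"
    by (rule poly_mapping_eqI)
      (auto simp: lookup_terms_satisfying exp_degree_eq_0_iff const_def lookup_single when_def)
  then have "const ?a \<in> J" using J(2) f unfolding graded_def by metis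
  then have "const (1 / ?a) * const ?a \<in> J" by (rule idl.subspace_scale[OF J(1)])
  then have "?a = 0" using J(3) by (cases "?a = 0") (auto simp flip: const_mult)
  then show "f \<in> irrelevant_ideal" by (simp add: irrelevant_ideal_def eval_0_eq_lookup)
qed

lemma homog_1_subset_irrelevant: "homog 1 \<subseteq> irrelevant_ideal"
  by (auto simp: irrelevant_ideal_def eval_0_eq_lookup polys_on_def in_keys_iff subset_iff)

text \<open>For \<open>a\<close> and \<open>b\<close> outside \<open>P\<close>, take their
  components of least degree outside \<open>P\<close>. The lower components can be discarded modulo
  \<open>P\<close>, and then the product of the two chosen components is the lowest component of an
  element of \<open>P\<close>.\<close>

lemma graded_prime:
  fixes P :: "('x::finite, 'k::field) mpoly set"
  assumes P: "idl.subspace P" "graded P" "1 \<notin> P"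
    and pr: "\<And>a b d e. a \<in> homog d \<Longrightarrow> b \<in> homog e \<Longrightarrow> a * b \<in> P \<Longrightarrow> a \<in> P \<or> b \<in> P"
  shows "prime_idl P"
  unfolding prime_idl_def
proof (intro conjI allI impI)
  fix a b assume ab: "a * b \<in> P"
  show "a \<in> P \<or> b \<in> P"
  proof (rule ccontr)
    assume n: "\<not> (a \<in> P \<or> b \<in> P)"
    define h :: "nat \<Rightarrow> ('x, 'k) mpoly \<Rightarrow> ('x, 'k) mpoly" where "h d = homog_part d" for d
    define lo :: "nat \<Rightarrow> ('x, 'k) mpoly \<Rightarrow> ('x, 'k) mpoly" where "lo d = terms_satisfying (\<lambda>\<nu>. exp_degree \<nu> < d)" for d
    define hi :: "nat \<Rightarrow> ('x, 'k) mpoly \<Rightarrow> ('x, 'k) mpoly" where "hi d = terms_satisfying (\<lambda>\<nu>. exp_degree \<nu> > d)" for d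
    have dec: "f = lo d f + (h d f + hi d f)" for f d
      by (rule poly_mapping_eqI) (auto simp: lo_def h_def hi_def lookup_add lookup_terms_satisfying)
    have low: "\<exists>d. h d f \<notin> P \<and> lo d f \<in> P" if f: "f \<notin> P" for f
    proof -
      have "\<exists>d. h d f \<notin> P"
      proof (rule ccontr)
        assume "\<not> ?thesis"
        then have "(\<Sum>d\<in>exp_degree ` keys f. h d f) \<in> P" by (intro idl.subspace_sum[OF P(1)]) simp
        then show False using f sum_homog_components[of f] by (simp add: h_def)
      qed
      then have *: "h (LEAST d. h d f \<notin> P) f \<notin> P" by (rule LeastI_ex)
      define d where "d = (LEAST d. h d f \<notin> P)"
      have "h e f \<in> P" if "e < d" for e using not_less_Least that unfolding d_def by blast
      then have "(\<Sum>e<d. h e f) \<in> P" by (intro idl.subspace_sum[OF P(1)]) simp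
      moreover have "(\<Sum>e<d. h e f) = lo d f"
        by (rule poly_mapping_eqI) (auto simp: lo_def h_def lookup_sum lookup_terms_satisfying)
      ultimately show ?thesis using * d_def by auto
    qed
    obtain d where d: "h d a \<notin> P" "lo d a \<in> P" using low n by blast
    obtain e where e: "h e b \<notin> P" "lo e b \<in> P" using low n by blast
    have "a * b - (lo d a * b + (h d a + hi d a) * lo e b) \<in> P"
      by (intro idl.subspace_diff[OF P(1) ab] idl.subspace_add[OF P(1)] idl.subspace_scale[OF P(1) e(2)]
          idl_mult_right[OF P(1) d(2)])
    moreover have "a * b - (lo d a * b + (h d a + hi d a) * lo e b) = (h d a + hi d a) * (h e b + hi e b)"
    proof -
      have "(x + y) * (x' + y') - (x * (x' + y') + y * x') = y * y'" for x y x' y' :: "('x, 'k) mpoly"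
        by (simp add: algebra_simps)
      from this[of "lo d a" "h d a + hi d a" "lo e b" "h e b + hi e b"]
      show ?thesis by (simp only: dec[symmetric])
    qed
    ultimately have "(h d a + hi d a) * (h e b + hi e b) \<in> P" by simp
    then have "h (d + e) ((h d a + hi d a) * (h e b + hi e b)) \<in> P"
      using P(2) by (simp add: graded_def h_def)
    moreover have "h (d + e) ((h d a + hi d a) * (h e b + hi e b)) = h d a * h e b"
    proof -
      have hh: "h d f \<in> homog d" for f d unfolding h_def by (rule terms_satisfying_in_polys_on)
      have hi: "hi d f \<in> polys_on {\<nu>. exp_degree \<nu> > d}" for f d
        unfolding hi_def by (rule terms_satisfying_in_polys_on)
      have 1: "h d a * h e b \<in> homog (d + e)" by (rule homog_mult[OF hh hh])
      have "h e b \<in> polys_on {\<nu>. exp_degree \<nu> \<ge> e}"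
        by (rule subsetD[OF polys_on_mono hh]) auto
      moreover have "hi e b \<in> polys_on {\<nu>. exp_degree \<nu> \<ge> e}"
        by (rule subsetD[OF polys_on_mono hi]) auto
      ultimately have "h e b + hi e b \<in> polys_on {\<nu>. exp_degree \<nu> \<ge> e}"
        by (rule vs.subspace_add[OF subspace_polys_on])
      then have 2: "hi d a * (h e b + hi e b) \<in> polys_on {\<nu>. exp_degree \<nu> > d + e}"
        by (rule polys_on_mult[OF hi]) (auto simp: exp_degree_add)
      have 3: "h d a * hi e b \<in> polys_on {\<nu>. exp_degree \<nu> > d + e}"
        by (rule polys_on_mult[OF hh hi]) (auto simp: exp_degree_add)
      have "(h d a + hi d a) * (h e b + hi e b) = h d a * h e b + (h d a * hi e b + hi d a * (h e b + hi e b))"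
        by (simp add: algebra_simps)
      moreover have "h (d + e) (h d a * h e b) = h d a * h e b"
        unfolding h_def[of "d + e"] using 1 by (intro terms_satisfying_polys_on) auto
      moreover have "h (d + e) (h d a * hi e b + hi d a * (h e b + hi e b)) = 0"
        unfolding h_def[of "d + e"]
        using vs.subspace_add[OF subspace_polys_on 3 2]
        by (intro terms_satisfying_none) (auto simp: polys_on_def)
      ultimately show ?thesis by (simp add: h_def terms_satisfying_add)
    qed
    ultimately have "h d a * h e b \<in> P" by simp
    then show False
      using pr[of "h d a" d "h e b" e] d e terms_satisfying_in_polys_on unfolding h_def by blast
  qed
qed (use P in auto)

lemma polys_on_supported_mult:
  "p \<in> polys_on (supported B) \<Longrightarrow> q \<in> polys_on (supported B) \<Longrightarrow> p * q \<in> polys_on (supported B)"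
  by (erule polys_on_mult) (auto simp: supported_def lookup_add)

text \<open>The chain starts with a homogeneous ideal that is maximal among those containing no nonzero form
  in the parameters.\<close>

lemma prime_chain_exists:
  fixes J :: "('x::finite, 'k::field_char_0) mpoly set"
  assumes "idl.subspace J" "graded J" "1 \<notin> J" "\<And>k'. k' < k \<Longrightarrow> \<not> params J k'"
  shows "\<exists>p. (\<forall>i\<le>k. prime_idl (p i) \<and> J \<subseteq> p i) \<and> (\<forall>i<k. p i \<subset> p (Suc i))"
  using assms
proof (induction k arbitrary: J)
  case 0
  have "J \<subseteq> irrelevant_ideal" by (rule proper_graded_subset_irrelevant) (use 0 in auto)
  then show ?case
    by (intro exI[of _ "\<lambda>_. irrelevant_ideal"]) (simp add: prime_irrelevant_ideal)
next
  case (Suc k)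
  note J = Suc.prems(1-3)
  have "\<not> params J k" using Suc.prems(4) by simp
  obtain B :: "'x set" and l :: "'x \<Rightarrow> ('x, 'k) mpoly" and N where B: "k < card B" "\<And>i. l i \<in> homog 1"
    "\<And>i. i \<notin> B \<Longrightarrow> l i = 0" "homog N \<subseteq> idl.span (J \<union> l ` B)"
    "\<And>p d. p \<in> homog d \<Longrightarrow> p \<in> polys_on (supported B) \<Longrightarrow> mpoly_eval const l p \<in> J \<Longrightarrow> p = 0"
    using minimal_params[OF J(1) \<open>\<not> params J k\<close>] by metis
  \<comment> \<open>The nonzero forms in the parameters, evaluated at \<open>l\<close>. They are
    multiplicatively closed because the polynomial ring is a domain, and \<open>J\<close> avoids
    them by the choice of the parameters.\<close>
  define S where "S = {mpoly_eval const l p | p d. p \<in> homog d \<and> p \<in> polys_on (supported B) \<and> p \<noteq> 0}"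
  have Smult: "s * t \<in> S" if st: "s \<in> S" "t \<in> S" for s t
  proof -
    obtain p d where p: "s = mpoly_eval const l p" "p \<in> homog d" "p \<in> polys_on (supported B)" "p \<noteq> 0"
      using st(1) unfolding S_def by blast
    obtain q e where q: "t = mpoly_eval const l q" "q \<in> homog e" "q \<in> polys_on (supported B)" "q \<noteq> 0"
      using st(2) unfolding S_def by blast
    have "s * t = mpoly_eval const l (p * q)" using p q by (simp add: subst.mpoly_eval_mult)
    moreover have "p * q \<in> homog (d + e)" by (rule homog_mult[OF p(2) q(2)])
    moreover have "p * q \<in> polys_on (supported B)" by (rule polys_on_supported_mult[OF p(3) q(3)])
    moreover have "p * q \<noteq> 0" using p(4) q(4) by (simp add: mpoly_mult_eq_0_iff)
    ultimately show ?thesis unfolding S_def by blast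
  qed
  define \<A> where "\<A> = {P. idl.subspace P \<and> graded P \<and> J \<subseteq> P \<and> P \<inter> S = {}}"
  have "J \<inter> S = {}" using B(5) unfolding S_def by blast
  then have "J \<in> \<A>" using J by (simp add: \<A>_def)
  have "\<exists>M\<in>\<A>. \<forall>Y\<in>\<A>. M \<subseteq> Y \<longrightarrow> Y = M"
  proof (rule subset_Zorn_nonempty)
    show "\<A> \<noteq> {}" using \<open>J \<in> \<A>\<close> by blast
    fix \<C> assume C: "\<C> \<noteq> {}" "subset.chain \<A> \<C>"
    have CA: "\<C> \<subseteq> \<A>" and tot: "\<And>x y. x \<in> \<C> \<Longrightarrow> y \<in> \<C> \<Longrightarrow> x \<subseteq> y \<or> y \<subseteq> x"
      using C(2) unfolding subset_chain_def by blast+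
    have "idl.subspace (\<Union>\<C>)"
    proof (rule idl.subspaceI)
      show "0 \<in> \<Union>\<C>" using C(1) CA unfolding \<A>_def by (blast intro: idl.subspace_0)
      show "x + y \<in> \<Union>\<C>" if xy: "x \<in> \<Union>\<C>" "y \<in> \<Union>\<C>" for x y
      proof -
        obtain Z1 Z2 where "Z1 \<in> \<C>" "x \<in> Z1" "Z2 \<in> \<C>" "y \<in> Z2" using xy by blast
        then obtain Z where "Z \<in> \<C>" "x \<in> Z" "y \<in> Z" using tot by blast
        moreover have "idl.subspace Z" using \<open>Z \<in> \<C>\<close> CA unfolding \<A>_def by blast
        ultimately show ?thesis using idl.subspace_add by blast
      qed
      show "c * x \<in> \<Union>\<C>" if x: "x \<in> \<Union>\<C>" for c x
        using x CA unfolding \<A>_def by (blast intro: idl.subspace_scale)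
    qed
    moreover have "graded (\<Union>\<C>)"
      using CA unfolding \<A>_def graded_def by blast
    ultimately show "\<Union>\<C> \<in> \<A>" using C(1) CA unfolding \<A>_def by blast
  qed
  then obtain P where P: "P \<in> \<A>" "\<And>Y. Y \<in> \<A> \<Longrightarrow> P \<subseteq> Y \<Longrightarrow> Y = P" by blast
  have P1: "idl.subspace P" "graded P" "J \<subseteq> P" "P \<inter> S = {}" using P(1) by (auto simp: \<A>_def)
  have "1 \<in> S"
  proof -
    have "(1 :: ('x, 'k) mpoly) \<in> homog 0" using const_in_homog[of "1 :: 'k"] by simp
    moreover have "(1 :: ('x, 'k) mpoly) \<in> polys_on (supported B)"
      by (simp add: polys_on_def supported_def)
    moreover have "mpoly_eval const l 1 = 1" by simp
    ultimately show ?thesis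
      unfolding S_def by (intro CollectI exI[of _ 1] exI[of _ 0] conjI) (simp_all only: one_neq_zero not_False_eq_True)
  qed
  then have P0: "1 \<notin> P" using P1(4) by blast
  \<comment> \<open>By maximality, \<open>P\<close> together with a form outside it generates an
    ideal that meets \<open>S\<close>. Two such forms cannot have their product in \<open>P\<close>,
    since a product of elements of \<open>S\<close> would then lie there.\<close>
  have meet: "\<exists>s\<in>S. \<exists>p\<in>P. \<exists>q. s = p + q * a" if a: "a \<in> homog d" "a \<notin> P" for a d
  proof (rule ccontr)
    assume n: "\<not> ?thesis"
    let ?Y = "idl.span (P \<union> {a})"
    have PY: "P \<subseteq> ?Y" "a \<in> ?Y" by (auto intro: idl.span_base)
    have "?Y \<inter> S = {}" using n idl_span_Un_single[OF P1(1)] by blast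
    moreover have "graded ?Y" by (rule graded_add_form[OF P1(2), of _ d]) (use a in simp)
    ultimately have "?Y \<in> \<A>" using PY P1(3) unfolding \<A>_def by auto
    then have "?Y = P" using P(2) PY by blast
    then show False using PY a by blast
  qed
  have pr: "prime_idl P"
  proof (rule graded_prime[OF P1(1,2) P0])
    fix a b d e assume ab: "a \<in> homog d" "b \<in> homog e" "a * b \<in> P"
    show "a \<in> P \<or> b \<in> P"
    proof (rule ccontr)
      assume n: "\<not> ?thesis"
      obtain s p q where s: "s \<in> S" "p \<in> P" "s = p + q * a" using meet[OF ab(1)] n by blast
      obtain t p' q' where t: "t \<in> S" "p' \<in> P" "t = p' + q' * b" using meet[OF ab(2)] n by blast
      have "p * t + p' * (q * a) + (q * q') * (a * b) \<in> P"
        by (intro idl.subspace_add[OF P1(1)] idl_mult_right[OF P1(1)] idl.subspace_scale[OF P1(1) ab(3)] s t)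
      moreover have "s * t = p * t + p' * (q * a) + (q * q') * (a * b)"
        by (simp add: s(3) t(3) algebra_simps)
      ultimately have "s * t \<in> P" by simp
      then show False using Smult[OF s(1) t(1)] P1(4) by blast
    qed
  qed
  have injP: "p = 0" if "p \<in> homog d" "p \<in> polys_on (supported B)" "mpoly_eval const l p \<in> P" for p d
    using that P1(4) unfolding S_def by blast
  \<comment> \<open>The parameters remain independent modulo \<open>P\<close>, so the growth of
    \<open>P\<close> exceeds order \<open>k\<close>.\<close>
  have npP: "\<not> params P k"
  proof
    assume "params P k"
    then obtain C where C: "\<And>d. ahilb P d \<le> C * (d + 1) ^ k"
      using params_imp_growth[OF P1(1,2)] unfolding growth_le_def by blast
    have "(e + 1) ^ card B \<le> C * (card B * e + 1) ^ k" for e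
    proof -
      have "(e + 1) ^ card B \<le> ahilb P (card B * e)"
        by (rule ahilb_lower_bound[OF P1(1,2), where l = l], rule B(2), rule injP)
      then show ?thesis using C[of "card B * e"] by linarith
    qed
    then show False by (rule growth_lower_contradiction[OF B(1)])
  qed
  \<comment> \<open>A parameter \<open>l b\<close> belongs to \<open>S\<close> and so lies outside
    \<open>P\<close>. Adding it gives a strictly larger proper graded ideal for which fewer than
    \<open>k\<close> parameters do not suffice, and the induction hypothesis continues the chain
    above \<open>P\<close>.\<close>
  obtain b where b: "b \<in> B" using B(1) by fastforce
  let ?J = "idl.span (P \<union> {l b})"
  have "l b \<in> S"
  proof -
    have "(var b :: ('x, 'k) mpoly) \<in> polys_on (supported B)"
      using b by (auto simp: var_eq_monomial supported_def lookup_single when_def)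
    moreover have "l b = mpoly_eval const l (var b)" by (simp add: subst.mpoly_eval_var)
    moreover have "(var b :: ('x, 'k) mpoly) \<noteq> 0" by (simp add: var_eq_monomial)
    ultimately show ?thesis unfolding S_def using var_in_homog[of b, where 'k = 'k] by blast
  qed
  then have lbP: "l b \<notin> P" using P1(4) by blast
  have PJ: "P \<subseteq> ?J" "l b \<in> ?J" by (auto intro: idl.span_base)
  have "?J \<subseteq> irrelevant_ideal"
  proof (rule idl.span_minimal)
    show "P \<union> {l b} \<subseteq> irrelevant_ideal"
      using proper_graded_subset_irrelevant[OF P1(1,2) P0] homog_1_subset_irrelevant B(2) by blast
  qed (rule subspace_irrelevant_ideal)
  then have "1 \<notin> ?J" using one_notin_irrelevant_ideal by blast
  moreover have "graded ?J" by (rule graded_add_form[OF P1(2), of _ 1]) (use B(2) in simp)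
  moreover have "\<not> params ?J k'" if "k' < k" for k'
  proof
    assume "params ?J k'"
    then have "params P (Suc k')" using B(2) by (rule params_add_form)
    then have "params P k" by (rule params_mono) (use that in simp)
    then show False using npP by blast
  qed
  ultimately obtain p where p: "\<forall>i\<le>k. prime_idl (p i) \<and> ?J \<subseteq> p i" "\<forall>i<k. p i \<subset> p (Suc i)"
    using Suc.IH[OF idl.subspace_span, of "P \<union> {l b}"] by blast
  define p' where "p' i = (case i of 0 \<Rightarrow> P | Suc i \<Rightarrow> p i)" for i
  have "prime_idl (p' i) \<and> J \<subseteq> p' i" if "i \<le> Suc k" for i
  proof (cases i)
    case 0
    then show ?thesis using pr P1(3) by (simp add: p'_def)
  next
    case (Suc j)
    then show ?thesis using p(1) that P1(3) PJ(1) by (auto simp: p'_def)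
  qed
  moreover have "p' i \<subset> p' (Suc i)" if "i < Suc k" for i
  proof (cases i)
    case 0
    have "?J \<subseteq> p 0" using p(1) by simp
    then have "P \<subset> p 0" using PJ lbP by blast
    then show ?thesis using 0 by (simp add: p'_def)
  next
    case (Suc j)
    then show ?thesis using p(2) that by (simp add: p'_def)
  qed
  ultimately show ?case by blast
qed

text \<open>As the supremum is \<open>m\<close>, some chain is longer than \<open>m - 1\<close>,
  which excludes growth of order \<open>m - 1\<close>. If \<open>m\<close> parameters did not
  suffice, there would be a chain of length \<open>m + 1\<close>. Positivity of \<open>m\<close>
  provides a prime above \<open>I\<close>, so that the quotient is not the zero ring.\<close>

theorem ideal_dim_params:
  fixes I :: "('x::finite, 'k::field_char_0) mpoly set"
  assumes I: "idl.subspace I" "graded I" and dim: "ideal_dim I = enat m" and m: "0 < m"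
  shows "1 \<notin> I" "params I m" "\<not> growth_le I (m - 1)"
proof -
  interpret q: quotient I by standard (rule I(1))
  define C where "C = {k. \<exists>p :: nat \<Rightarrow> ('x, 'k) mpoly set. (\<forall>i\<le>k. prime_idl (p i) \<and> I \<subseteq> p i) \<and> (\<forall>i<k. p i \<subset> p (Suc i))}"
  have dimC: "(SUP k\<in>C. enat k) = enat m"
    using dim unfolding ideal_dim_def krull_dim_def q.prime_chain_quotient_iff C_def .
  have "m - 1 < m" using m by simp
  then have "enat (m - 1) < (SUP k\<in>C. enat k)" unfolding dimC by simp
  then obtain k where k: "k \<in> C" "enat (m - 1) < enat k" unfolding less_SUP_iff by blast
  then obtain p :: "nat \<Rightarrow> ('x, 'k) mpoly set" where
    p: "\<forall>i\<le>k. prime_idl (p i) \<and> I \<subseteq> p i" "\<forall>i<k. p i \<subset> p (Suc i)" unfolding C_def by blast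
  show 1: "1 \<notin> I" using p(1) by (auto simp: prime_idl_def)
  show "\<not> growth_le I (m - 1)"
  proof
    assume "growth_le I (m - 1)"
    then have "k \<le> m - 1"
    proof (rule prime_chain_length_le[OF I(1)])
      show "p i \<subset> p (Suc i)" if "i < k" for i using p(2) that by blast
    qed (use p(1) in auto)
    then show False using k(2) by simp
  qed
  show "params I m"
  proof (rule ccontr)
    assume n: "\<not> params I m"
    have "\<exists>p. (\<forall>i\<le>Suc m. prime_idl (p i) \<and> I \<subseteq> p i) \<and> (\<forall>i<Suc m. p i \<subset> p (Suc i))"
      by (rule prime_chain_exists[OF I 1]) (use n params_mono in \<open>auto simp: less_Suc_eq_le\<close>)
    then have "Suc m \<in> C" unfolding C_def by blast
    then have "enat (Suc m) \<le> (SUP k\<in>C. enat k)" by (rule SUP_upper)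
    then show False unfolding dimC by simp
  qed
qed

text \<open>The growth of the zero ideal has at most the number of variables as its order, and a
  nonzero element of \<open>I\<close> is a non-zero-divisor modulo the zero ideal, so that the order
  for \<open>I\<close> is smaller.\<close>

lemma dim_less_card:
  fixes I :: "('x::finite, 'k::field_char_0) mpoly set"
  assumes I: "idl.subspace I" "I \<noteq> {0}" "1 \<notin> I" and g: "\<not> growth_le I (m - 1)"
  shows "m < CARD('x)"
proof -
  have z: "idl.subspace ({0} :: ('x, 'k) mpoly set)" "graded ({0} :: ('x, 'k) mpoly set)"
    by (simp_all add: graded_def)
  have g0: "growth_le ({0} :: ('x, 'k) mpoly set) CARD('x)"
    by (rule params_imp_growth[OF z params_card])
  have "0 \<in> I" using I(1) idl.subspace_0 by blast
  then obtain f where f: "f \<in> I" "f \<noteq> 0" using I(2) by blast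
  have "\<exists>k'. CARD('x) = Suc k' \<and> growth_le I k'"
    by (rule growth_drop[OF z(1) I(1) _ I(3) f(1) _ g0])
      (use \<open>0 \<in> I\<close> f(2) in \<open>auto simp: mpoly_mult_eq_0_iff\<close>)
  then obtain k' where k': "CARD('x) = Suc k'" "growth_le I k'" by blast
  have "\<not> k' \<le> m - 1" using g growth_le_mono[OF k'(2)] by blast
  then show ?thesis using k'(1) by simp
qed

subsection \<open>Depth\<close>

text \<open>Summation inverts differences: a linear non-zero-divisor replaces the Hilbert function
  by its first difference, so \<open>r\<close> summations lead back from the quotient by a regular
  sequence of length \<open>r\<close>.\<close>

definition partial_sums :: "(nat \<Rightarrow> nat) \<Rightarrow> nat \<Rightarrow> nat"
  where "partial_sums f d = (\<Sum>e\<le>d. f e)"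

lemma partial_sums_mono: "(\<And>d. f d \<le> g d) \<Longrightarrow> partial_sums f d \<le> partial_sums g d"
  unfolding partial_sums_def by (rule sum_mono)

lemma partial_sums_funpow_mono:
  "(\<And>d. f d \<le> g d) \<Longrightarrow> (partial_sums ^^ r) f d \<le> (partial_sums ^^ r) g d"
  by (induction r arbitrary: d) (auto intro: partial_sums_mono)

text \<open>The supremum exceeds \<open>r - 1\<close>, so some sequence has at least
  \<open>r\<close> members, and its first \<open>r\<close> members are again regular. For
  \<open>r = 0\<close> the empty list serves.\<close>

lemma depth_ge_sequence:
  fixes I :: "('x::finite, 'k::field_char_0) mpoly set"
  assumes I: "idl.subspace I" "1 \<notin> I" and r: "enat r \<le> ideal_depth I"
  obtains ls where "length ls = r" "set ls \<subseteq> homog 1"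
    "\<And>i a. i < r \<Longrightarrow> ls ! i * a \<in> idl.span (I \<union> set (take i ls)) \<Longrightarrow> a \<in> idl.span (I \<union> set (take i ls))"
    "1 \<notin> idl.span (I \<union> set ls)"
proof (cases r)
  case 0
  have e: "idl.span (I \<union> {}) = I" using I(1) by simp
  show ?thesis
  proof (rule that[of "[]"])
    show "1 \<notin> idl.span (I \<union> set [])" unfolding list.set e by (rule I(2))
  qed (use 0 in simp_all)
next
  case (Suc r')
  interpret q: quotient I by standard (rule I(1))
  have "enat r' < ideal_depth I" using r Suc by (metis Suc_ile_eq)
  then obtain ls where ls: "\<forall>l\<in>set ls. linear_form l" "regular_sequence q.Q (map q.coset ls)" "enat r' < enat (length ls)"
    unfolding ideal_depth_def less_SUP_iff q.coset_def by blast
  note reg = q.regular_sequence_quotientD[OF ls(2)]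
  have len: "r \<le> length ls" using ls(3) Suc by simp
  show ?thesis
  proof (rule that[of "take r ls"])
    show "set (take r ls) \<subseteq> homog 1" using ls(1) set_take_subset[of r ls] by (auto simp: linear_form_iff)
    show "a \<in> idl.span (I \<union> set (take i (take r ls)))"
      if "i < r" "take r ls ! i * a \<in> idl.span (I \<union> set (take i (take r ls)))" for i a
      using reg(1)[of i a] that len by (simp add: min_def)
    have "idl.span (I \<union> set (take r ls)) \<subseteq> idl.span (I \<union> set ls)"
      using set_take_subset[of r ls] by (intro idl.span_mono) auto
    then show "1 \<notin> idl.span (I \<union> set (take r ls))" using reg(2) by blast
  qed (use len in simp)
qed

text \<open>Modulo \<open>y\<close> all degrees from \<open>N\<close> on vanish, so multiplication
  by \<open>y\<close> maps degree \<open>d\<close> onto degree \<open>d + 1\<close>.\<close>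

lemma hilb_nonincreasing:
  fixes J :: "('x::finite, 'k::field) mpoly set"
  assumes J: "idl.subspace J" "graded J" and y: "y \<in> homog 1" and N: "homog N \<subseteq> idl.span (J \<union> {y})" "N \<le> d"
  shows "hilb J (Suc d) \<le> hilb J d"
proof -
  have "homog (Suc d) \<subseteq> idl.span (J \<union> {y})"
    using N(2) by (intro homog_subset_ideal_mono[OF idl.subspace_span N(1)]) simp
  then have "hilb (idl.span (J \<union> {y})) (Suc d) \<le> card ({} :: ('x, 'k) mpoly set)"
    unfolding hilb_def
    by (intro vs.codim_le_card[OF ideal_subspace[OF idl.subspace_span]]) (auto intro: vs.span_base)
  then show ?thesis using hilb_Suc_le[OF J y, of d] by simp
qed

text \<open>Where the least value on \<open>{N..}\<close> is attained, the function can neither fall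
  nor rise any further.\<close>

lemma eventually_constant:
  fixes h :: "nat \<Rightarrow> nat"
  assumes "\<And>d. N \<le> d \<Longrightarrow> h (Suc d) \<le> h d"
  shows "\<exists>d\<^sub>0\<ge>N. \<forall>d\<ge>d\<^sub>0. h d = h d\<^sub>0"
proof -
  define v where "v = (LEAST v. \<exists>d\<ge>N. h d = v)"
  have "\<exists>v. \<exists>d\<ge>N. h d = v" by blast
  then have "\<exists>d\<ge>N. h d = v" unfolding v_def by (rule LeastI_ex)
  then obtain d0 where d0: "N \<le> d0" "h d0 = v" by blast
  have "h d = v" if "d0 \<le> d" for d
  proof (rule antisym)
    show "v \<le> h d" unfolding v_def by (rule Least_le) (use that d0 in \<open>auto intro: exI[of _ d]\<close>)
    show "h d \<le> v" using that
    proof (induction d rule: dec_induct)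
      case (step d)
      then show ?case using assms[of d] d0 by simp
    qed (simp add: d0)
  qed
  then show ?thesis using d0 by auto
qed

text \<open>The quotient by the regular sequence is one-dimensional, so that some linear form maps each
  sufficiently high degree onto the next one.\<close>

lemma regular_linear_section:
  fixes I :: "('x::finite, 'k::field_char_0) mpoly set"
  assumes I: "idl.subspace I" "graded I" "1 \<notin> I" "params I (Suc r)" and r: "enat r \<le> ideal_depth I"
  obtains ls d\<^sub>0 where "length ls = r" "set ls \<subseteq> homog 1"
    "\<And>d. (partial_sums ^^ r) (hilb (idl.span (I \<union> set ls))) d \<le> hilb I d"
    "\<And>d. d\<^sub>0 \<le> d \<Longrightarrow> hilb (idl.span (I \<union> set ls)) d = hilb (idl.span (I \<union> set ls)) d\<^sub>0"
proof -
  obtain ls where ls: "length ls = r" "set ls \<subseteq> homog 1"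
    "\<And>i a. i < r \<Longrightarrow> ls ! i * a \<in> idl.span (I \<union> set (take i ls)) \<Longrightarrow> a \<in> idl.span (I \<union> set (take i ls))"
    "1 \<notin> idl.span (I \<union> set ls)"
    using depth_ge_sequence[OF I(1,3) r] by metis
  define J where "J i = idl.span (I \<union> set (take i ls))" for i
  have J: "idl.subspace (J i)" for i by (simp add: J_def)
  have grJ: "graded (J i)" for i
    unfolding J_def using ls(2) set_take_subset[of i ls] by (intro graded_add_form[OF I(2), of _ 1]) blast
  have take_Suc: "set (take (Suc i) ls) = set (take i ls) \<union> {ls ! i}" if "i < r" for i
    using that ls(1) by (simp add: take_Suc_conv_app_nth)
  have JS: "J (Suc i) = idl.span (J i \<union> {ls ! i})" if "i < r" for i
    unfolding J_def take_Suc[OF that] idl_span_Un_span ..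
  have sub: "J i \<subseteq> J (Suc i)" "ls ! i \<in> J (Suc i)" if "i < r" for i
    unfolding JS[OF that] by (auto intro: idl.span_base)
  have lin: "ls ! i \<in> homog 1" if "i < r" for i using that ls(1,2) nth_mem by blast
  have J1: "1 \<notin> J i" for i
  proof -
    have "J i \<subseteq> idl.span (I \<union> set ls)"
      unfolding J_def using set_take_subset[of i ls] by (intro idl.span_mono) auto
    then show ?thesis using ls(4) by blast
  qed
  have J0: "J 0 = I" using I(1) by (simp add: J_def)
  \<comment> \<open>Each member of the sequence lowers the order of growth by one, from
    \<open>r + 1\<close> down to 1.\<close>
  have g: "\<exists>k. Suc r = i + k \<and> growth_le (J i) k" if "i \<le> r" for i
    using that
  proof (induction i)
    case 0
    then show ?case using J0 params_imp_growth[OF I(1,2,4)] by simp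
  next
    case (Suc i)
    then obtain k where k: "Suc r = i + k" "growth_le (J i) k" by auto
    have "\<exists>k'. k = Suc k' \<and> growth_le (J (Suc i)) k'"
      by (rule growth_drop[OF J J _ J1 _ _ k(2), where f = "ls ! i"])
        (use sub ls(3) Suc.prems in \<open>auto simp: J_def\<close>)
    then show ?case using k by auto
  qed
  \<comment> \<open>Each member is a non-zero-divisor modulo its predecessors, so one summation
    leads from \<open>J (Suc i)\<close> back to a bound by \<open>J i\<close>.\<close>
  have ps: "(partial_sums ^^ i) (hilb (J i)) d \<le> hilb I d" if "i \<le> r" for i d
    using that
  proof (induction i arbitrary: d)
    case 0
    then show ?case using J0 by simp
  next
    case (Suc i)
    have "partial_sums (hilb (J (Suc i))) d \<le> hilb (J i) d" for d
      unfolding partial_sums_def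
      by (rule hilb_regular_sum[OF J J, where f = "ls ! i"])
        (use sub ls(3) lin Suc.prems in \<open>auto simp: J_def\<close>)
    then have "(partial_sums ^^ i) (partial_sums (hilb (J (Suc i)))) d \<le> (partial_sums ^^ i) (hilb (J i)) d"
      by (rule partial_sums_funpow_mono)
    then show ?case using Suc.IH[of d] Suc.prems by (simp only: funpow_Suc_right o_def) simp
  qed
  have Jr: "J r = idl.span (I \<union> set ls)" using ls(1) by (simp add: J_def)
  have "growth_le (J r) 1" using g[of r] by auto
  then have "params (J r) 1" by (rule growth_imp_params[OF J grJ])
  then obtain F N where F: "finite F" "card F \<le> 1" "F \<subseteq> homog 1" "homog N \<subseteq> idl.span (J r \<union> F)"
    unfolding params_def by blast
  \<comment> \<open>If no parameter is left, the form 0 takes its place.\<close>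
  obtain y where y: "F \<subseteq> {y}" "y \<in> homog 1"
  proof (cases "F = {}")
    case True
    then show ?thesis using that[of 0] by simp
  next
    case False
    then obtain y where "y \<in> F" by blast
    then have "F = {y}" using F(1,2) card_le_Suc0_iff_eq[of F] by auto
    then show ?thesis using that F(3) by blast
  qed
  have "idl.span (J r \<union> F) \<subseteq> idl.span (J r \<union> {y})" using y by (intro idl.span_mono) auto
  then have N: "homog N \<subseteq> idl.span (J r \<union> {y})" using F(4) by blast
  have "hilb (J r) (Suc d) \<le> hilb (J r) d" if "N \<le> d" for d
    by (rule hilb_nonincreasing[OF J grJ y(2) N that])
  then obtain d0 where d0: "\<forall>d\<ge>d0. hilb (J r) d = hilb (J r) d0"
    using eventually_constant[of N "hilb (J r)"] by blast
  show ?thesis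
  proof (rule that[OF ls(1,2)])
    show "(partial_sums ^^ r) (hilb (idl.span (I \<union> set ls))) d \<le> hilb I d" for d
      using ps[of r d] unfolding Jr by simp
    show "hilb (idl.span (I \<union> set ls)) d = hilb (idl.span (I \<union> set ls)) d0" if "d0 \<le> d" for d
      using d0 that unfolding Jr by blast
  qed
qed

section \<open>Generic coordinates\<close>

subsection \<open>Polynomial functions of a matrix\<close>

text \<open>Regular functions on the space of matrices. They are functions and not polynomials, so
  that closure properties apply directly to expressions in \<open>g\<close>.\<close>

definition polyfun :: "('k::field ^ 'x::finite ^ 'x \<Rightarrow> 'k) \<Rightarrow> bool"
  where "polyfun \<phi> \<longleftrightarrow> (\<exists>f. \<forall>g. \<phi> g = mpoly_eval id (\<lambda>(i, j). g $ i $ j) f)"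

lemma polyfun_const: "polyfun (\<lambda>_. c)"
  unfolding polyfun_def by (rule exI[of _ "const c"]) (simp only: ev.mpoly_eval_const id_apply simp_thms)

lemma polyfun_entry: "polyfun (\<lambda>g. g $ i $ j)"
  unfolding polyfun_def by (rule exI[of _ "var (i, j)"]) (simp only: ev.mpoly_eval_var prod.case simp_thms)

lemma polyfun_add:
  assumes "polyfun \<phi>" "polyfun \<psi>"
  shows "polyfun (\<lambda>g. \<phi> g + \<psi> g)"
proof -
  obtain f f' where "\<And>g. \<phi> g = mpoly_eval id (\<lambda>(i, j). g $ i $ j) f" "\<And>g. \<psi> g = mpoly_eval id (\<lambda>(i, j). g $ i $ j) f'"
    using assms unfolding polyfun_def by blast
  then show ?thesis
    unfolding polyfun_def by (intro exI[of _ "f + f'"]) (simp only: ev.mpoly_eval_add simp_thms)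
qed

lemma polyfun_mult:
  assumes "polyfun \<phi>" "polyfun \<psi>"
  shows "polyfun (\<lambda>g. \<phi> g * \<psi> g)"
proof -
  obtain f f' where "\<And>g. \<phi> g = mpoly_eval id (\<lambda>(i, j). g $ i $ j) f" "\<And>g. \<psi> g = mpoly_eval id (\<lambda>(i, j). g $ i $ j) f'"
    using assms unfolding polyfun_def by blast
  then show ?thesis
    unfolding polyfun_def by (intro exI[of _ "f * f'"]) (simp only: ev.mpoly_eval_mult simp_thms)
qed

lemma polyfun_diff:
  assumes "polyfun \<phi>" "polyfun \<psi>"
  shows "polyfun (\<lambda>g. \<phi> g - \<psi> g)"
  using polyfun_add[OF assms(1) polyfun_mult[OF polyfun_const[of "-1"] assms(2)]] by simp

lemma polyfun_sum: "(\<And>i. i \<in> S \<Longrightarrow> polyfun (\<phi> i)) \<Longrightarrow> polyfun (\<lambda>g. \<Sum>i\<in>S. \<phi> i g)"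
  by (induction S rule: infinite_finite_induct) (simp_all add: polyfun_const polyfun_add)

lemma polyfun_prod: "(\<And>i. i \<in> S \<Longrightarrow> polyfun (\<phi> i)) \<Longrightarrow> polyfun (\<lambda>g. \<Prod>i\<in>S. \<phi> i g)"
  by (induction S rule: infinite_finite_induct) (simp_all add: polyfun_const polyfun_mult)

lemma polyfun_power: "polyfun \<phi> \<Longrightarrow> polyfun (\<lambda>g. \<phi> g ^ n)"
  by (induction n) (simp_all add: polyfun_const polyfun_mult)

lemma polyfun_det:
  fixes M :: "'k::field ^ 'x::finite ^ 'x \<Rightarrow> 'k ^ 'x ^ 'x"
  assumes "\<And>i j. polyfun (\<lambda>g. M g $ i $ j)"
  shows "polyfun (\<lambda>g. det (M g))"
  unfolding det_def by (intro polyfun_sum polyfun_mult polyfun_const polyfun_prod assms)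

lemma polyfun_common_nonvanishing:
  fixes \<phi> :: "'j \<Rightarrow> 'k::field_char_0 ^ 'x::finite ^ 'x \<Rightarrow> 'k"
  assumes "finite S" "\<And>j. j \<in> S \<Longrightarrow> polyfun (\<phi> j)" "\<And>j. j \<in> S \<Longrightarrow> \<exists>g. \<phi> j g \<noteq> 0"
  shows "\<exists>g. \<forall>j\<in>S. \<phi> j g \<noteq> 0"
proof -
  have "\<forall>j\<in>S. \<exists>f. \<forall>g. \<phi> j g = mpoly_eval id (\<lambda>(i, j). g $ i $ j) f"
    using assms(2) unfolding polyfun_def by blast
  then obtain f where f: "\<And>j g. j \<in> S \<Longrightarrow> \<phi> j g = mpoly_eval id (\<lambda>(i, j). g $ i $ j) (f j)"
    by metis
  have "\<exists>a. \<forall>j\<in>S. mpoly_eval id a (f j) \<noteq> 0"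
  proof (rule common_nonvanishing_point[OF assms(1)])
    fix j assume j: "j \<in> S"
    obtain g where "\<phi> j g \<noteq> 0" using assms(3)[OF j] by blast
    then show "\<exists>a. mpoly_eval id a (f j) \<noteq> 0" using f[OF j, of g] by metis
  qed
  then obtain a where a: "\<forall>j\<in>S. mpoly_eval id a (f j) \<noteq> 0" by blast
  have e: "(\<lambda>(i, j). (\<chi> i j. a (i, j)) $ i $ j) = a" by auto
  have "\<forall>j\<in>S. \<phi> j (\<chi> i j. a (i, j)) \<noteq> 0" using a f[of _ "\<chi> i j. a (i, j)"] unfolding e by metis
  then show ?thesis by blast
qed

lemma matrix_inv_both:
  fixes g :: "'k::field ^ 'x::finite ^ 'x"
  assumes "invertible g"
  shows matrix_inv_right: "g ** matrix_inv g = mat 1" and matrix_inv_left: "matrix_inv g ** g = mat 1"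
  using someI_ex[of "\<lambda>A'. g ** A' = mat 1 \<and> A' ** g = mat 1"] assms
  unfolding matrix_inv_def invertible_def by blast+

text \<open>By Cramer's rule a polynomial function of the inverse matrix is a polynomial function divided by a
  power of the determinant.\<close>

definition inv_rational :: "('k::field ^ 'x::finite ^ 'x \<Rightarrow> 'k) \<Rightarrow> bool"
  where "inv_rational \<phi> \<longleftrightarrow> (\<exists>N \<psi>. polyfun \<psi> \<and> (\<forall>g. invertible g \<longrightarrow> \<phi> g * det g ^ N = \<psi> g))"

lemma polyfun_det_id: "polyfun (\<lambda>g :: 'k::field ^ 'x::finite ^ 'x. det g)"
  by (rule polyfun_det[of "\<lambda>g. g"]) (rule polyfun_entry)

lemma inv_rational_const: "inv_rational (\<lambda>_. c)"
  unfolding inv_rational_def using polyfun_const[of c] by (intro exI[of _ 0] exI[of _ "\<lambda>_. c"]) simp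

lemma inv_rational_mult:
  assumes "inv_rational \<phi>" "inv_rational \<phi>'"
  shows "inv_rational (\<lambda>g. \<phi> g * \<phi>' g)"
proof -
  obtain N \<psi> N' \<psi>' where *: "polyfun \<psi>" "\<And>g. invertible g \<Longrightarrow> \<phi> g * det g ^ N = \<psi> g"
    "polyfun \<psi>'" "\<And>g. invertible g \<Longrightarrow> \<phi>' g * det g ^ N' = \<psi>' g"
    using assms unfolding inv_rational_def by blast
  have "\<phi> g * \<phi>' g * det g ^ (N + N') = \<psi> g * \<psi>' g" if "invertible g" for g
    unfolding *(2)[OF that, symmetric] *(4)[OF that, symmetric] power_add by (simp only: mult_ac)
  then show ?thesis unfolding inv_rational_def using polyfun_mult[OF *(1,3)] by blast
qed

lemma inv_rational_add:
  assumes "inv_rational \<phi>" "inv_rational \<phi>'"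
  shows "inv_rational (\<lambda>g. \<phi> g + \<phi>' g)"
proof -
  obtain N \<psi> N' \<psi>' where *: "polyfun \<psi>" "\<And>g. invertible g \<Longrightarrow> \<phi> g * det g ^ N = \<psi> g"
    "polyfun \<psi>'" "\<And>g. invertible g \<Longrightarrow> \<phi>' g * det g ^ N' = \<psi>' g"
    using assms unfolding inv_rational_def by blast
  have "(\<phi> g + \<phi>' g) * det g ^ (N + N') = \<psi> g * det g ^ N' + \<psi>' g * det g ^ N" if "invertible g" for g
    unfolding *(2)[OF that, symmetric] *(4)[OF that, symmetric] power_add by (simp add: algebra_simps)
  moreover have "polyfun (\<lambda>g. \<psi> g * det g ^ N' + \<psi>' g * det g ^ N)"
    by (intro polyfun_add polyfun_mult polyfun_power polyfun_det_id *(1,3))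
  ultimately show ?thesis unfolding inv_rational_def by blast
qed

lemma inv_rational_sum: "(\<And>i. i \<in> S \<Longrightarrow> inv_rational (\<phi> i)) \<Longrightarrow> inv_rational (\<lambda>g. \<Sum>i\<in>S. \<phi> i g)"
  by (induction S rule: infinite_finite_induct) (simp_all add: inv_rational_const inv_rational_add)

lemma inv_rational_prod: "(\<And>i. i \<in> S \<Longrightarrow> inv_rational (\<phi> i)) \<Longrightarrow> inv_rational (\<lambda>g. \<Prod>i\<in>S. \<phi> i g)"
  by (induction S rule: infinite_finite_induct) (simp_all add: inv_rational_const inv_rational_mult)

lemma inv_rational_power: "inv_rational \<phi> \<Longrightarrow> inv_rational (\<lambda>g. \<phi> g ^ n)"
  by (induction n) (simp_all add: inv_rational_const inv_rational_mult)

text \<open>Column \<open>l\<close> of the inverse solves the linear system with a unit vector as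
  right-hand side; \<open>M g\<close> is the matrix of Cramer's rule, with column \<open>k\<close>
  replaced by that vector.\<close>

lemma inv_rational_entry:
  "inv_rational (\<lambda>g :: 'k::field ^ 'x::finite ^ 'x. matrix_inv g $ k $ l)"
proof -
  define M :: "'k ^ 'x ^ 'x \<Rightarrow> 'k ^ 'x ^ 'x" where "M g = (\<chi> i j. if j = k then axis l 1 $ i else g $ i $ j)" for g
  have "matrix_inv g $ k $ l * det g ^ 1 = det (M g)" if g: "invertible g" for g
  proof -
    have d: "det g \<noteq> 0" using g invertible_det_nz by blast
    have inv: "g ** matrix_inv g = mat 1" by (rule matrix_inv_right[OF g])
    have "g *v (matrix_inv g *v axis l 1) = axis l 1"
      by (simp add: matrix_vector_mul_assoc inv)
    then have "matrix_inv g *v axis l 1 = (\<chi> k. det (\<chi> i j. if j = k then axis l 1 $ i else g $ i $ j) / det g)"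
      using cramer[OF d] by blast
    then have "(matrix_inv g *v axis l 1) $ k = det (M g) / det g"
      unfolding M_def by (metis (no_types, lifting) vec_lambda_beta)
    moreover have "(matrix_inv g *v axis l 1) $ k = matrix_inv g $ k $ l"
    proof -
      have "(matrix_inv g *v axis l 1) $ k = (\<Sum>j\<in>UNIV. if j = l then matrix_inv g $ k $ j else 0)"
        unfolding matrix_vector_mult_def by (simp add: axis_def if_distrib[of "\<lambda>x. _ * x"] cong: if_cong)
      then show ?thesis by simp
    qed
    ultimately show ?thesis using d by simp
  qed
  moreover have "polyfun (\<lambda>g. det (M g))"
  proof (rule polyfun_det)
    show "polyfun (\<lambda>g. M g $ i $ j)" for i j
      by (cases "j = k") (simp_all add: M_def polyfun_const polyfun_entry)
  qed
  ultimately show ?thesis unfolding inv_rational_def by blast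
qed

text \<open>Multiplication by a power of the nonzero determinant clears denominators and leaves the
  zero set unchanged.\<close>

lemma polyfun_inverse:
  fixes \<phi> :: "'k::field ^ 'x::finite ^ 'x \<Rightarrow> 'k"
  assumes "polyfun \<phi>"
  shows "\<exists>\<psi>. polyfun \<psi> \<and> (\<forall>g. invertible g \<longrightarrow> (\<psi> g = 0 \<longleftrightarrow> \<phi> (matrix_inv g) = 0))"
proof -
  obtain f where f: "\<And>g. \<phi> g = mpoly_eval id (\<lambda>(i, j). g $ i $ j) f"
    using assms unfolding polyfun_def by blast
  have "inv_rational (\<lambda>g. \<phi> (matrix_inv g))"
    unfolding f mpoly_eval_def case_prod_beta
    by (intro inv_rational_sum inv_rational_mult inv_rational_const inv_rational_prod inv_rational_power inv_rational_entry)
  then obtain N \<psi> where *: "polyfun \<psi>" "\<And>g. invertible g \<Longrightarrow> \<phi> (matrix_inv g) * det g ^ N = \<psi> g"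
    unfolding inv_rational_def by blast
  have "\<psi> g = 0 \<longleftrightarrow> \<phi> (matrix_inv g) = 0" if "invertible g" for g
    using *(2)[OF that] that invertible_det_nz[of g] by auto
  then show ?thesis using *(1) by blast
qed

subsection \<open>Semicontinuity of the Hilbert function\<close>

definition polyvec :: "('k::field ^ 'x::finite ^ 'x \<Rightarrow> ('y, 'k) mpoly) \<Rightarrow> bool"
  where "polyvec v \<longleftrightarrow> (\<forall>\<nu>. polyfun (\<lambda>g. lookup (v g) \<nu>))"

text \<open>Independence of an indexed family instead of a set: members that coincide for some
  \<open>g\<close> have to count as dependent there.\<close>

definition fam_indep :: "('j \<Rightarrow> ('y, 'k::field) mpoly) \<Rightarrow> 'j set \<Rightarrow> bool"
  where "fam_indep v S \<longleftrightarrow> (\<forall>u. (\<Sum>j\<in>S. const (u j) * v j) = 0 \<longrightarrow> (\<forall>j\<in>S. u j = 0))"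

lemma fam_indepD: "fam_indep v S \<Longrightarrow> (\<Sum>j\<in>S. const (u j) * v j) = 0 \<Longrightarrow> j \<in> S \<Longrightarrow> u j = 0"
  by (simp add: fam_indep_def)

text \<open>Gaussian elimination: after clearing the coordinate in which one vector is nonzero from the others,
  these stay independent, and conversely.\<close>

lemma fam_indep_open:
  fixes y :: "'j \<Rightarrow> 'k::field ^ 'x::finite ^ 'x \<Rightarrow> ('y, 'k) mpoly"
  assumes "finite S" "\<And>j. j \<in> S \<Longrightarrow> polyvec (y j)" "fam_indep (\<lambda>j. y j g\<^sub>0) S"
  shows "\<exists>\<phi>. polyfun \<phi> \<and> \<phi> g\<^sub>0 \<noteq> 0 \<and> (\<forall>g. \<phi> g \<noteq> 0 \<longrightarrow> fam_indep (\<lambda>j. y j g) S)"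
  using assms
proof (induction S arbitrary: y)
  case empty
  show ?case by (rule exI[of _ "\<lambda>_. 1"]) (simp add: polyfun_const fam_indep_def)
next
  case (insert j S)
  have "y j g\<^sub>0 \<noteq> 0"
  proof
    assume 0: "y j g\<^sub>0 = 0"
    have "(\<Sum>i\<in>insert j S. const (if i = j then 1 else 0) * y i g\<^sub>0) = 0"
      by (rule sum.neutral) (simp add: 0)
    from fam_indepD[OF insert.prems(2) this, of j] show False by simp
  qed
  then obtain \<nu> where nu: "lookup (y j g\<^sub>0) \<nu> \<noteq> 0"
    by (metis lookup_zero poly_mapping_eqI)
  \<comment> \<open>The coefficient of \<open>y j\<close> at \<open>\<nu>\<close> is the pivot. In
    \<open>w i\<close> this coefficient is cleared by cross-multiplication instead of division, so
    that \<open>w i\<close> stays polynomial in \<open>g\<close>.\<close>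
  define c where "c i g = lookup (y i g) \<nu>" for i g
  define w where "w i g = const (c j g) * y i g - const (c i g) * y j g" for i g
  have pc: "polyfun (c i)" if "i \<in> insert j S" for i
    unfolding c_def using insert.prems(1)[OF that] unfolding polyvec_def by blast
  have elim: "(\<Sum>i\<in>S. const (u i) * w i g)
      = (\<Sum>i\<in>S. const (c j g * u i) * y i g) - const (\<Sum>i\<in>S. u i * c i g) * y j g" for u g
  proof -
    have "const (\<Sum>i\<in>S. u i * c i g) = (\<Sum>i\<in>S. const (u i * c i g) :: ('y, 'k) mpoly)"
      by (induction S rule: infinite_finite_induct) (simp_all add: const_add)
    moreover have "const (u i) * (const (c i g) * y j g) = const (u i * c i g) * y j g" for i
      by (simp only: const_mult mult.assoc)
    moreover have "const (u i) * (const (c j g) * y i g) = const (c j g * u i) * y i g" for i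
      by (simp only: const_mult mult.assoc mult.left_commute)
    ultimately show ?thesis
      by (simp only: w_def right_diff_distrib sum_subtractf sum_distrib_right)
  qed
  have 1: "polyvec (w i)" if "i \<in> S" for i
    unfolding polyvec_def w_def lookup_minus lookup_const_mult
    using pc that insert.prems(1) unfolding polyvec_def
    by (intro allI polyfun_diff polyfun_mult) auto
  have 2: "fam_indep (\<lambda>i. w i g\<^sub>0) S"
    unfolding fam_indep_def
  proof (intro allI impI ballI)
    fix u i assume 0: "(\<Sum>i\<in>S. const (u i) * w i g\<^sub>0) = 0" and i: "i \<in> S"
    let ?u = "\<lambda>i. if i = j then - (\<Sum>i\<in>S. u i * c i g\<^sub>0) else c j g\<^sub>0 * u i"
    have "(\<Sum>i\<in>S. const (?u i) * y i g\<^sub>0) = (\<Sum>i\<in>S. const (c j g\<^sub>0 * u i) * y i g\<^sub>0)"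
      by (rule sum.cong) (use insert.hyps(2) in auto)
    then have "(\<Sum>i\<in>insert j S. const (?u i) * y i g\<^sub>0) = 0"
      using 0 insert.hyps unfolding elim by (simp add: const_uminus)
    from fam_indepD[OF insert.prems(2) this, of i] have "?u i = 0" using i by blast
    moreover have "i \<noteq> j" using i insert.hyps(2) by blast
    ultimately have "c j g\<^sub>0 * u i = 0" by (simp only: if_False)
    then show "u i = 0" using nu by (simp add: c_def)
  qed
  obtain \<phi> where phi: "polyfun \<phi>" "\<phi> g\<^sub>0 \<noteq> 0" "\<And>g. \<phi> g \<noteq> 0 \<Longrightarrow> fam_indep (\<lambda>i. w i g) S"
    using insert.IH[OF 1 2] by blast
  show ?case
  proof (intro exI[of _ "\<lambda>g. \<phi> g * c j g"] conjI allI impI)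
    show "polyfun (\<lambda>g. \<phi> g * c j g)" by (intro polyfun_mult phi(1) pc) simp
    show "\<phi> g\<^sub>0 * c j g\<^sub>0 \<noteq> 0" using phi(2) nu by (simp add: c_def)
    fix g assume "\<phi> g * c j g \<noteq> 0"
    then have g: "fam_indep (\<lambda>i. w i g) S" "c j g \<noteq> 0" using phi(3) by auto
    show "fam_indep (\<lambda>i. y i g) (insert j S)"
      unfolding fam_indep_def
    proof (intro allI impI)
      fix u assume 0: "(\<Sum>i\<in>insert j S. const (u i) * y i g) = 0"
      then have s: "const (u j) * y j g + (\<Sum>i\<in>S. const (u i) * y i g) = 0"
        using insert.hyps by simp
      then have "lookup (const (u j) * y j g + (\<Sum>i\<in>S. const (u i) * y i g)) \<nu> = 0" by simp
      then have l: "u j * c j g + (\<Sum>i\<in>S. u i * c i g) = 0"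
        by (simp only: lookup_add lookup_sum lookup_const_mult c_def)
      have "(\<Sum>i\<in>S. const (c j g * u i) * y i g) = const (c j g) * (\<Sum>i\<in>S. const (u i) * y i g)"
        by (simp add: sum_distrib_left const_mult mult_ac)
      also have "(\<Sum>i\<in>S. const (u i) * y i g) = const (- u j) * y j g"
        using s by (simp add: const_uminus eq_neg_iff_add_eq_0 add.commute)
      also have "const (c j g) * (const (- u j) * y j g) = const (\<Sum>i\<in>S. u i * c i g) * y j g"
      proof -
        have "c j g * (- u j) = (\<Sum>i\<in>S. u i * c i g)"
          using l by (simp add: mult.commute eq_neg_iff_add_eq_0 neg_eq_iff_add_eq_0)
        then show ?thesis by (simp only: mult.assoc[symmetric] const_mult[symmetric])
      qed
      finally have "(\<Sum>i\<in>S. const (u i) * w i g) = 0" unfolding elim by simp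
      then have uS: "\<forall>i\<in>S. u i = 0" using g(1) unfolding fam_indep_def by blast
      then have "(\<Sum>i\<in>S. u i * c i g) = 0" by simp
      then have "u j = 0" using l g(2) by simp
      then show "\<forall>i\<in>insert j S. u i = 0" using uS by simp
    qed
  qed
qed

text \<open>Provides generators of degree \<open>d\<close> of the ideal that depend polynomially on
  the forms in \<open>F\<close>: passing to components of degree \<open>d\<close> turns each
  coefficient of a form into a combination of monomials.\<close>

lemma homog_part_span:
  fixes J :: "('x::finite, 'k::field) mpoly set"
  assumes J: "idl.subspace J" "graded J" and F: "F \<subseteq> homog 1" and x: "x \<in> idl.span (J \<union> F)" "x \<in> homog d"
  shows "x \<in> vs.span ((J \<inter> homog d) \<union> {monomial \<mu> * f | \<mu> f. f \<in> F \<and> exp_degree \<mu> + 1 = d})"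
    (is "x \<in> vs.span ?G")
proof -
  have "homog_part d x \<in> vs.span ?G"
    using x(1)
  proof (induction rule: idl.span_induct_alt)
    case base
    then show ?case by (simp add: vs.span_zero)
  next
    case (step c a b)
    have "homog_part d (c * a) \<in> vs.span ?G"
    proof (cases "a \<in> J")
      case True
      then have "c * a \<in> J" by (rule idl.subspace_scale[OF J(1)])
      then have "homog_part d (c * a) \<in> J \<inter> homog d"
        using J(2) terms_satisfying_in_polys_on unfolding graded_def by blast
      then show ?thesis by (intro vs.span_base) simp
    next
      case False
      then have a: "a \<in> F" using step(1) by simp
      define q where "q = terms_satisfying (\<lambda>\<nu>. exp_degree \<nu> + 1 = d) c"
      have "homog_part d (c * a) = q * a"
        unfolding q_def using a F by (intro terms_satisfying_homog_mult[where Q = "\<lambda>n. n = d"]) blast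
      also have "q * a = (\<Sum>\<mu>\<in>keys q. const (lookup q \<mu>) * (monomial \<mu> * a))"
        by (subst mpoly_expand_keys[of q]) (simp only: sum_distrib_right mult.assoc)
      also have "\<dots> \<in> vs.span ?G"
      proof (intro vs.span_sum vs.span_scale vs.span_base UnI2)
        fix \<mu> assume "\<mu> \<in> keys q"
        then have "exp_degree \<mu> + 1 = d" by (simp add: q_def keys_terms_satisfying)
        then show "monomial \<mu> * a \<in> {monomial \<mu> * f | \<mu> f. f \<in> F \<and> exp_degree \<mu> + 1 = d}" using a by blast
      qed
      finally show ?thesis .
    qed
    then show ?case using step(2) unfolding terms_satisfying_add by (rule vs.span_add)
  qed
  moreover have "homog_part d x = x"
    using x(2) by (intro terms_satisfying_polys_on) auto
  ultimately show ?thesis by simp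
qed

lemma fam_indep_imp_inj_on:
  fixes v :: "'j \<Rightarrow> ('y, 'k::field) mpoly"
  assumes "fam_indep v S" "finite S"
  shows "inj_on v S"
proof (rule inj_onI, rule ccontr)
  fix i j assume ij: "i \<in> S" "j \<in> S" "v i = v j" "i \<noteq> j"
  let ?u = "\<lambda>t. if t = i then 1 else if t = j then -1 else 0"
  have "(\<Sum>t\<in>S. const (?u t) * v t) = (\<Sum>t\<in>S. (if t = i then v t else 0) + (if t = j then - v t else 0))"
    by (rule sum.cong) (use ij in \<open>auto simp: const_uminus\<close>)
  also have "\<dots> = 0" using ij assms(2) by (simp add: sum.distrib)
  finally have F: "(\<Sum>t\<in>S. const (?u t) * v t) = 0" .
  have "?u i = (0 :: 'k)" by (rule fam_indepD[OF assms(1) F ij(1)])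
  then show False by simp
qed

lemma fam_indep_iff_indep_mod:
  assumes "finite S"
  shows "fam_indep v S \<longleftrightarrow> inj_on v S \<and> vs.indep_mod {0} (v ` S)"
proof
  assume f: "fam_indep v S"
  have inj: "inj_on v S" by (rule fam_indep_imp_inj_on[OF f assms])
  have "vs.indep_mod {0} (v ` S)"
    unfolding vs.indep_mod_def
  proof (intro conjI allI impI)
    fix u assume "(\<Sum>t\<in>v ` S. const (u t) * t) \<in> {0}"
    then have "(\<Sum>j\<in>S. const (u (v j)) * v j) = 0" by (simp add: sum.reindex[OF inj])
    then have "u (v j) = 0" if "j \<in> S" for j using fam_indepD[OF f, of "\<lambda>j. u (v j)"] that by blast
    then show "\<forall>t\<in>v ` S. u t = 0" by blast
  qed (use assms in simp)
  then show "inj_on v S \<and> vs.indep_mod {0} (v ` S)" using inj by blast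
next
  assume "inj_on v S \<and> vs.indep_mod {0} (v ` S)"
  then have inj: "inj_on v S" and ind: "vs.indep_mod {0} (v ` S)" by blast+
  show "fam_indep v S"
    unfolding fam_indep_def
  proof (intro allI impI)
    fix u assume 0: "(\<Sum>j\<in>S. const (u j) * v j) = 0"
    let ?u = "\<lambda>t. u (inv_into S v t)"
    have "(\<Sum>t\<in>v ` S. const (?u t) * t) = (\<Sum>j\<in>S. const (u j) * v j)"
      unfolding sum.reindex[OF inj] by (rule sum.cong) (simp_all add: inj)
    then have "(\<Sum>t\<in>v ` S. const (?u t) * t) \<in> {0}" using 0 by simp
    from vs.indep_modD[OF ind this] show "\<forall>j\<in>S. u j = 0" by (simp add: inj)
  qed
qed

text \<open>A complement \<open>S\<close> found at \<open>g\<^sub>0\<close> is kept fixed. Together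
  with a basis of the part of \<open>J\<close> and the monomial multiples of the forms it spans
  degree \<open>d\<close> at \<open>g\<^sub>0\<close>. A basis selected from these vectors stays
  independent on an open set and, by its number, still spans, so that \<open>S\<close> continues to
  span modulo the varying ideal.\<close>

lemma hilb_semicontinuous:
  fixes J :: "('x::finite, 'k::field) mpoly set" and l :: "'x \<Rightarrow> 'k ^ 'x ^ 'x \<Rightarrow> ('x, 'k) mpoly"
  assumes J: "idl.subspace J" "graded J" and l: "\<And>i g. l i g \<in> homog 1" "\<And>i. polyvec (l i)"
    and le: "hilb (idl.span (J \<union> (\<lambda>i. l i g\<^sub>0) ` B)) d \<le> c"
  shows "\<exists>\<phi>. polyfun \<phi> \<and> \<phi> g\<^sub>0 \<noteq> 0 \<and> (\<forall>g. \<phi> g \<noteq> 0 \<longrightarrow> hilb (idl.span (J \<union> (\<lambda>i. l i g) ` B)) d \<le> c)"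
proof -
  define V where "V g = idl.span (J \<union> (\<lambda>i. l i g) ` B)" for g
  have V: "vs.subspace (V g)" for g unfolding V_def by (rule ideal_subspace) simp
  let ?W = "homog d :: ('x, 'k) mpoly set"
  have W: "vs.subspace ?W" by (rule subspace_polys_on)
  have z: "vs.subspace ({0} :: ('x, 'k) mpoly set)" by simp
  have sp0: "vs.span ({0} \<union> A) = vs.span A" for A :: "('x, 'k) mpoly set"
    by simp
  obtain S where S: "S \<subseteq> ?W" "vs.indep_mod (V g\<^sub>0) S" "card S = vs.codim ?W (V g\<^sub>0)" "?W \<subseteq> vs.span (V g\<^sub>0 \<union> S)"
    by (rule vs.codim_basis[OF V hilb_fin])
  have finS: "finite S" and cS: "card S \<le> c"
    using S le by (simp_all add: vs.indep_mod_def hilb_def V_def)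
  have JW: "vs.subspace (J \<inter> ?W)" by (rule vs.subspace_inter[OF ideal_subspace[OF J(1)] W])
  have b1: "card T \<le> card (monomial ` {\<nu> :: 'x \<Rightarrow>\<^sub>0 nat. exp_degree \<nu> = d} :: ('x, 'k) mpoly set)"
    if "T \<subseteq> J \<inter> ?W" "vs.indep_mod {0} T" for T
  proof (rule vs.card_indep_mod_le[OF z that(2)])
    show "T \<subseteq> vs.span ({0} \<union> monomial ` {\<nu>. exp_degree \<nu> = d})"
      using that(1) polys_on_subset_span[of "{\<nu>. exp_degree \<nu> = d}" "{0}"] by blast
  qed (simp add: finite_exp_degree_eq)
  obtain G where G: "G \<subseteq> J \<inter> ?W" "vs.indep_mod {0} G" "J \<inter> ?W \<subseteq> vs.span ({0} \<union> G)"
    by (rule vs.maximal_indep_mod[OF z b1])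
  have finG: "finite G" using G(2) by (simp add: vs.indep_mod_def)
  \<comment> \<open>\<open>Inl\<close> marks the constant vectors from \<open>G\<close> and
    \<open>S\<close>, \<open>Inr\<close> the multiples of the forms, which vary with
    \<open>g\<close>.\<close>
  define y :: "('x, 'k) mpoly + ('x \<times> ('x \<Rightarrow>\<^sub>0 nat)) \<Rightarrow> 'k ^ 'x ^ 'x \<Rightarrow> ('x, 'k) mpoly"
    where "y t g = (case t of Inl p \<Rightarrow> p | Inr (i, \<mu>) \<Rightarrow> monomial \<mu> * l i g)" for t g
  define D :: "('x \<Rightarrow>\<^sub>0 nat) set" where "D = {\<mu>. exp_degree \<mu> + 1 = d}"
  have finD: "finite D" by (rule finite_subset[OF _ finite_exp_degree_le[of d]]) (auto simp: D_def)
  define T where "T = Inl ` (G \<union> S) \<union> Inr ` (B \<times> D)"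
  have finT: "finite T" unfolding T_def using finG finS finD by simp
  have yT: "y t g \<in> ?W" if "t \<in> T" for t g
    using that
  proof (cases t)
    case (Inr p)
    then obtain i \<mu> where p: "p = (i, \<mu>)" "\<mu> \<in> D" using \<open>t \<in> T\<close> unfolding T_def by auto
    have "monomial \<mu> * l i g \<in> homog (exp_degree \<mu> + 1)"
      by (rule homog_mult[OF _ l(1)]) simp
    then show ?thesis using Inr p by (simp add: y_def D_def)
  qed (use G(1) S(1) in \<open>auto simp: T_def y_def\<close>)
  have pvT: "polyvec (y t)" for t
  proof (cases t)
    case (Inl p)
    then show ?thesis by (simp add: y_def polyvec_def polyfun_const)
  next
    case (Inr p)
    obtain i \<mu> where p: "p = (i, \<mu>)" by (cases p)
    \<comment> \<open>Multiplication by a monomial shifts exponents, so a coefficient of the product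
      is a coefficient of \<open>l i g\<close> or 0.\<close>
    have "polyfun (\<lambda>g. lookup (monomial \<mu> * l i g) \<nu>)" for \<nu>
    proof (cases "\<exists>\<kappa>. \<nu> = \<mu> + \<kappa>")
      case True
      then obtain \<kappa> where k: "\<nu> = \<mu> + \<kappa>" by blast
      have "lookup (monomial \<mu> * q) (\<mu> + \<kappa>) = lookup q \<kappa>" for q :: "('x, 'k) mpoly"
        by (induction q rule: mpoly_induct)
          (simp_all add: distrib_left lookup_add mult.left_commute[of "monomial \<mu>"] lookup_const_mult
            lookup_monomial flip: monomial_add)
      then show ?thesis using l(2)[of i] unfolding k polyvec_def by simp
    next
      case False
      have "lookup (monomial \<mu> * q) \<nu> = 0" for q :: "('x, 'k) mpoly"
        using False
        by (induction q rule: mpoly_induct)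
          (auto simp add: distrib_left lookup_add mult.left_commute[of "monomial \<mu>"] lookup_const_mult
            lookup_monomial simp flip: monomial_add)
      then show ?thesis by (simp add: polyfun_const)
    qed
    then show ?thesis by (simp add: Inr p y_def polyvec_def)
  qed
  have span0: "?W \<subseteq> vs.span ((\<lambda>t. y t g\<^sub>0) ` T)"
  proof
    fix x assume x: "x \<in> ?W"
    let ?Y = "(\<lambda>t. y t g\<^sub>0) ` T"
    have GY: "G \<subseteq> ?Y" and SY: "S \<subseteq> ?Y"
      by (force simp: T_def y_def image_iff)+
    obtain v s where vs: "v \<in> V g\<^sub>0" "s \<in> vs.span S" "x = v + s"
      using S(4) x unfolding vs.span_Un_subspace[OF V] subset_iff by blast
    have "s \<in> ?W" using vs(2) vs.span_minimal[OF S(1) W] by blast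
    then have "x - s \<in> ?W" using x vs.subspace_diff[OF W] by blast
    then have "v \<in> ?W" using vs(3) by simp
    then have "v \<in> vs.span ((J \<inter> ?W) \<union> {monomial \<mu> * f | \<mu> f. f \<in> (\<lambda>i. l i g\<^sub>0) ` B \<and> exp_degree \<mu> + 1 = d})"
      using vs(1) l(1) unfolding V_def by (intro homog_part_span[OF J]) auto
    also have "\<dots> \<subseteq> vs.span ?Y"
    proof (rule vs.span_minimal)
      have "J \<inter> ?W \<subseteq> vs.span ?Y" using G(3) vs.span_mono[OF GY] unfolding sp0 by blast
      moreover have "monomial \<mu> * l i g\<^sub>0 \<in> ?Y" if "i \<in> B" "exp_degree \<mu> + 1 = d" for \<mu> i
      proof (rule image_eqI[of _ _ "Inr (i, \<mu>)"])
        show "Inr (i, \<mu>) \<in> T" using that by (simp add: T_def D_def image_iff)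
      qed (simp add: y_def)
      then have "{monomial \<mu> * f | \<mu> f. f \<in> (\<lambda>i. l i g\<^sub>0) ` B \<and> exp_degree \<mu> + 1 = d} \<subseteq> ?Y"
        by blast
      then have "{monomial \<mu> * f | \<mu> f. f \<in> (\<lambda>i. l i g\<^sub>0) ` B \<and> exp_degree \<mu> + 1 = d} \<subseteq> vs.span ?Y"
        using vs.span_superset by (rule subset_trans)
      ultimately show "(J \<inter> ?W) \<union> {monomial \<mu> * f | \<mu> f. f \<in> (\<lambda>i. l i g\<^sub>0) ` B \<and> exp_degree \<mu> + 1 = d} \<subseteq> vs.span ?Y"
        by (rule Un_least)
    qed simp
    finally have "v \<in> vs.span ?Y" .
    moreover have "s \<in> vs.span ?Y" using vs(2) vs.span_mono[OF SY] by blast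
    ultimately show "x \<in> vs.span ?Y" unfolding vs(3) by (rule vs.span_add)
  qed
  have b2: "card A \<le> card ((\<lambda>t. y t g\<^sub>0) ` T)" if "A \<subseteq> (\<lambda>t. y t g\<^sub>0) ` T" for A
    using that finT by (intro card_mono) auto
  obtain A where A: "A \<subseteq> (\<lambda>t. y t g\<^sub>0) ` T" "vs.indep_mod {0} A" "(\<lambda>t. y t g\<^sub>0) ` T \<subseteq> vs.span ({0} \<union> A)"
    by (rule vs.maximal_indep_mod[OF z b2])
  have WA: "?W \<subseteq> vs.span ({0} \<union> A)"
    by (rule subset_trans[OF span0 vs.span_minimal[OF A(3) vs.subspace_span]])
  have cardA: "vs.codim ?W {0} \<le> card A"
    using A(2) WA by (intro vs.codim_le_card[OF z]) (simp_all add: vs.indep_mod_def)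
  obtain T' where T': "T' \<subseteq> T" "inj_on (\<lambda>t. y t g\<^sub>0) T'" "A = (\<lambda>t. y t g\<^sub>0) ` T'"
    using A(1) unfolding subset_image_inj by blast
  have finT': "finite T'" using T'(1) finT finite_subset by blast
  have "fam_indep (\<lambda>t. y t g\<^sub>0) T'"
    unfolding fam_indep_iff_indep_mod[OF finT'] using T'(2) A(2) unfolding T'(3) by blast
  then obtain \<phi> where phi: "polyfun \<phi>" "\<phi> g\<^sub>0 \<noteq> 0" "\<And>g. \<phi> g \<noteq> 0 \<Longrightarrow> fam_indep (\<lambda>t. y t g) T'"
    using fam_indep_open[of T' y g\<^sub>0] finT' pvT by blast
  have "hilb (V g) d \<le> c" if g: "\<phi> g \<noteq> 0" for g
  proof -
    let ?A = "(\<lambda>t. y t g) ` T'"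
    have A': "inj_on (\<lambda>t. y t g) T'" "vs.indep_mod {0} ?A"
      using phi(3)[OF g] unfolding fam_indep_iff_indep_mod[OF finT'] by blast+
    have cA: "card ?A = card A" unfolding T'(3) card_image[OF T'(2)] card_image[OF A'(1)] ..
    have AW: "?A \<subseteq> ?W" using yT T'(1) by blast
    \<comment> \<open>An independent family with as many members as the dimension of the space spans
      it.\<close>
    have "?W \<subseteq> vs.span ({0} \<union> ?A)"
    proof (rule subsetI, rule ccontr)
      fix x assume x: "x \<in> ?W" "x \<notin> vs.span ({0} \<union> ?A)"
      have "vs.indep_mod {0} (insert x ?A)" by (rule vs.indep_mod_insert[OF z A'(2) x(2)])
      then have "card (insert x ?A) \<le> vs.codim ?W {0}"
        using x(1) AW by (intro vs.card_le_codim[OF z hilb_fin]) auto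
      moreover have "x \<notin> ?A" using x(2) vs.span_base[of x "{0} \<union> ?A"] by blast
      then have "card (insert x ?A) = Suc (card ?A)" using finT' by simp
      ultimately show False using cA cardA by simp
    qed
    also have "\<dots> \<subseteq> vs.span (V g \<union> S)"
    proof (rule vs.span_mono, rule Un_least)
      show "{0} \<subseteq> V g \<union> S" using vs.subspace_0[OF V] by blast
      show "?A \<subseteq> V g \<union> S"
      proof clarify
        fix t assume t: "t \<in> T'" "y t g \<notin> S"
        have JV: "J \<subseteq> V g" unfolding V_def by (auto intro: idl.span_base)
        show "y t g \<in> V g"
        proof (cases t)
          case (Inl p)
          then have "p \<in> G \<union> S" using t(1) T'(1) unfolding T_def by auto
          then have "p \<in> G" using t(2) Inl by (simp add: y_def)
          then show ?thesis using G(1) JV Inl by (auto simp: y_def)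
        next
          case (Inr p)
          then obtain i \<mu> where p: "p = (i, \<mu>)" "i \<in> B" using t(1) T'(1) unfolding T_def by auto
          have "monomial \<mu> * l i g \<in> V g"
            unfolding V_def using p(2) by (intro idl.span_scale idl.span_base) blast
          then show ?thesis using Inr p by (simp add: y_def)
        qed
      qed
    qed
    finally have "vs.codim ?W (V g) \<le> card S" by (rule vs.codim_le_card[OF V finS])
    then show ?thesis using cS by (simp add: hilb_def)
  qed
  then show ?thesis using phi(1,2) unfolding V_def by blast
qed

subsection \<open>The action of the general linear group\<close>

text \<open>The image of variable \<open>i\<close> under \<open>g\<close>; its coefficients form
  column \<open>i\<close> of the matrix.\<close>

definition lin_form :: "'x::finite \<Rightarrow> 'k::field ^ 'x ^ 'x \<Rightarrow> ('x, 'k) mpoly"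
  where "lin_form i g = (\<Sum>j\<in>UNIV. const (g $ j $ i) * var j)"

lemma gl_action_eq: "gl_action (g :: 'k::field ^ 'x::finite ^ 'x) = mpoly_eval const (\<lambda>i. lin_form i g)"
  by (simp add: gl_action_def lin_form_def)

lemma gl_action_var: "gl_action (g :: 'k::field ^ 'x::finite ^ 'x) (var i) = lin_form i g"
  unfolding gl_action_eq by (rule subst.mpoly_eval_var)

lemma lin_form_homog: "lin_form i g \<in> homog 1"
  unfolding lin_form_def
  by (intro vs.subspace_sum[OF subspace_polys_on] vs.subspace_scale[OF subspace_polys_on] var_in_homog)

lemma lookup_lin_form:
  "lookup (lin_form i g) \<nu> = (\<Sum>j\<in>UNIV. g $ j $ i * lookup (var j) \<nu>)"
  by (simp only: lin_form_def lookup_sum lookup_const_mult)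

lemma polyvec_lin_form: "polyvec (lin_form i)"
  unfolding polyvec_def lookup_lin_form
  by (intro allI polyfun_sum polyfun_mult polyfun_entry polyfun_const)

lemma linear_form_is_lin_form:
  fixes l :: "'x::finite \<Rightarrow> ('x, 'k::field) mpoly"
  assumes "\<And>i. l i \<in> homog 1"
  shows "\<exists>g. \<forall>i. lin_form i g = l i"
proof (intro exI allI)
  fix i
  show "lin_form i (\<chi> j i. lookup (l i) (single j 1)) = l i"
  proof (rule poly_mapping_eqI)
    fix \<nu>
    show "lookup (lin_form i (\<chi> j i. lookup (l i) (single j 1))) \<nu> = lookup (l i) \<nu>"
    proof (cases "exp_degree \<nu> = Suc 0")
      case True
      then obtain \<mu> k where k: "\<nu> = \<mu> + single k 1" "exp_degree \<mu> = 0" by (rule exp_degree_SucE)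
      then have nu: "\<nu> = single k 1" by (simp add: exp_degree_eq_0_iff)
      have inj: "single k (1::nat) = single j 1 \<longleftrightarrow> k = j" for j
        by (metis lookup_single_eq lookup_single_not_eq zero_neq_one)
      have "(\<Sum>j\<in>UNIV. lookup (l i) (single j 1) * lookup (var j :: ('x, 'k) mpoly) \<nu>)
          = (\<Sum>j\<in>UNIV. if k = j then lookup (l i) (single j 1) else 0)"
        by (rule sum.cong) (simp_all only: nu var_eq_monomial lookup_monomial inj split: if_split, auto)
      then show ?thesis by (simp add: lookup_lin_form nu)
    next
      case False
      then have "\<nu> \<notin> keys (l i)" "\<nu> \<notin> keys (lin_form i (\<chi> j i. lookup (l i) (single j 1)))"
        using assms[of i] lin_form_homog[of i "\<chi> j i. lookup (l i) (single j 1)"]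
        by (auto simp: polys_on_def)
      then show ?thesis by (simp add: in_keys_iff)
    qed
  qed
qed

lemma gl_action_add: "gl_action (g :: 'k::field ^ 'x::finite ^ 'x) (a + b) = gl_action g a + gl_action g b"
  unfolding gl_action_eq by (rule subst.mpoly_eval_add)

lemma gl_action_mult: "gl_action (g :: 'k::field ^ 'x::finite ^ 'x) (a * b) = gl_action g a * gl_action g b"
  unfolding gl_action_eq by (rule subst.mpoly_eval_mult)

lemma gl_action_const: "gl_action (g :: 'k::field ^ 'x::finite ^ 'x) (const c) = const c"
  unfolding gl_action_eq by (rule subst.mpoly_eval_const)

lemma gl_action_0: "gl_action (g :: 'k::field ^ 'x::finite ^ 'x) 0 = 0"
  unfolding gl_action_eq by (rule subst.mpoly_eval_0)

lemma gl_action_1: "gl_action (g :: 'k::field ^ 'x::finite ^ 'x) 1 = 1"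
  unfolding gl_action_eq by (rule subst.mpoly_eval_1)

text \<open>Since images of variables are columns, substitutions compose in the order of the matrix
  product and the action is a left action.\<close>

lemma gl_action_gl_action:
  fixes f :: "('x::finite, 'k::field) mpoly"
  shows "gl_action g (gl_action h f) = gl_action (g ** h) f"
proof -
  have "mpoly_eval const (\<lambda>i. lin_form i g) (lin_form i h) = lin_form i (g ** h)" for i
  proof -
    have cs: "const (\<Sum>j\<in>S. f j) = (\<Sum>j\<in>S. const (f j) :: ('x, 'k) mpoly)" for S :: "'x set" and f
      by (induction S rule: infinite_finite_induct) (simp_all add: const_add)
    have "mpoly_eval const (\<lambda>i. lin_form i g) (lin_form i h) = (\<Sum>j\<in>UNIV. const (h $ j $ i) * lin_form j g)"
      unfolding lin_form_def[of i h]
      by (simp only: subst.mpoly_eval_sum subst.mpoly_eval_mult subst.mpoly_eval_const subst.mpoly_eval_var)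
    also have "\<dots> = (\<Sum>j\<in>UNIV. \<Sum>k\<in>UNIV. const (g $ k $ j * h $ j $ i) * var k)"
      unfolding lin_form_def sum_distrib_left by (simp only: const_mult mult_ac)
    also have "\<dots> = (\<Sum>k\<in>UNIV. \<Sum>j\<in>UNIV. const (g $ k $ j * h $ j $ i) * var k)"
      by (rule sum.swap)
    also have "\<dots> = lin_form i (g ** h)"
      unfolding lin_form_def matrix_matrix_mult_def by (simp add: cs sum_distrib_right)
    finally show ?thesis .
  qed
  then show ?thesis unfolding gl_action_eq subst_subst by simp
qed

lemma gl_action_mat_1: "gl_action (mat 1) f = (f :: ('x::finite, 'k::field) mpoly)"
proof -
  have "lin_form i (mat 1) = (var i :: ('x, 'k) mpoly)" for i
  proof -
    have "lin_form i (mat 1) = (\<Sum>j\<in>UNIV. if j = i then var j else 0 :: ('x, 'k) mpoly)"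
      unfolding lin_form_def by (rule sum.cong) (auto simp: mat_def)
    then show ?thesis by simp
  qed
  then show ?thesis unfolding gl_action_eq by (simp add: subst_var_id)
qed

lemma gl_action_inverse:
  fixes f :: "('x::finite, 'k::field) mpoly"
  assumes "invertible g"
  shows "gl_action (matrix_inv g) (gl_action g f) = f" "gl_action g (gl_action (matrix_inv g) f) = f"
  unfolding gl_action_gl_action
  by (simp_all add: matrix_inv_left[OF assms] matrix_inv_right[OF assms] gl_action_mat_1)

lemma invertible_matrix_inv: "invertible (g :: 'k::field ^ 'x::finite ^ 'x) \<Longrightarrow> invertible (matrix_inv g)"
  using matrix_inv_left matrix_inv_right unfolding invertible_def by metis

lemma matrix_inv_matrix_inv:
  fixes g :: "'k::field ^ 'x::finite ^ 'x"
  assumes g: "invertible g"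
  shows "matrix_inv (matrix_inv g) = g"
proof -
  have "matrix_inv (matrix_inv g) = matrix_inv (matrix_inv g) ** (matrix_inv g ** g)"
    by (simp add: matrix_inv_left[OF g])
  also have "\<dots> = (matrix_inv (matrix_inv g) ** matrix_inv g) ** g" by (rule matrix_mul_assoc)
  also have "\<dots> = g" by (simp add: matrix_inv_left[OF invertible_matrix_inv[OF g]])
  finally show ?thesis .
qed

lemma gl_action_homog: "f \<in> homog d \<Longrightarrow> gl_action (g :: 'k::field ^ 'x::finite ^ 'x) f \<in> homog d"
  unfolding gl_action_eq by (rule subst_homog[OF lin_form_homog])

lemma subspace_gl_action:
  fixes J :: "('x::finite, 'k::field) mpoly set"
  assumes g: "invertible g" and J: "idl.subspace J"
  shows "idl.subspace (gl_action g ` J)"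
proof (rule idl.subspaceI)
  show "0 \<in> gl_action g ` J"
    using idl.subspace_0[OF J] gl_action_0[of g] by force
  show "x + y \<in> gl_action g ` J" if "x \<in> gl_action g ` J" "y \<in> gl_action g ` J" for x y
    using that idl.subspace_add[OF J] by (force simp flip: gl_action_add)
  show "c * x \<in> gl_action g ` J" if x: "x \<in> gl_action g ` J" for c x
  proof -
    obtain y where y: "x = gl_action g y" "y \<in> J" using x by blast
    have "c * x = gl_action g (gl_action (matrix_inv g) c * y)"
      unfolding gl_action_mult gl_action_inverse(2)[OF g] y(1) ..
    then show ?thesis using idl.subspace_scale[OF J y(2)] by blast
  qed
qed

lemma graded_gl_action:
  fixes J :: "('x::finite, 'k::field) mpoly set"
  assumes "graded J"
  shows "graded (gl_action g ` J)"
  unfolding graded_def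
proof (intro ballI allI)
  fix f d assume "f \<in> gl_action g ` J"
  then obtain f' where f': "f' \<in> J" "f = gl_action g f'" by blast
  have "homog_part d f = gl_action g (homog_part d f')"
    unfolding f'(2) gl_action_eq by (rule subst_homog_component[OF lin_form_homog])
  then show "homog_part d f \<in> gl_action g ` J"
    using assms f'(1) unfolding graded_def by blast
qed

lemma gl_action_span:
  fixes F :: "('x::finite, 'k::field) mpoly set"
  assumes g: "invertible g"
  shows "gl_action g ` idl.span F = idl.span (gl_action g ` F)"
proof -
  have sub: "idl.span (gl_action h ` A) \<subseteq> gl_action h ` idl.span A" if "invertible h" for h and A :: "('x, 'k) mpoly set"
    by (rule idl.span_minimal[OF _ subspace_gl_action[OF that]]) (auto intro: idl.span_base)
  have "gl_action (matrix_inv g) ` gl_action g ` F = F"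
    unfolding image_image by (simp add: gl_action_inverse[OF g])
  then have "idl.span F \<subseteq> gl_action (matrix_inv g) ` idl.span (gl_action g ` F)"
    using sub[OF invertible_matrix_inv[OF g], of "gl_action g ` F"] by simp
  then have "gl_action g ` idl.span F \<subseteq> gl_action g ` gl_action (matrix_inv g) ` idl.span (gl_action g ` F)"
    by (rule image_mono)
  also have "\<dots> = idl.span (gl_action g ` F)"
    unfolding image_image by (simp add: gl_action_inverse[OF g])
  finally show ?thesis using sub[OF g, of F] by blast
qed

text \<open>The images of vectors that span modulo \<open>J\<close> span modulo the image of
  \<open>J\<close>. The reverse inequality is the same statement for the inverse matrix. With
  \<open>E\<close> left open, both Hilbert functions are covered.\<close>

lemma codim_gl_action_le:
  fixes J :: "('x::finite, 'k::field) mpoly set"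
  assumes g: "invertible g" and J: "idl.subspace J"
    and E: "finite E" "\<And>(h :: 'k ^ 'x ^ 'x) f. f \<in> polys_on E \<Longrightarrow> gl_action h f \<in> polys_on E"
  shows "vs.codim (polys_on E) (gl_action g ` J) \<le> vs.codim (polys_on E) J"
proof -
  have fin: "finite (monomial ` E :: ('x, 'k) mpoly set)" using E(1) by simp
  obtain T where T: "T \<subseteq> polys_on E" "vs.indep_mod J T" "card T = vs.codim (polys_on E) J" "polys_on E \<subseteq> vs.span (J \<union> T)"
    by (rule vs.codim_basis[OF ideal_subspace[OF J] fin polys_on_subset_span])
  have finT: "finite T" using T(2) by (simp add: vs.indep_mod_def)
  have "polys_on E \<subseteq> vs.span (gl_action g ` J \<union> gl_action g ` T)"
  proof
    fix x :: "('x, 'k) mpoly" assume "x \<in> polys_on E"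
    then have "gl_action (matrix_inv g) x \<in> vs.span (J \<union> T)" using E(2) T(4) by blast
    then have "gl_action g (gl_action (matrix_inv g) x) \<in> vs.span (gl_action g ` (J \<union> T))"
    proof (induction rule: vs.span_induct_alt)
      case base
      then show ?case by (simp add: gl_action_0 vs.span_zero)
    next
      case (step c a b)
      show ?case
        unfolding gl_action_add gl_action_mult gl_action_const
        by (rule vs.span_add[OF vs.span_scale[OF vs.span_base[OF imageI[OF step(1)]]] step(2)])
    qed
    then show "x \<in> vs.span (gl_action g ` J \<union> gl_action g ` T)"
      unfolding gl_action_inverse(2)[OF g] image_Un .
  qed
  then have "vs.codim (polys_on E) (gl_action g ` J) \<le> card (gl_action g ` T)"
    using finT by (intro vs.codim_le_card[OF ideal_subspace[OF subspace_gl_action[OF g J]]]) auto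
  also have "\<dots> \<le> vs.codim (polys_on E) J" using card_image_le[OF finT] T(3) by metis
  finally show ?thesis .
qed

lemma gl_action_deg_le: "f \<in> deg_le d \<Longrightarrow> gl_action (g :: 'k::field ^ 'x::finite ^ 'x) f \<in> deg_le d"
proof -
  assume f: "f \<in> deg_le d"
  have "gl_action g f = gl_action g (\<Sum>e\<in>exp_degree ` keys f. homog_part e f)"
    using sum_homog_components[of f] by simp
  also have "\<dots> = (\<Sum>e\<in>exp_degree ` keys f. gl_action g (homog_part e f))"
    unfolding gl_action_eq by (rule subst.mpoly_eval_sum)
  also have "\<dots> \<in> deg_le d"
  proof (rule vs.subspace_sum[OF subspace_polys_on])
    fix e assume "e \<in> exp_degree ` keys f"
    then have "e \<le> d" using f by (auto simp: polys_on_def)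
    then show "gl_action g (homog_part e f) \<in> deg_le d"
      by (intro subsetD[OF polys_on_mono gl_action_homog[OF terms_satisfying_in_polys_on]]) auto
  qed
  finally show ?thesis .
qed

lemma gl_action_inverse_image:
  fixes J :: "('x::finite, 'k::field) mpoly set"
  assumes "invertible g"
  shows "gl_action (matrix_inv g) ` gl_action g ` J = J"
  unfolding image_image by (simp add: gl_action_inverse[OF assms])

lemma hilb_gl_action:
  fixes J :: "('x::finite, 'k::field) mpoly set"
  assumes g: "invertible g" and J: "idl.subspace J"
  shows "hilb (gl_action g ` J) d = hilb J d"
proof (rule antisym)
  show "hilb (gl_action g ` J) d \<le> hilb J d"
    unfolding hilb_def by (rule codim_gl_action_le[OF g J finite_exp_degree_eq gl_action_homog])
  show "hilb J d \<le> hilb (gl_action g ` J) d"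
    using codim_gl_action_le[OF invertible_matrix_inv[OF g] subspace_gl_action[OF g J] finite_exp_degree_eq gl_action_homog, of d]
    unfolding hilb_def gl_action_inverse_image[OF g] .
qed

lemma ahilb_gl_action:
  fixes J :: "('x::finite, 'k::field) mpoly set"
  assumes g: "invertible g" and J: "idl.subspace J"
  shows "ahilb (gl_action g ` J) d = ahilb J d"
proof (rule antisym)
  show "ahilb (gl_action g ` J) d \<le> ahilb J d"
    unfolding ahilb_def by (rule codim_gl_action_le[OF g J finite_exp_degree_le gl_action_deg_le])
  show "ahilb J d \<le> ahilb (gl_action g ` J) d"
    using codim_gl_action_le[OF invertible_matrix_inv[OF g] subspace_gl_action[OF g J] finite_exp_degree_le gl_action_deg_le, of d]
    unfolding ahilb_def gl_action_inverse_image[OF g] .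
qed

subsection \<open>Genericity of good coordinates\<close>

lemma hilb_eq_0_iff:
  fixes J :: "('x::finite, 'k::field) mpoly set"
  assumes J: "idl.subspace J"
  shows "hilb J d = 0 \<longleftrightarrow> homog d \<subseteq> J"
proof
  assume 0: "hilb J d = 0"
  obtain T where T: "T \<subseteq> homog d" "vs.indep_mod J T" "card T = vs.codim (homog d) J" "homog d \<subseteq> vs.span (J \<union> T)"
    by (rule vs.codim_basis[OF ideal_subspace[OF J] hilb_fin])
  have "T = {}" using 0 T(2,3) by (simp add: hilb_def vs.indep_mod_def)
  moreover have e: "vs.span J = J" using ideal_subspace[OF J] by simp
  ultimately show "homog d \<subseteq> J" using T(4) unfolding \<open>T = {}\<close> Un_empty_right e by blast
next
  assume "homog d \<subseteq> J"
  then have "homog d \<subseteq> vs.span (J \<union> {})" using vs.span_superset by blast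
  then have "hilb J d \<le> card ({} :: ('x, 'k) mpoly set)"
    unfolding hilb_def by (intro vs.codim_le_card[OF ideal_subspace[OF J]]) simp_all
  then show "hilb J d = 0" by simp
qed

text \<open>The second condition is the numerical trace of a regular sequence. The opposite
  inequality holds for all linear forms, by \<open>hilb_le_partial_sums\<close>.\<close>

definition good_coordinates :: "nat \<Rightarrow> ('x::finite, 'k::field) mpoly set \<Rightarrow> bool"
  where "good_coordinates r J \<longleftrightarrow>
    (\<forall>B. card B = Suc r \<longrightarrow> (\<exists>N. homog N \<subseteq> idl.span (J \<union> var ` B))) \<and>
    (\<forall>B. card B = r \<longrightarrow> (\<forall>d. (partial_sums ^^ r) (hilb (idl.span (J \<union> var ` B))) d \<le> hilb J d))"

text \<open>The forms are distributed over a subset of \<open>B\<close>, and the rest of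
  \<open>B\<close> receives the form 0.\<close>

lemma enumerate_forms:
  fixes F :: "('x::finite, 'k::field) mpoly set" and B :: "'x set"
  assumes "finite F" "card F \<le> card B" "F \<subseteq> homog 1"
  obtains l where "\<And>i. l i \<in> homog 1" "F \<subseteq> l ` B"
proof -
  obtain B' where B': "B' \<subseteq> B" "card B' = card F" using obtain_subset_with_card_n[OF assms(2)] by metis
  have "finite B'" by simp
  then obtain h where h: "bij_betw h B' F" using finite_same_card_bij assms(1) B'(2) by metis
  have hF: "h ` B' = F" using h by (simp add: bij_betw_def)
  show ?thesis
  proof (rule that[of "\<lambda>i. if i \<in> B' then h i else 0"])
    show "(if i \<in> B' then h i else 0) \<in> homog 1" for i using hF assms(3) by auto
    show "F \<subseteq> (\<lambda>i. if i \<in> B' then h i else 0) ` B" using B'(1) unfolding hF[symmetric] by auto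
  qed
qed

lemma zariski_open_polyfun:
  assumes "polyfun \<phi>"
  shows "zariski_open_GL {g. invertible g \<and> \<phi> g \<noteq> 0}"
proof -
  obtain f where "\<And>g. \<phi> g = mpoly_eval id (\<lambda>(i, j). g $ i $ j) f"
    using assms unfolding polyfun_def by blast
  then show ?thesis unfolding zariski_open_GL_def by (intro exI[of _ "{f}"]) (simp only: bex_simps simp_thms)
qed

lemma polyfun_eval: "polyfun (\<lambda>g. mpoly_eval id (\<lambda>(i, j). g $ i $ j) f)"
  unfolding polyfun_def by blast

text \<open>With the determinant added to the list of polynomials, a common nonvanishing point is an
  invertible matrix.\<close>

lemma zariski_open_meet:
  fixes U V :: "('k::field_char_0 ^ 'x::finite ^ 'x) set"
  assumes "zariski_open_GL U" "U \<noteq> {}" "zariski_open_GL V" "V \<noteq> {}"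
  shows "U \<inter> V \<noteq> {}"
proof -
  define ev :: "('x \<times> 'x, 'k) mpoly \<Rightarrow> 'k ^ 'x ^ 'x \<Rightarrow> 'k" where "ev f g = mpoly_eval id (\<lambda>(i, j). g $ i $ j) f" for f g
  obtain S where S: "U = {g. invertible g \<and> (\<exists>f\<in>S. ev f g \<noteq> 0)}"
    using assms(1) unfolding zariski_open_GL_def ev_def by blast
  obtain S' where S': "V = {g. invertible g \<and> (\<exists>f\<in>S'. ev f g \<noteq> 0)}"
    using assms(3) unfolding zariski_open_GL_def ev_def by blast
  obtain f g where f: "invertible g" "f \<in> S" "ev f g \<noteq> 0" using assms(2) S by blast
  obtain f' g' where f': "invertible g'" "f' \<in> S'" "ev f' g' \<noteq> 0" using assms(4) S' by blast
  have p: "polyfun (ev f)" for f unfolding ev_def by (rule polyfun_eval)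
  have "\<exists>g. \<forall>\<phi>\<in>{det, ev f, ev f'}. \<phi> g \<noteq> 0"
  proof (rule polyfun_common_nonvanishing)
    show "polyfun \<phi>" if "\<phi> \<in> {det, ev f, ev f'}" for \<phi> using that p polyfun_det_id by auto
    show "\<exists>g. \<phi> g \<noteq> 0" if "\<phi> \<in> {det, ev f, ev f'}" for \<phi>
      using that f f' invertible_det_nz by blast
  qed simp
  then obtain h where "det h \<noteq> 0" "ev f h \<noteq> 0" "ev f' h \<noteq> 0" by auto
  then have "h \<in> U \<inter> V" unfolding S S' using f f' invertible_det_nz by blast
  then show ?thesis by blast
qed

text \<open>Each condition is open by \<open>hilb_semicontinuous\<close>, and nonempty because forms
  satisfying it are at hand: the parameters \<open>F\<close> and the regular sequence
  \<open>ls\<close> can be placed on any set \<open>B\<close> of variables of the right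
  size.\<close>

theorem generic_good_coordinates:
  fixes I :: "('x::finite, 'k::field_char_0) mpoly set"
  assumes I: "idl.subspace I" "graded I" "1 \<notin> I" "params I (Suc r)" and r: "enat r \<le> ideal_depth I"
    and lt: "Suc r \<le> CARD('x)"
  shows "\<exists>U. zariski_open_GL U \<and> U \<noteq> {} \<and> (\<forall>g\<in>U. good_coordinates r (gl_action g ` I))"
proof -
  obtain F N\<^sub>0 where F: "finite F" "card F \<le> Suc r" "F \<subseteq> homog 1" "homog N\<^sub>0 \<subseteq> idl.span (I \<union> F)"
    using I(4) unfolding params_def by blast
  obtain ls d\<^sub>0 where ls: "length ls = r" "set ls \<subseteq> homog 1"
    "\<And>d. (partial_sums ^^ r) (hilb (idl.span (I \<union> set ls))) d \<le> hilb I d"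
    "\<And>d. d\<^sub>0 \<le> d \<Longrightarrow> hilb (idl.span (I \<union> set ls)) d = hilb (idl.span (I \<union> set ls)) d\<^sub>0"
    using regular_linear_section[OF I r] by metis
  \<comment> \<open>The bound to be imposed on sections by \<open>r\<close> variables. From
    \<open>d\<^sub>1\<close> on it is constant while those sections do not increase, so that the
    degrees up to \<open>d\<^sub>1\<close> decide.\<close>
  define h where "h = hilb (idl.span (I \<union> set ls))"
  define d\<^sub>1 where "d\<^sub>1 = max N\<^sub>0 d\<^sub>0"
  define V where "V B g = idl.span (I \<union> (\<lambda>i. lin_form i g) ` B)" for B :: "'x set" and g
  \<comment> \<open>The bound holds at a matrix whose forms for \<open>B\<close> include
    \<open>H\<close>; this matrix need not be invertible.\<close>
  have semi: "\<exists>\<phi>. polyfun \<phi> \<and> (\<exists>g. \<phi> g \<noteq> 0) \<and> (\<forall>g. \<phi> g \<noteq> 0 \<longrightarrow> hilb (V B g) d \<le> c)"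
    if H: "finite H" "card H \<le> card B" "H \<subseteq> homog 1" and le: "hilb (idl.span (I \<union> H)) d \<le> c"
    for H and B :: "'x set" and d c
  proof -
    obtain l where l: "\<And>i. l i \<in> homog 1" "H \<subseteq> l ` B" using enumerate_forms[OF H] by metis
    obtain g where g: "\<And>i. lin_form i g = l i" using linear_form_is_lin_form[of l] l(1) by blast
    have "idl.span (I \<union> H) \<subseteq> V B g" unfolding V_def g using l(2) by (intro idl.span_mono) auto
    then have "hilb (V B g) d \<le> c"
      using hilb_antimono[of "idl.span (I \<union> H)" "V B g" d] le unfolding V_def by simp
    then show ?thesis
      using hilb_semicontinuous[OF I(1,2), of lin_form g B d c] lin_form_homog polyvec_lin_form
      unfolding V_def by blast
  qed
  have "\<exists>\<phi>. polyfun \<phi> \<and> (\<exists>g. \<phi> g \<noteq> 0) \<and> (\<forall>g. \<phi> g \<noteq> 0 \<longrightarrow> hilb (V B g) N\<^sub>0 \<le> 0)"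
    if "card B = Suc r" for B
  proof (rule semi[OF F(1) _ F(3)])
    have "hilb (idl.span (I \<union> F)) N\<^sub>0 = 0"
      unfolding hilb_eq_0_iff[OF idl.subspace_span] by (rule F(4))
    then show "hilb (idl.span (I \<union> F)) N\<^sub>0 \<le> 0" by simp
  qed (use F(2) that in simp)
  then obtain \<alpha> where \<alpha>: "\<And>B. card B = Suc r \<Longrightarrow> polyfun (\<alpha> B)" "\<And>B. card B = Suc r \<Longrightarrow> \<exists>g. \<alpha> B g \<noteq> 0"
    "\<And>B g. card B = Suc r \<Longrightarrow> \<alpha> B g \<noteq> 0 \<Longrightarrow> hilb (V B g) N\<^sub>0 \<le> 0"
    by metis
  have "\<exists>\<phi>. polyfun \<phi> \<and> (\<exists>g. \<phi> g \<noteq> 0) \<and> (\<forall>g. \<phi> g \<noteq> 0 \<longrightarrow> hilb (V B g) d \<le> h d)"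
    if "card B = r" for B d
    by (rule semi[OF _ _ ls(2)]) (use that ls(1) card_length[of ls] in \<open>auto simp: h_def\<close>)
  then obtain \<beta> where \<beta>: "\<And>B d. card B = r \<Longrightarrow> polyfun (\<beta> B d)" "\<And>B d. card B = r \<Longrightarrow> \<exists>g. \<beta> B d g \<noteq> 0"
    "\<And>B d g. card B = r \<Longrightarrow> \<beta> B d g \<noteq> 0 \<Longrightarrow> hilb (V B g) d \<le> h d"
    by metis
  \<comment> \<open>Finite: the determinant, one function for each \<open>B\<close> with
    \<open>r + 1\<close> elements, and one for each \<open>B\<close> with \<open>r\<close> elements
    and each degree up to \<open>d\<^sub>1\<close>.\<close>
  define \<Phi> where "\<Phi> = insert det (\<alpha> ` {B. card B = Suc r} \<union> (\<lambda>(B, d). \<beta> B d) ` ({B. card B = r} \<times> {..d\<^sub>1}))"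
  have fin: "finite \<Phi>" by (simp add: \<Phi>_def)
  have poly: "polyfun \<phi>" if "\<phi> \<in> \<Phi>" for \<phi>
    using that \<alpha>(1) \<beta>(1) polyfun_det_id unfolding \<Phi>_def by auto
  have nz: "\<exists>g. \<phi> g \<noteq> 0" if \<phi>: "\<phi> \<in> \<Phi>" for \<phi>
  proof -
    consider "\<phi> = det" | B where "card B = Suc r" "\<phi> = \<alpha> B" | B d where "card B = r" "\<phi> = \<beta> B d"
      using \<phi> unfolding \<Phi>_def by auto
    then show ?thesis
    proof cases
      case 1
      then show ?thesis by (intro exI[of _ "mat 1"]) simp
    qed (use \<alpha>(2) \<beta>(2) in blast)+
  qed
  obtain g\<^sub>1 where g1: "\<forall>\<phi>\<in>\<Phi>. \<phi> g\<^sub>1 \<noteq> 0"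
    using polyfun_common_nonvanishing[OF fin, of "\<lambda>\<phi>. \<phi>"] poly nz by blast
  then have inv1: "invertible g\<^sub>1" using invertible_det_nz unfolding \<Phi>_def by blast
  define P where "P g = (\<Prod>\<phi>\<in>\<Phi>. \<phi> g)" for g
  have polyP: "polyfun P" unfolding P_def by (rule polyfun_prod) (rule poly)
  have Pnz: "P g \<noteq> 0 \<longleftrightarrow> (\<forall>\<phi>\<in>\<Phi>. \<phi> g \<noteq> 0)" for g
    unfolding P_def using fin by (simp add: prod_zero_iff)
  obtain \<psi> where psi: "polyfun \<psi>" "\<And>g. invertible g \<Longrightarrow> \<psi> g = 0 \<longleftrightarrow> P (matrix_inv g) = 0"
    using polyfun_inverse[OF polyP] by blast
  define U where "U = {g. invertible g \<and> \<psi> g \<noteq> 0}"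
  have "matrix_inv g\<^sub>1 \<in> U"
    unfolding U_def using psi(2)[OF invertible_matrix_inv[OF inv1]] invertible_matrix_inv[OF inv1] Pnz g1
    by (simp add: matrix_inv_matrix_inv[OF inv1])
  then have "U \<noteq> {}" by blast
  moreover have "zariski_open_GL U" unfolding U_def by (rule zariski_open_polyfun[OF psi(1)])
  moreover have "good_coordinates r (gl_action g ` I)" if gU: "g \<in> U" for g
  proof -
    have g: "invertible g" and "P (matrix_inv g) \<noteq> 0" using gU psi(2) unfolding U_def by auto
    then have nzg: "\<forall>\<phi>\<in>\<Phi>. \<phi> (matrix_inv g) \<noteq> 0" using Pnz by blast
    have tr: "gl_action g ` V B (matrix_inv g) = idl.span (gl_action g ` I \<union> var ` B)" for B
    proof -
      have "gl_action g (lin_form i (matrix_inv g)) = var i" for i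
        using gl_action_inverse(2)[OF g, of "var i"] unfolding gl_action_var .
      then show ?thesis unfolding V_def gl_action_span[OF g] image_Un image_image by simp
    qed
    have Vs: "idl.subspace (V B (matrix_inv g))" for B by (simp add: V_def)
    have hg: "hilb (idl.span (gl_action g ` I \<union> var ` B)) d = hilb (V B (matrix_inv g)) d" for B d
      unfolding tr[symmetric] by (rule hilb_gl_action[OF g Vs])
    have A: "homog N\<^sub>0 \<subseteq> idl.span (gl_action g ` I \<union> var ` B)" if B: "card B = Suc r" for B
    proof -
      have "\<alpha> B \<in> \<Phi>" using B by (simp add: \<Phi>_def)
      then have "hilb (V B (matrix_inv g)) N\<^sub>0 \<le> 0" using \<alpha>(3)[OF B] nzg by blast
      then show ?thesis unfolding hg[symmetric] using hilb_eq_0_iff[OF idl.subspace_span] by blast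
    qed
    have le: "hilb (idl.span (gl_action g ` I \<union> var ` B)) d \<le> h d" if B: "card B = r" for B d
    proof -
      let ?K = "idl.span (gl_action g ` I \<union> var ` B)"
      have small: "hilb ?K d \<le> h d" if "d \<le> d\<^sub>1" for d
      proof -
        have "\<beta> B d \<in> \<Phi>" using B that by (auto simp: \<Phi>_def)
        then show ?thesis unfolding hg using \<beta>(3)[OF B] nzg by blast
      qed
      \<comment> \<open>By \<open>lt\<close> there is a variable outside \<open>B\<close>. With it
        \<open>r + 1\<close> variables are parameters, which makes the Hilbert function
        nonincreasing from \<open>N\<^sub>0\<close> on.\<close>
      have "B \<noteq> UNIV" using B lt by auto
      then obtain b where b: "b \<notin> B" by blast
      have cb: "card (insert b B) = Suc r" using b B by simp
      have "homog N\<^sub>0 \<subseteq> idl.span (gl_action g ` I \<union> (var ` B \<union> {var b}))"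
        using A[OF cb] by simp
      then have N: "homog N\<^sub>0 \<subseteq> idl.span (?K \<union> {var b})" unfolding idl_span_Un_span .
      have "var ` B \<subseteq> (homog 1 :: ('x, 'k) mpoly set)" using var_in_homog by blast
      then have gr: "graded ?K" by (rule graded_add_form[OF graded_gl_action[OF I(2)]])
      have step: "hilb ?K (Suc d) \<le> hilb ?K d" if "N\<^sub>0 \<le> d" for d
        by (rule hilb_nonincreasing[OF idl.subspace_span gr var_in_homog N that])
      show ?thesis
      proof (cases "d \<le> d\<^sub>1")
        case False
        then have "d\<^sub>1 \<le> d" by simp
        then have "hilb ?K d \<le> hilb ?K d\<^sub>1"
        proof (induction d rule: dec_induct)
          case (step d)
          then show ?case using \<open>\<And>d. N\<^sub>0 \<le> d \<Longrightarrow> hilb ?K (Suc d) \<le> hilb ?K d\<close>[of d] by (simp add: d\<^sub>1_def)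
        qed simp
        also have "\<dots> \<le> h d\<^sub>1" by (rule small) simp
        also have "h d\<^sub>1 = h d\<^sub>0" unfolding h_def by (rule ls(4)) (simp add: d\<^sub>1_def)
        also have "\<dots> = h d" unfolding h_def using \<open>d\<^sub>1 \<le> d\<close> by (intro ls(4)[symmetric]) (simp add: d\<^sub>1_def)
        finally show ?thesis .
      qed (rule small)
    qed
    have "(partial_sums ^^ r) (hilb (idl.span (gl_action g ` I \<union> var ` B))) d \<le> hilb (gl_action g ` I) d"
      if "card B = r" for B d
    proof -
      have "(partial_sums ^^ r) (hilb (idl.span (gl_action g ` I \<union> var ` B))) d \<le> (partial_sums ^^ r) h d"
        by (rule partial_sums_funpow_mono) (rule le[OF that])
      also have "\<dots> \<le> hilb I d" unfolding h_def by (rule ls(3))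
      finally show ?thesis unfolding hilb_gl_action[OF g I(1)] .
    qed
    then show ?thesis unfolding good_coordinates_def using A by blast
  qed
  ultimately show ?thesis by blast
qed

section \<open>Initial ideals in good coordinates\<close>

definition restrict_vars :: "'x set \<Rightarrow> ('x::finite, 'k::field) mpoly \<Rightarrow> ('x, 'k) mpoly"
  where "restrict_vars B = mpoly_eval const (\<lambda>i. if i \<in> B then 0 else var i)"

lemma restrict_vars_add: "restrict_vars B (f + g) = restrict_vars B f + restrict_vars B g"
  unfolding restrict_vars_def by (rule subst.mpoly_eval_add)

lemma restrict_vars_mult: "restrict_vars B (f * g) = restrict_vars B f * restrict_vars B g"
  unfolding restrict_vars_def by (rule subst.mpoly_eval_mult)

lemma restrict_vars_0 [simp]: "restrict_vars B 0 = 0"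
  unfolding restrict_vars_def by (rule subst.mpoly_eval_0)

lemma restrict_vars_const: "restrict_vars B (const c) = const c"
  unfolding restrict_vars_def by (rule subst.mpoly_eval_const)

lemma restrict_vars_var: "restrict_vars B (var i) = (if i \<in> B then 0 else var i)"
  unfolding restrict_vars_def by (rule subst.mpoly_eval_var)

lemma supported_Compl_iff: "\<nu> \<in> supported (- B) \<longleftrightarrow> (\<forall>i\<in>B. lookup \<nu> i = 0)"
  by (auto simp: supported_def)

lemma restrict_vars_monomial:
  fixes B :: "'x::finite set"
  shows "restrict_vars B (monomial \<nu> :: ('x, 'k::field) mpoly) = (if \<nu> \<in> supported (- B) then monomial \<nu> else 0)"
proof (cases "\<nu> \<in> supported (- B)")
  case True
  have "(\<Prod>i\<in>UNIV. (if i \<in> B then 0 else var i) ^ lookup \<nu> i)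
      = (\<Prod>i\<in>UNIV. var i ^ lookup \<nu> i :: ('x, 'k) mpoly)"
    by (rule prod.cong) (use True in \<open>auto simp: supported_Compl_iff\<close>)
  then show ?thesis
    using True by (simp add: restrict_vars_def subst.mpoly_eval_monomial flip: monomial_eq_prod_var)
next
  case False
  then obtain i where i: "i \<in> B" "lookup \<nu> i \<noteq> 0" by (auto simp: supported_Compl_iff)
  then have z: "(if i \<in> B then 0 else var i) ^ lookup \<nu> i = (0 :: ('x, 'k) mpoly)" by (simp add: zero_power)
  have "(\<Prod>i\<in>UNIV. (if i \<in> B then 0 else var i) ^ lookup \<nu> i) = (0 :: ('x, 'k) mpoly)"
    by (rule prod_zero[OF finite_class.finite_UNIV], rule bexI[where x = i], rule z, rule UNIV_I)
  then show ?thesis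
    using False by (simp add: restrict_vars_def subst.mpoly_eval_monomial)
qed

text \<open>Both descriptions are used: as a substitution the map is multiplicative, as a selection
  of terms it can be compared with initial forms.\<close>

lemma restrict_vars_eq: "restrict_vars B f = terms_satisfying (\<lambda>\<nu>. \<nu> \<in> supported (- B)) f"
proof (induction f rule: mpoly_induct)
  case (add c \<nu> p)
  have "terms_satisfying (\<lambda>\<nu>. \<nu> \<in> supported (- B)) (monomial \<nu> :: ('a, 'b) mpoly)
      = (if \<nu> \<in> supported (- B) then monomial \<nu> else 0)"
    by (auto intro: terms_satisfying_id terms_satisfying_none)
  then show ?case
    unfolding restrict_vars_add restrict_vars_mult restrict_vars_const terms_satisfying_add
      terms_satisfying_const_mult add restrict_vars_monomial by simp
qed simp

lemma restrict_vars_congruent: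
  "f - restrict_vars B f \<in> idl.span (var ` B)"
proof -
  have "mpoly_eval const var f - mpoly_eval const (\<lambda>i. if i \<in> B then 0 else var i) f \<in> idl.span (var ` B)"
    by (rule idl_subst_cong[OF idl.subspace_span]) (auto intro: idl.span_base idl.span_zero)
  then show ?thesis unfolding restrict_vars_def subst_var_id .
qed

text \<open>The ideal of the section by the coordinate subspace where the variables of
  \<open>B\<close> vanish, extended back to the full ring so that it can be compared with initial
  ideals.\<close>

definition restricted_ideal :: "'x set \<Rightarrow> ('x::finite, 'k::field) mpoly set \<Rightarrow> ('x, 'k) mpoly set"
  where "restricted_ideal B J = idl.span (restrict_vars B ` J)"

lemma terms_satisfying_commute:
  "terms_satisfying P (terms_satisfying Q f) = terms_satisfying Q (terms_satisfying P f)"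
  unfolding terms_satisfying_terms_satisfying by (rule terms_satisfying_cong) auto

lemma graded_restricted_ideal:
  fixes J :: "('x::finite, 'k::field) mpoly set"
  assumes "graded J"
  shows "graded (restricted_ideal B J)"
  unfolding restricted_ideal_def
proof (rule graded_span_homog)
  fix s d assume "s \<in> restrict_vars B ` J"
  then obtain f where f: "f \<in> J" "s = restrict_vars B f" by blast
  have "homog_part d s = restrict_vars B (homog_part d f)"
    unfolding f(2) restrict_vars_eq by (rule terms_satisfying_commute)
  moreover have "homog_part d f \<in> J" using assms f(1) by (simp add: graded_def)
  ultimately show "homog_part d s \<in> idl.span (restrict_vars B ` J)"
    by (auto intro: idl.span_base)
qed

text \<open>An element and its restriction are congruent modulo the variables of \<open>B\<close>,
  so adding the variables of \<open>C\<close> erases the difference between the two ideals.\<close>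

lemma restricted_ideal_Un_vars:
  fixes J :: "('x::finite, 'k::field) mpoly set"
  assumes "B \<subseteq> C"
  shows "idl.span (restricted_ideal B J \<union> var ` C) = idl.span (J \<union> var ` C)"
proof
  have vB: "idl.span (var ` B) \<subseteq> idl.span (K \<union> var ` C)" for K :: "('x, 'k) mpoly set"
    using assms by (intro idl.span_mono) auto
  show "idl.span (restricted_ideal B J \<union> var ` C) \<subseteq> idl.span (J \<union> var ` C)"
  proof (rule idl.span_minimal)
    have "restrict_vars B f \<in> idl.span (J \<union> var ` C)" if "f \<in> J" for f
    proof -
      have "f - (f - restrict_vars B f) \<in> idl.span (J \<union> var ` C)"
        using that by (intro idl.span_diff idl.span_base[of f] subsetD[OF vB restrict_vars_congruent]) simp
      then show ?thesis by simp
    qed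
    then have "restricted_ideal B J \<subseteq> idl.span (J \<union> var ` C)"
      unfolding restricted_ideal_def by (intro idl.span_minimal) auto
    then show "restricted_ideal B J \<union> var ` C \<subseteq> idl.span (J \<union> var ` C)" by (auto intro: idl.span_base)
  qed simp
  show "idl.span (J \<union> var ` C) \<subseteq> idl.span (restricted_ideal B J \<union> var ` C)"
  proof (rule idl.span_minimal)
    have "f \<in> idl.span (restricted_ideal B J \<union> var ` C)" if "f \<in> J" for f
    proof -
      have "restrict_vars B f \<in> restricted_ideal B J"
        unfolding restricted_ideal_def using that by (intro idl.span_base) blast
      then have "restrict_vars B f + (f - restrict_vars B f) \<in> idl.span (restricted_ideal B J \<union> var ` C)"
        by (intro idl.span_add idl.span_base[of "restrict_vars B f"] subsetD[OF vB restrict_vars_congruent]) simp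
      then show ?thesis by simp
    qed
    then show "J \<union> var ` C \<subseteq> idl.span (restricted_ideal B J \<union> var ` C)" by (auto intro: idl.span_base)
  qed simp
qed

lemma restrict_vars_span:
  fixes J :: "('x::finite, 'k::field) mpoly set"
  assumes "x \<in> idl.span (J \<union> var ` B)"
  shows "restrict_vars B x \<in> restricted_ideal B J"
  using assms
proof (induction rule: idl.span_induct_alt)
  case base
  then show ?case by (simp add: restricted_ideal_def idl.span_zero)
next
  case (step c x y)
  have "restrict_vars B x \<in> restricted_ideal B J"
  proof (cases "x \<in> J")
    case True
    then show ?thesis unfolding restricted_ideal_def by (intro idl.span_base) blast
  next
    case False
    then obtain b where "b \<in> B" "x = var b" using step(1) by blast
    then show ?thesis by (simp add: restrict_vars_var restricted_ideal_def idl.span_zero)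
  qed
  then show ?case
    using step(2) unfolding restrict_vars_add restrict_vars_mult restricted_ideal_def
    by (intro idl.span_add idl.span_scale)
qed

text \<open>Each form costs one summation, by \<open>hilb_le_sum\<close>, whether or not it is a
  non-zero-divisor.\<close>

lemma hilb_le_partial_sums:
  fixes K :: "('x::finite, 'k::field) mpoly set"
  assumes "finite F" "F \<subseteq> homog 1" "idl.subspace K" "graded K"
  shows "hilb K d \<le> (partial_sums ^^ card F) (hilb (idl.span (K \<union> F))) d"
  using assms
proof (induction F arbitrary: K d)
  case empty
  have "idl.span (K \<union> {}) = K" using empty by simp
  then show ?case by (simp only: card.empty funpow_0)
next
  case (insert l F)
  let ?K = "idl.span (K \<union> {l})"
  have gr: "graded ?K" by (rule graded_add_form[OF insert.prems(3), where e = 1]) (use insert.prems(1) in simp)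
  have eq: "idl.span (?K \<union> F) = idl.span (K \<union> insert l F)" unfolding idl_span_Un_span by simp
  have "hilb K d \<le> partial_sums (hilb ?K) d"
    unfolding partial_sums_def by (rule hilb_le_sum) (use insert.prems in auto)
  also have "\<dots> \<le> partial_sums ((partial_sums ^^ card F) (hilb (idl.span (?K \<union> F)))) d"
    by (rule partial_sums_mono) (rule insert.IH[OF _ idl.subspace_span gr], use insert.prems in simp)
  finally show ?case using insert.hyps unfolding eq by simp
qed

lemma params_add_forms:
  fixes J :: "('x::finite, 'k::field) mpoly set"
  assumes "finite F" "F \<subseteq> homog 1" "params (idl.span (J \<union> F)) k"
  shows "params J (k + card F)"
proof -
  obtain H N where H: "finite H" "card H \<le> k" "H \<subseteq> homog 1" "homog N \<subseteq> idl.span (idl.span (J \<union> F) \<union> H)"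
    using assms(3) unfolding params_def by blast
  have "homog N \<subseteq> idl.span (J \<union> (F \<union> H))" using H(4) unfolding idl_span_Un_span .
  moreover have "card (F \<union> H) \<le> k + card F" using card_Un_le[of F H] H(2) by simp
  moreover have "finite (F \<union> H)" "F \<union> H \<subseteq> homog 1" using assms(1,2) H by auto
  ultimately show ?thesis unfolding params_def by blast
qed

subsection \<open>Initial forms\<close>

definition argmin_vars :: "real ^ 'x::finite \<Rightarrow> 'x set"
  where "argmin_vars \<omega> = {i. \<forall>k. \<omega> $ i \<le> \<omega> $ k}"

lemma argmin_vars_nonempty: "argmin_vars \<omega> \<noteq> {}"
proof -
  have "finite (range (($) \<omega>))" "range (($) \<omega>) \<noteq> {}" by simp_all
  then have "Min (range (($) \<omega>)) \<in> range (($) \<omega>)" by (rule Min_in)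
  then obtain i where "\<omega> $ i = Min (range (($) \<omega>))" by force
  then have "i \<in> argmin_vars \<omega>" by (simp add: argmin_vars_def)
  then show ?thesis by blast
qed

text \<open>The excess of the weight over the least one possible in the same degree is a sum of
  nonnegative terms, one for each variable. It vanishes only if no variable outside
  \<open>argmin_vars \<omega>\<close> occurs.\<close>

lemma weight_ge_min:
  fixes \<omega> :: "real ^ 'x::finite"
  assumes "i \<in> argmin_vars \<omega>"
  shows "\<omega> $ i * real (exp_degree \<nu>) \<le> weight \<omega> \<nu>"
    and "weight \<omega> \<nu> = \<omega> $ i * real (exp_degree \<nu>) \<longleftrightarrow> \<nu> \<in> supported (argmin_vars \<omega>)"
proof -
  have min: "\<omega> $ i \<le> \<omega> $ k" for k using assms by (simp add: argmin_vars_def)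
  have diff: "weight \<omega> \<nu> - \<omega> $ i * real (exp_degree \<nu>) = (\<Sum>k\<in>UNIV. (\<omega> $ k - \<omega> $ i) * real (lookup \<nu> k))"
    by (simp add: weight_def exp_degree_def sum_distrib_left left_diff_distrib sum_subtractf)
  have nn: "0 \<le> (\<omega> $ k - \<omega> $ i) * real (lookup \<nu> k)" for k using min[of k] by simp
  have "0 \<le> (\<Sum>k\<in>UNIV. (\<omega> $ k - \<omega> $ i) * real (lookup \<nu> k))" by (rule sum_nonneg) (rule nn)
  then show "\<omega> $ i * real (exp_degree \<nu>) \<le> weight \<omega> \<nu>" using diff by linarith
  have "weight \<omega> \<nu> = \<omega> $ i * real (exp_degree \<nu>) \<longleftrightarrow> (\<Sum>k\<in>UNIV. (\<omega> $ k - \<omega> $ i) * real (lookup \<nu> k)) = 0"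
    using diff by linarith
  also have "\<dots> \<longleftrightarrow> (\<forall>k. (\<omega> $ k - \<omega> $ i) * real (lookup \<nu> k) = 0)"
    by (subst sum_nonneg_eq_0_iff) (use nn in auto)
  also have "\<dots> \<longleftrightarrow> (\<forall>k. \<omega> $ k = \<omega> $ i \<or> lookup \<nu> k = 0)"
    by (simp only: mult_eq_0_iff right_minus_eq of_nat_eq_0_iff)
  also have "\<dots> \<longleftrightarrow> \<nu> \<in> supported (argmin_vars \<omega>)"
  proof -
    have eq: "\<omega> $ k = \<omega> $ i \<longleftrightarrow> k \<in> argmin_vars \<omega>" for k
    proof
      assume "\<omega> $ k = \<omega> $ i"
      then show "k \<in> argmin_vars \<omega>" using min unfolding argmin_vars_def by simp
    next
      assume "k \<in> argmin_vars \<omega>"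
      then have "\<omega> $ k \<le> \<omega> $ i" unfolding argmin_vars_def by blast
      then show "\<omega> $ k = \<omega> $ i" using min[of k] by (rule order_antisym)
    qed
    show ?thesis by (simp only: supported_def mem_Collect_eq eq disj_imp)
  qed
  finally show "weight \<omega> \<nu> = \<omega> $ i * real (exp_degree \<nu>) \<longleftrightarrow> \<nu> \<in> supported (argmin_vars \<omega>)" .
qed

section \<open>Initial ideals and their Hilbert functions\<close>

lemma initial_ideal_eq: "initial_ideal \<omega> J = idl.span (initial_form \<omega> ` J)"
  unfolding initial_ideal_def by (rule genideal_type_algebra)

text \<open>Within one degree the terms of least possible weight are those in the minimal variables
  alone. If one of them occurs in \<open>f\<close>, the initial form consists of exactly these;
  otherwise the restriction is 0.\<close>

lemma restrict_vars_homog_initial: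
  fixes f :: "('x::finite, 'k::field) mpoly"
  assumes f: "f \<in> homog d"
  shows "restrict_vars (- argmin_vars \<omega>) f = 0 \<or> restrict_vars (- argmin_vars \<omega>) f = initial_form \<omega> f"
proof (cases "\<exists>\<nu>\<in>keys f. \<nu> \<in> supported (argmin_vars \<omega>)")
  case False
  then have "restrict_vars (- argmin_vars \<omega>) f = 0"
    unfolding restrict_vars_eq by (intro terms_satisfying_none) simp
  then show ?thesis by blast
next
  case True
  then obtain \<nu>\<^sub>0 where nu0: "\<nu>\<^sub>0 \<in> keys f" "\<nu>\<^sub>0 \<in> supported (argmin_vars \<omega>)" by blast
  obtain i where i: "i \<in> argmin_vars \<omega>" using argmin_vars_nonempty by blast
  have deg: "exp_degree \<nu> = d" if "\<nu> \<in> keys f" for \<nu> using f that by (auto simp: polys_on_def)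
  have w0: "weight \<omega> \<nu>\<^sub>0 = \<omega> $ i * real d" using weight_ge_min(2)[OF i] nu0 deg by metis
  have "terms_satisfying (\<lambda>\<nu>. \<nu> \<in> supported (- (- argmin_vars \<omega>))) f = initial_form \<omega> f"
    unfolding initial_form_def
  proof (rule terms_satisfying_cong)
    fix \<nu> assume nu: "\<nu> \<in> keys f"
    have "\<nu> \<in> supported (argmin_vars \<omega>) \<longleftrightarrow> weight \<omega> \<nu> = \<omega> $ i * real d"
      using weight_ge_min(2)[OF i] deg[OF nu] by metis
    also have "\<dots> \<longleftrightarrow> (\<forall>\<mu>\<in>keys f. weight \<omega> \<nu> \<le> weight \<omega> \<mu>)"
    proof
      assume "weight \<omega> \<nu> = \<omega> $ i * real d"
      then show "\<forall>\<mu>\<in>keys f. weight \<omega> \<nu> \<le> weight \<omega> \<mu>"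
        using weight_ge_min(1)[OF i] deg by metis
    next
      assume "\<forall>\<mu>\<in>keys f. weight \<omega> \<nu> \<le> weight \<omega> \<mu>"
      then have "weight \<omega> \<nu> \<le> \<omega> $ i * real d" using nu0(1) w0 by metis
      moreover have "\<omega> $ i * real d \<le> weight \<omega> \<nu>" using weight_ge_min(1)[OF i, of \<nu>] deg[OF nu] by metis
      ultimately show "weight \<omega> \<nu> = \<omega> $ i * real d" by linarith
    qed
    finally show "(\<nu> \<in> supported (- (- argmin_vars \<omega>))) = (\<forall>\<mu>\<in>keys f. weight \<omega> \<nu> \<le> weight \<omega> \<mu>)"
      by simp
  qed
  then show ?thesis unfolding restrict_vars_eq by blast
qed

lemma restricted_ideal_subset_initial_ideal:
  fixes J :: "('x::finite, 'k::field) mpoly set"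
  assumes J: "graded J"
  shows "restricted_ideal (- argmin_vars \<omega>) J \<subseteq> initial_ideal \<omega> J"
  unfolding restricted_ideal_def
proof (rule idl.span_minimal)
  show "idl.subspace (initial_ideal \<omega> J)" by (simp add: initial_ideal_eq)
  show "restrict_vars (- argmin_vars \<omega>) ` J \<subseteq> initial_ideal \<omega> J"
  proof clarify
    fix f assume f: "f \<in> J"
    let ?h = "\<lambda>d. homog_part d f"
    let ?D = "exp_degree ` keys f"
    have "restrict_vars (- argmin_vars \<omega>) f = restrict_vars (- argmin_vars \<omega>) (\<Sum>d\<in>?D. ?h d)"
      using sum_homog_components[of f] by simp
    also have "\<dots> = (\<Sum>d\<in>?D. restrict_vars (- argmin_vars \<omega>) (?h d))"
      unfolding restrict_vars_eq terms_satisfying_sum ..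
    also have "\<dots> \<in> initial_ideal \<omega> J"
      unfolding initial_ideal_eq
    proof (rule idl.span_sum)
      fix d
      have "?h d \<in> J" using J f by (simp add: graded_def)
      then have "initial_form \<omega> (?h d) \<in> idl.span (initial_form \<omega> ` J)" by (intro idl.span_base) blast
      then show "restrict_vars (- argmin_vars \<omega>) (?h d) \<in> idl.span (initial_form \<omega> ` J)"
        using restrict_vars_homog_initial[where d = d and f = "?h d" and \<omega> = \<omega>, OF terms_satisfying_in_polys_on]
          idl.span_zero by metis
    qed
    finally show "restrict_vars (- argmin_vars \<omega>) f \<in> initial_ideal \<omega> J" .
  qed
qed

text \<open>If the component of degree \<open>d\<close> of an initial form is not 0, then the
  component of \<open>f\<close> attains the same least weight, and the former is the initial form of
  the latter.\<close>

lemma graded_initial_ideal: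
  fixes J :: "('x::finite, 'k::field) mpoly set"
  assumes J: "graded J"
  shows "graded (initial_ideal \<omega> J)"
  unfolding initial_ideal_eq
proof (rule graded_span_homog)
  fix s d assume "s \<in> initial_form \<omega> ` J"
  then obtain f where f: "f \<in> J" "s = initial_form \<omega> f" by blast
  let ?h = "homog_part d"
  show "?h s \<in> idl.span (initial_form \<omega> ` J)"
  proof (cases "\<exists>\<nu>\<in>keys s. exp_degree \<nu> = d")
    case False
    then have "?h s = 0" by (intro terms_satisfying_none) blast
    then show ?thesis by (simp add: idl.span_zero)
  next
    case True
    then obtain \<nu>\<^sub>0 where nu0: "\<nu>\<^sub>0 \<in> keys f" "exp_degree \<nu>\<^sub>0 = d"
      "\<forall>\<mu>\<in>keys f. weight \<omega> \<nu>\<^sub>0 \<le> weight \<omega> \<mu>"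
      unfolding f(2) initial_form_def keys_terms_satisfying by blast
    have "?h s = initial_form \<omega> (?h f)"
    proof (rule poly_mapping_eqI)
      fix \<nu>
      have "(\<forall>\<mu>\<in>keys f. weight \<omega> \<nu> \<le> weight \<omega> \<mu>) \<longleftrightarrow>
          (\<forall>\<mu>\<in>keys (?h f). weight \<omega> \<nu> \<le> weight \<omega> \<mu>)"
      proof
        assume "\<forall>\<mu>\<in>keys (?h f). weight \<omega> \<nu> \<le> weight \<omega> \<mu>"
        then have "weight \<omega> \<nu> \<le> weight \<omega> \<nu>\<^sub>0" using nu0 by (simp add: keys_terms_satisfying)
        then show "\<forall>\<mu>\<in>keys f. weight \<omega> \<nu> \<le> weight \<omega> \<mu>" using nu0(3) by (meson order_trans)
      qed (simp add: keys_terms_satisfying)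
      then show "lookup (?h s) \<nu> = lookup (initial_form \<omega> (?h f)) \<nu>"
        unfolding f(2) initial_form_def lookup_terms_satisfying by simp
    qed
    moreover have "?h f \<in> J" using J f(1) by (simp add: graded_def)
    ultimately show ?thesis by (auto intro: idl.span_base)
  qed
qed

lemma weight_add: "weight \<omega> (\<mu> + \<nu>) = weight \<omega> \<mu> + weight \<omega> \<nu>"
  by (simp add: weight_def lookup_add algebra_simps sum.distrib)

lemma terms_of_weight_monomial_mult:
  fixes f :: "('x::finite, 'k::field) mpoly"
  shows "terms_satisfying (\<lambda>\<nu>. weight \<omega> \<nu> = weight \<omega> \<mu> + w) (monomial \<mu> * f)
    = monomial \<mu> * terms_satisfying (\<lambda>\<nu>. weight \<omega> \<nu> = w) f"
proof (induction f rule: mpoly_induct)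
  case (add c \<nu> p)
  have "terms_satisfying (\<lambda>\<nu>. weight \<omega> \<nu> = weight \<omega> \<mu> + w) (monomial (\<mu> + \<nu>) :: ('x, 'k) mpoly)
      = monomial \<mu> * terms_satisfying (\<lambda>\<nu>. weight \<omega> \<nu> = w) (monomial \<nu>)"
  proof (cases "weight \<omega> \<nu> = w")
    case True
    have "terms_satisfying (\<lambda>\<nu>. weight \<omega> \<nu> = weight \<omega> \<mu> + w) (monomial (\<mu> + \<nu>) :: ('x, 'k) mpoly) = monomial (\<mu> + \<nu>)"
      by (rule terms_satisfying_id) (simp add: weight_add True)
    moreover have "terms_satisfying (\<lambda>\<nu>. weight \<omega> \<nu> = w) (monomial \<nu> :: ('x, 'k) mpoly) = monomial \<nu>"
      by (rule terms_satisfying_id) (simp add: True)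
    ultimately show ?thesis by (simp add: monomial_add)
  next
    case False
    have "terms_satisfying (\<lambda>\<nu>. weight \<omega> \<nu> = weight \<omega> \<mu> + w) (monomial (\<mu> + \<nu>) :: ('x, 'k) mpoly) = 0"
      by (rule terms_satisfying_none) (simp add: weight_add False)
    moreover have "terms_satisfying (\<lambda>\<nu>. weight \<omega> \<nu> = w) (monomial \<nu> :: ('x, 'k) mpoly) = 0"
      by (rule terms_satisfying_none) (simp add: False)
    ultimately show ?thesis by simp
  qed
  then show ?case
    unfolding distrib_left terms_satisfying_add mult.left_commute[of "monomial \<mu>" "const c"]
      terms_satisfying_const_mult monomial_add[symmetric] add by simp
qed simp

text \<open>With one weight \<open>w\<close> fixed, the property is closed under sums: summands
  without terms of weight \<open>w\<close> are lifted by 0. A monomial multiple of an initial form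
  is lifted by the component of degree \<open>d\<close> of the same multiple of the element
  itself.\<close>

lemma initial_ideal_lift:
  fixes J :: "('x::finite, 'k::field) mpoly set"
  assumes J: "idl.subspace J" "graded J" and x: "x \<in> initial_ideal \<omega> J"
  shows "\<exists>F\<in>J. F \<in> homog d \<and> (\<forall>\<nu>\<in>keys F. w \<le> weight \<omega> \<nu>) \<and>
    terms_satisfying (\<lambda>\<nu>. weight \<omega> \<nu> = w) F
      = terms_satisfying (\<lambda>\<nu>. weight \<omega> \<nu> = w) (homog_part d x)"
    (is "?P x")
proof -
  let ?w = "terms_satisfying (\<lambda>\<nu>. weight \<omega> \<nu> = w)"
  let ?h = "homog_part d"
  have P0: "?P 0" using J(1) by (intro bexI[of _ 0]) (simp_all add: idl.subspace_0)
  have Padd: "?P (a + b)" if ab: "?P a" "?P b" for a b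
  proof -
    obtain F1 where F1: "F1 \<in> J" "F1 \<in> homog d" "\<forall>\<nu>\<in>keys F1. w \<le> weight \<omega> \<nu>" "?w F1 = ?w (?h a)"
      using ab(1) by blast
    obtain F2 where F2: "F2 \<in> J" "F2 \<in> homog d" "\<forall>\<nu>\<in>keys F2. w \<le> weight \<omega> \<nu>" "?w F2 = ?w (?h b)"
      using ab(2) by blast
    show ?thesis
    proof (intro bexI[of _ "F1 + F2"] conjI)
      show "F1 + F2 \<in> J" by (rule idl.subspace_add[OF J(1) F1(1) F2(1)])
      show "F1 + F2 \<in> homog d" by (rule vs.subspace_add[OF subspace_polys_on F1(2) F2(2)])
      show "\<forall>\<nu>\<in>keys (F1 + F2). w \<le> weight \<omega> \<nu>"
        using F1(3) F2(3) keys_add[of F1 F2] by blast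
      show "?w (F1 + F2) = ?w (?h (a + b))" unfolding terms_satisfying_add F1(4) F2(4) ..
    qed
  qed
  have Pscale: "?P (const c * a)" if a: "?P a" for c a
  proof -
    obtain F1 where F1: "F1 \<in> J" "F1 \<in> homog d" "\<forall>\<nu>\<in>keys F1. w \<le> weight \<omega> \<nu>" "?w F1 = ?w (?h a)"
      using a by blast
    show ?thesis
    proof (intro bexI[of _ "const c * F1"] conjI)
      show "const c * F1 \<in> J" by (rule idl.subspace_scale[OF J(1) F1(1)])
      show "const c * F1 \<in> homog d" by (rule vs.subspace_scale[OF subspace_polys_on F1(2)])
      show "\<forall>\<nu>\<in>keys (const c * F1). w \<le> weight \<omega> \<nu>"
        using F1(3) by (simp add: in_keys_iff lookup_const_mult)
      show "?w (const c * F1) = ?w (?h (const c * a))" unfolding terms_satisfying_const_mult F1(4) ..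
    qed
  qed
  have Pmono: "?P (monomial \<mu> * initial_form \<omega> f)" if f: "f \<in> J" for \<mu> f
  proof (cases "f = 0")
    case True
    then show ?thesis using P0 by (simp add: initial_form_def)
  next
    case False
    then have ne: "keys f \<noteq> {}" by simp
    define w0 where "w0 = Min (weight \<omega> ` keys f)"
    have w0le: "w0 \<le> weight \<omega> \<nu>" if "\<nu> \<in> keys f" for \<nu> unfolding w0_def using that by simp
    have "w0 \<in> weight \<omega> ` keys f" unfolding w0_def using ne by (intro Min_in) auto
    then obtain \<nu>\<^sub>0 where nu0: "\<nu>\<^sub>0 \<in> keys f" "weight \<omega> \<nu>\<^sub>0 = w0" by blast
    have inf: "initial_form \<omega> f = terms_satisfying (\<lambda>\<nu>. weight \<omega> \<nu> = w0) f"
      unfolding initial_form_def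
    proof (rule terms_satisfying_cong)
      fix \<nu> assume nu: "\<nu> \<in> keys f"
      show "(\<forall>\<mu>\<in>keys f. weight \<omega> \<nu> \<le> weight \<omega> \<mu>) = (weight \<omega> \<nu> = w0)"
        using w0le nu nu0 by (metis order_antisym)
    qed
    have e: "monomial \<mu> * initial_form \<omega> f = terms_satisfying (\<lambda>\<nu>. weight \<omega> \<nu> = weight \<omega> \<mu> + w0) (monomial \<mu> * f)"
      unfolding inf terms_of_weight_monomial_mult ..
    show ?thesis
    proof (cases "weight \<omega> \<mu> + w0 = w")
      case True
      have mf: "monomial \<mu> * f \<in> J" by (rule idl.subspace_scale[OF J(1) f])
      show ?thesis
      proof (intro bexI[of _ "?h (monomial \<mu> * f)"] conjI)
        show "?h (monomial \<mu> * f) \<in> J" using J(2) mf by (simp add: graded_def)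
        show "?h (monomial \<mu> * f) \<in> homog d" by (rule terms_satisfying_in_polys_on)
        show "\<forall>\<nu>\<in>keys (?h (monomial \<mu> * f)). w \<le> weight \<omega> \<nu>"
        proof
          fix \<nu> assume "\<nu> \<in> keys (?h (monomial \<mu> * f))"
          then have "\<nu> \<in> keys (monomial \<mu> * f)" by (simp add: keys_terms_satisfying)
          then obtain \<kappa> where "\<nu> = \<mu> + \<kappa>" "\<kappa> \<in> keys f"
            using keys_mult[of "monomial \<mu>" f] by auto
          then show "w \<le> weight \<omega> \<nu>" using w0le[of \<kappa>] True by (simp add: weight_add)
        qed
        show "?w (?h (monomial \<mu> * f)) = ?w (?h (monomial \<mu> * initial_form \<omega> f))"
          unfolding e True terms_satisfying_terms_satisfying by (rule terms_satisfying_cong) auto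
      qed
    next
      case False
      have "?w (?h (monomial \<mu> * initial_form \<omega> f)) = 0"
        unfolding e terms_satisfying_terms_satisfying using False by (intro terms_satisfying_none) auto
      then show ?thesis using J(1) by (intro bexI[of _ 0]) (simp_all add: idl.subspace_0)
    qed
  qed
  show ?thesis
    using x unfolding initial_ideal_eq
  proof (induction rule: idl.span_induct_alt)
    case base
    show ?case by (rule P0)
  next
    case (step c a b)
    obtain f where f: "f \<in> J" "a = initial_form \<omega> f" using step(1) by blast
    have "?P (c * a)"
    proof (induction c rule: mpoly_induct)
      case zero
      then show ?case using P0 by simp
    next
      case (add k \<mu> p)
      have "?P (const k * (monomial \<mu> * a) + p * a)"
        unfolding f(2) by (rule Padd[OF Pscale[OF Pmono[OF f(1)]] add[unfolded f(2)]])
      then show ?case by (simp only: distrib_right mult.assoc)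
    qed
    then show ?case by (rule Padd[OF _ step(2)])
  qed
qed

text \<open>Monomials \<open>S\<close> forming a basis modulo the initial ideal span modulo
  \<open>J\<close> as well: the part of least weight of a form is removed by a combination of
  \<open>S\<close> and an element of \<open>J\<close>, which raises the least weight.\<close>

lemma hilb_le_initial_ideal:
  fixes J :: "('x::finite, 'k::field) mpoly set"
  assumes J: "idl.subspace J" "graded J"
  shows "hilb J d \<le> hilb (initial_ideal \<omega> J) d"
proof -
  let ?N = "initial_ideal \<omega> J"
  let ?W = "homog d :: ('x, 'k) mpoly set"
  let ?G = "monomial ` {\<nu>. exp_degree \<nu> = d} :: ('x, 'k) mpoly set"
  have N: "vs.subspace ?N" by (rule ideal_subspace) (simp add: initial_ideal_eq)
  have W: "vs.subspace ?W" by (rule subspace_polys_on)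
  have GW: "?G \<subseteq> ?W" by auto
  have b: "card T \<le> card ?G" if "T \<subseteq> ?G" for T using that finite_exp_degree_eq by (intro card_mono) auto
  obtain S where S: "S \<subseteq> ?G" "vs.indep_mod ?N S" "?G \<subseteq> vs.span (?N \<union> S)"
    by (rule vs.maximal_indep_mod[OF N b])
  have finS: "finite S" using S(2) by (simp add: vs.indep_mod_def)
  have "card S \<le> hilb ?N d"
    unfolding hilb_def by (rule vs.card_le_codim[OF N hilb_fin _ S(2)]) (use S(1) GW in blast)
  have WN: "?W \<subseteq> vs.span (?N \<union> S)"
    using polys_on_span vs.span_minimal[OF S(3) vs.subspace_span] by (rule subset_trans)
  let ?w = "\<lambda>w. terms_satisfying (\<lambda>\<nu>. weight \<omega> \<nu> = w)"
  \<comment> \<open>\<open>S\<close> consists of monomials, so its span contains the weight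
    components of its elements.\<close>
  have wS: "?w w s \<in> vs.span S" if "s \<in> vs.span S" for w s
    using that
  proof (induction rule: vs.span_induct_alt)
    case base
    then show ?case by (simp add: vs.span_zero)
  next
    case (step c a b)
    obtain \<nu> where nu: "a = monomial \<nu>" using step(1) S(1) by blast
    have "?w w a = a \<or> ?w w a = 0"
      unfolding nu by (cases "weight \<omega> \<nu> = w") (auto intro: terms_satisfying_id terms_satisfying_none)
    then have "?w w a \<in> vs.span S" using step(1) vs.span_base vs.span_zero by metis
    then show ?case
      using step(2) unfolding terms_satisfying_add terms_satisfying_const_mult
      by (intro vs.span_add vs.span_scale)
  qed
  \<comment> \<open>The reduction terminates because the finitely many exponents of degree
    \<open>d\<close> with weight at least \<open>w\<close> become fewer as \<open>w\<close>
    rises.\<close>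
  have red: "f \<in> vs.span (J \<union> S)" if "f \<in> ?W" "\<And>\<nu>. \<nu> \<in> keys f \<Longrightarrow> w \<le> weight \<omega> \<nu>" for f w
    using that
  proof (induction "card {\<nu> :: 'x \<Rightarrow>\<^sub>0 nat. exp_degree \<nu> = d \<and> w \<le> weight \<omega> \<nu>}" arbitrary: f w rule: less_induct)
    case less
    show ?case
    proof (cases "f = 0")
      case True
      then show ?thesis by (simp add: vs.span_zero)
    next
      case False
      define w0 where "w0 = Min (weight \<omega> ` keys f)"
      have w0le: "w0 \<le> weight \<omega> \<nu>" if "\<nu> \<in> keys f" for \<nu> unfolding w0_def using that by simp
      have "w0 \<in> weight \<omega> ` keys f" unfolding w0_def using False by (intro Min_in) auto
      then obtain \<nu>\<^sub>0 where nu0: "\<nu>\<^sub>0 \<in> keys f" "weight \<omega> \<nu>\<^sub>0 = w0" by blast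
      have ww0: "w \<le> w0" using less.prems(2)[OF nu0(1)] nu0(2) by simp
      have degf: "exp_degree \<nu> = d" if "\<nu> \<in> keys f" for \<nu>
        using less.prems(1) that by (auto simp: polys_on_def)
      obtain n s where ns: "n \<in> ?N" "s \<in> vs.span S" "f = n + s"
        using WN less.prems(1) unfolding vs.span_Un_subspace[OF N] subset_iff by blast
      have sW: "s \<in> ?W" using ns(2) vs.span_minimal[OF subset_trans[OF S(1) GW] W] by blast
      have "f - s \<in> ?W" using vs.subspace_diff[OF W less.prems(1) sW] .
      then have nW: "n \<in> ?W" using ns(3) by simp
      then have hn: "homog_part d n = n"
        by (intro terms_satisfying_polys_on) auto
      obtain F where F: "F \<in> J" "F \<in> ?W" "\<forall>\<nu>\<in>keys F. w0 \<le> weight \<omega> \<nu>" "?w w0 F = ?w w0 n"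
        using initial_ideal_lift[OF J ns(1), of d w0] unfolding hn by blast
      \<comment> \<open>The parts of weight \<open>w0\<close> cancel, since \<open>f = n + s\<close>
        and \<open>F\<close> agrees with \<open>n\<close> in this weight.\<close>
      define f' where "f' = f - F - ?w w0 s"
      have sS: "?w w0 s \<in> vs.span S" by (rule wS[OF ns(2)])
      have swW: "?w w0 s \<in> ?W" using sS vs.span_minimal[OF subset_trans[OF S(1) GW] W] by blast
      have f'W: "f' \<in> ?W" unfolding f'_def
        by (rule vs.subspace_diff[OF W vs.subspace_diff[OF W less.prems(1) F(2)] swW])
      have ge: "w0 \<le> weight \<omega> \<nu>" if "\<nu> \<in> keys f'" for \<nu>
      proof -
        have "lookup f' \<nu> \<noteq> 0" using that by (simp add: in_keys_iff)
        then have "\<nu> \<in> keys f \<or> \<nu> \<in> keys F \<or> \<nu> \<in> keys (?w w0 s)"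
          by (auto simp: f'_def lookup_minus in_keys_iff)
        then show ?thesis using w0le F(3) by (auto simp: keys_terms_satisfying)
      qed
      have "?w w0 f' = ?w w0 n + ?w w0 s - ?w w0 n - ?w w0 s"
        unfolding f'_def ns(3) terms_satisfying_diff terms_satisfying_add F(4)
        by (simp add: terms_satisfying_terms_satisfying)
      then have z: "?w w0 f' = 0" by simp
      have gt: "w0 < weight \<omega> \<nu>" if "\<nu> \<in> keys f'" for \<nu>
      proof -
        have "weight \<omega> \<nu> \<noteq> w0"
        proof
          assume "weight \<omega> \<nu> = w0"
          then have "\<nu> \<in> keys (?w w0 f')" using that by (simp add: keys_terms_satisfying)
          then show False using z by simp
        qed
        then show ?thesis using ge[OF that] by simp
      qed
      have "f' \<in> vs.span (J \<union> S)"
      proof (cases "f' = 0")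
        case True
        then show ?thesis by (simp add: vs.span_zero)
      next
        case False
        define w1 where "w1 = Min (weight \<omega> ` keys f')"
        have "w1 \<in> weight \<omega> ` keys f'" unfolding w1_def using False by (intro Min_in) auto
        then have w1: "w0 < w1" using gt by auto
        have w1le: "w1 \<le> weight \<omega> \<nu>" if "\<nu> \<in> keys f'" for \<nu> unfolding w1_def using that by simp
        have "{\<nu> :: 'x \<Rightarrow>\<^sub>0 nat. exp_degree \<nu> = d \<and> w1 \<le> weight \<omega> \<nu>} \<subset> {\<nu>. exp_degree \<nu> = d \<and> w \<le> weight \<omega> \<nu>}"
        proof
          show "{\<nu> :: 'x \<Rightarrow>\<^sub>0 nat. exp_degree \<nu> = d \<and> w1 \<le> weight \<omega> \<nu>} \<subseteq> {\<nu>. exp_degree \<nu> = d \<and> w \<le> weight \<omega> \<nu>}"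
            using w1 ww0 by auto
          show "{\<nu> :: 'x \<Rightarrow>\<^sub>0 nat. exp_degree \<nu> = d \<and> w1 \<le> weight \<omega> \<nu>} \<noteq> {\<nu>. exp_degree \<nu> = d \<and> w \<le> weight \<omega> \<nu>}"
            using nu0 degf ww0 w1 by force
        qed
        moreover have "finite {\<nu> :: 'x \<Rightarrow>\<^sub>0 nat. exp_degree \<nu> = d \<and> w \<le> weight \<omega> \<nu>}"
          by (rule finite_subset[OF _ finite_exp_degree_eq[of d]]) auto
        ultimately have "card {\<nu> :: 'x \<Rightarrow>\<^sub>0 nat. exp_degree \<nu> = d \<and> w1 \<le> weight \<omega> \<nu>}
            < card {\<nu> :: 'x \<Rightarrow>\<^sub>0 nat. exp_degree \<nu> = d \<and> w \<le> weight \<omega> \<nu>}"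
          by (intro psubset_card_mono)
        then show ?thesis by (rule less.hyps[OF _ f'W w1le])
      qed
      moreover have "F \<in> vs.span (J \<union> S)" using F(1) by (intro vs.span_base) simp
      moreover have "?w w0 s \<in> vs.span (J \<union> S)" using sS vs.span_mono[of S "J \<union> S"] by blast
      ultimately have "f' + F + ?w w0 s \<in> vs.span (J \<union> S)" by (intro vs.span_add)
      then show ?thesis by (simp add: f'_def)
    qed
  qed
  have "?W \<subseteq> vs.span (J \<union> S)"
  proof
    fix f assume f: "f \<in> ?W"
    show "f \<in> vs.span (J \<union> S)"
    proof (cases "f = 0")
      case False
      show ?thesis by (rule red[OF f, of "Min (weight \<omega> ` keys f)"]) simp
    qed (simp add: vs.span_zero)
  qed
  then have "hilb J d \<le> card S"
    unfolding hilb_def by (rule vs.codim_le_card[OF ideal_subspace[OF J(1)] finS])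
  then show ?thesis using \<open>card S \<le> hilb ?N d\<close> by simp
qed

section \<open>Initial ideals of an ideal in good coordinates\<close>

locale good_ideal =
  fixes J :: "('x::finite, 'k::field_char_0) mpoly set" and r :: nat
  assumes J: "idl.subspace J" "graded J" "1 \<notin> J"
    and growth: "\<not> growth_le J r"
    and good: "good_coordinates r J"
    and lt: "Suc r < CARD('x)"
begin

lemma good_params:
  assumes "Suc r \<le> card B"
  obtains N where "homog N \<subseteq> idl.span (J \<union> var ` B)"
proof -
  obtain C where C: "C \<subseteq> B" "card C = Suc r" using obtain_subset_with_card_n[OF assms] by metis
  obtain N where "homog N \<subseteq> idl.span (J \<union> var ` C)"
    using good C(2) unfolding good_coordinates_def by blast
  moreover have "idl.span (J \<union> var ` C) \<subseteq> idl.span (J \<union> var ` B)"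
    using C(1) by (intro idl.span_mono) auto
  ultimately show ?thesis using that by blast
qed

lemma extend_to_card:
  fixes B :: "'x set"
  assumes "card B \<le> n" "B \<subseteq> D" "n \<le> card D"
  obtains C where "B \<subseteq> C" "C \<subseteq> D" "card C = n"
proof -
  have "n - card B \<le> card (D - B)" using assms by (simp add: card_Diff_subset)
  then obtain E where E: "E \<subseteq> D - B" "card E = n - card B" using obtain_subset_with_card_n by metis
  have "finite B" "finite E" "B \<inter> E = {}" using E(1) by auto
  then have "card (B \<union> E) = n" using E(2) assms(1) by (simp add: card_Un_disjoint)
  then show ?thesis using that[of "B \<union> E"] E(1) assms(2) by blast
qed

text \<open>\<open>B\<close> is enlarged to a set \<open>C\<close> of \<open>r\<close> variables.
  Modulo these the restricted ideal and \<open>J\<close> agree, and goodness bounds the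
  \<open>r\<close> summations by the Hilbert function of \<open>J\<close>.\<close>

lemma hilb_restricted_ideal_le:
  assumes "card B \<le> r"
  shows "hilb (restricted_ideal B J) d \<le> hilb J d"
proof -
  obtain C where C: "B \<subseteq> C" "card C = r"
    using extend_to_card[OF assms, of UNIV] lt by (metis Suc_lessD less_imp_le subset_UNIV)
  have inj: "inj_on (var :: 'x \<Rightarrow> ('x, 'k) mpoly) C"
    by (rule inj_onI) (metis inj_monomial injD lookup_single_eq lookup_single_not_eq var_eq_monomial zero_neq_one)
  have "hilb (restricted_ideal B J) d
      \<le> (partial_sums ^^ card (var ` C :: ('x, 'k) mpoly set)) (hilb (idl.span (restricted_ideal B J \<union> var ` C))) d"
  proof (rule hilb_le_partial_sums)
    show "var ` C \<subseteq> (homog 1 :: ('x, 'k) mpoly set)" using var_in_homog by blast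
    show "idl.subspace (restricted_ideal B J)" by (simp add: restricted_ideal_def)
    show "graded (restricted_ideal B J)" by (rule graded_restricted_ideal[OF J(2)])
  qed simp
  also have "card (var ` C :: ('x, 'k) mpoly set) = r" using inj C(2) by (simp add: card_image)
  also have "idl.span (restricted_ideal B J \<union> var ` C) = idl.span (J \<union> var ` C)"
    by (rule restricted_ideal_Un_vars[OF C(1)])
  also have "(partial_sums ^^ r) (hilb (idl.span (J \<union> var ` C))) d \<le> hilb J d"
    using good C(2) unfolding good_coordinates_def by blast
  finally show ?thesis .
qed

text \<open>Both ideals have the Hilbert function of \<open>J\<close>.\<close>

lemma initial_ideal_eq_restricted_ideal:
  assumes "card (- argmin_vars \<omega>) \<le> r"
  shows "initial_ideal \<omega> J = restricted_ideal (- argmin_vars \<omega>) J"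
proof
  let ?E = "restricted_ideal (- argmin_vars \<omega>) J" and ?N = "initial_ideal \<omega> J"
  have E: "idl.subspace ?E" by (simp add: restricted_ideal_def)
  have N: "idl.subspace ?N" by (simp add: initial_ideal_eq)
  have EN: "?E \<subseteq> ?N" by (rule restricted_ideal_subset_initial_ideal[OF J(2)])
  then show "?E \<subseteq> ?N" .
  have le: "hilb ?E d \<le> hilb ?N d" for d
    using hilb_restricted_ideal_le[OF assms, of d] hilb_le_initial_ideal[OF J(1,2), of d \<omega>] by linarith
  have sub: "homog d \<inter> ?N \<subseteq> ?E" for d
    by (rule vs.codim_le_imp_subset[OF ideal_subspace[OF E] ideal_subspace[OF N] hilb_fin EN le[unfolded hilb_def]])
  show "?N \<subseteq> ?E"
  proof
    fix f assume f: "f \<in> ?N"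
    have "homog_part d f \<in> ?E" for d
      using sub[of d] f graded_initial_ideal[OF J(2), of \<omega>] terms_satisfying_in_polys_on
      unfolding graded_def by blast
    then have "(\<Sum>d\<in>exp_degree ` keys f. homog_part d f) \<in> ?E"
      by (intro idl.subspace_sum[OF E])
    then show "f \<in> ?E" using sum_homog_components[of f] by simp
  qed
qed

text \<open>Modulo \<open>r + 1\<close> or more variables a power of each further variable vanishes.
  Setting the variables of \<open>B\<close> to 0 leaves this power unchanged.\<close>

lemma power_in_restricted_ideal:
  assumes "Suc r \<le> card B" "i \<notin> B"
  shows "\<exists>N. monomial (single i N) \<in> restricted_ideal B J"
proof -
  obtain N where N: "homog N \<subseteq> idl.span (J \<union> var ` B)" by (rule good_params[OF assms(1)])
  have "monomial (single i N) \<in> idl.span (J \<union> var ` B)"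
    by (rule subsetD[OF N]) simp
  then have "restrict_vars B (monomial (single i N)) \<in> restricted_ideal B J"
    by (rule restrict_vars_span)
  moreover have "single i N \<in> supported (- B)"
    using assms(2) by (auto simp: supported_def lookup_single when_def)
  ultimately show ?thesis by (auto simp: restrict_vars_monomial)
qed

text \<open>Setting the variables in \<open>B\<close> to \<open>1\<close> maps the restricted ideal to itself.\<close>

lemma monomial_restricted_ideal:
  assumes "monomial \<nu> \<in> restricted_ideal B J"
  obtains \<mu> where "monomial \<mu> \<in> restricted_ideal B J" "\<And>i. i \<in> B \<Longrightarrow> lookup \<mu> i = 0"
proof -
  define \<tau> :: "('x, 'k) mpoly \<Rightarrow> ('x, 'k) mpoly" where "\<tau> = mpoly_eval const (\<lambda>i. if i \<in> B then 1 else var i)"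
  \<comment> \<open>Restricted polynomials contain no variable of \<open>B\<close>, so
    \<open>\<tau>\<close> fixes the generators.\<close>
  have fixed: "\<tau> (restrict_vars B f) = restrict_vars B f" for f
  proof -
    have "mpoly_eval const (\<lambda>i. if i \<in> B then 1 else var i) (if j \<in> B then 0 else var j)
        = (if j \<in> B then 0 else var j :: ('x, 'k) mpoly)" for j
      by (cases "j \<in> B") (simp_all only: if_True if_False subst.mpoly_eval_0 subst.mpoly_eval_var)
    then show ?thesis unfolding \<tau>_def restrict_vars_def subst_subst by simp
  qed
  have img: "\<tau> x \<in> restricted_ideal B J" if "x \<in> restricted_ideal B J" for x
    using that unfolding restricted_ideal_def
  proof (induction rule: idl.span_induct_alt)
    case base
    then show ?case by (simp add: \<tau>_def idl.span_zero)
  next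
    case (step c x y)
    have "\<tau> (c * x + y) = \<tau> c * x + \<tau> y"
      using step(1) fixed unfolding \<tau>_def subst.mpoly_eval_add subst.mpoly_eval_mult by auto
    then show ?case using step by (simp add: idl.span_add idl.span_scale idl.span_base)
  qed
  define \<mu> where "\<mu> = Abs_poly_mapping (\<lambda>i. if i \<in> B then 0 else lookup \<nu> i)"
  have mu: "lookup \<mu> i = (if i \<in> B then 0 else lookup \<nu> i)" for i
    unfolding \<mu>_def by simp
  have "\<tau> (monomial \<nu>) = (\<Prod>i\<in>UNIV. (if i \<in> B then 1 else var i) ^ lookup \<nu> i)"
    unfolding \<tau>_def by (rule subst.mpoly_eval_monomial)
  also have "\<dots> = (\<Prod>i\<in>UNIV. var i ^ lookup \<mu> i)"
    by (rule prod.cong) (simp_all add: mu)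
  also have "\<dots> = monomial \<mu>" by (rule monomial_eq_prod_var[symmetric])
  finally have "monomial \<mu> \<in> restricted_ideal B J" using img[OF assms] by simp
  then show ?thesis using that mu by simp
qed

text \<open>Such a monomial may be taken in the variables outside \<open>B\<close> and then lies in
  the ideal \<open>K\<close> of the section. With any of its variables added, \<open>K\<close> has
  \<open>r - card B\<close> parameters, so \<open>growth_le_monomial\<close> gives \<open>K\<close>
  itself that order of growth, and \<open>J\<close> would have \<open>r\<close> parameters, against
  \<open>growth\<close>.\<close>

lemma no_monomial_restricted_ideal:
  assumes B: "card B \<le> r"
  shows "monomial \<nu> \<notin> restricted_ideal B J"
proof
  assume "monomial \<nu> \<in> restricted_ideal B J"
  then obtain \<mu> where mu: "monomial \<mu> \<in> restricted_ideal B J" "\<And>i. i \<in> B \<Longrightarrow> lookup \<mu> i = 0"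
    by (rule monomial_restricted_ideal) blast
  define K where "K = idl.span (J \<union> var ` B)"
  have varB: "var ` B \<subseteq> (homog 1 :: ('x, 'k) mpoly set)" for B :: "'x set" using var_in_homog by blast
  have K: "idl.subspace K" "graded K"
    unfolding K_def by (simp, rule graded_add_form[OF J(2) varB])
  have "restricted_ideal B J \<subseteq> idl.span (restricted_ideal B J \<union> var ` B)" by (auto intro: idl.span_base)
  then have muK: "monomial \<mu> \<in> K" using mu(1) unfolding K_def restricted_ideal_Un_vars[OF order_refl] by blast
  have "growth_le K (r - card B)"
  proof (rule growth_le_monomial[OF K muK])
    fix i assume "lookup \<mu> i \<noteq> 0"
    then have iB: "i \<notin> B" using mu(2)[of i] by argo
    then have "card (insert i B) \<le> Suc r" using B by simp
    moreover have "Suc r \<le> CARD('x)" using lt by simp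
    \<comment> \<open>\<open>C\<close> consists of \<open>B\<close>, the variable \<open>i\<close>
      and \<open>r - card B\<close> further variables.\<close>
    ultimately obtain C where C: "insert i B \<subseteq> C" "C \<subseteq> UNIV" "card C = Suc r"
      by (rule extend_to_card[OF _ subset_UNIV])
    obtain N where N: "homog N \<subseteq> idl.span (J \<union> var ` C)"
      using good C(3) unfolding good_coordinates_def by blast
    let ?K = "idl.span (K \<union> {var i})"
    let ?F = "var ` (C - insert i B) :: ('x, 'k) mpoly set"
    have "var ` C = var ` B \<union> ({var i} \<union> ?F)" using C(1) by blast
    then have "homog N \<subseteq> idl.span (?K \<union> ?F)"
      using N unfolding K_def idl_span_Un_span by simp
    moreover have "card ?F \<le> r - card B"
    proof -
      have "card ?F \<le> card (C - insert i B)" by (rule card_image_le) simp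
      also have "\<dots> = card C - card (insert i B)" using C(1) by (intro card_Diff_subset) auto
      also have "\<dots> = r - card B" using C(3) iB by simp
      finally show ?thesis .
    qed
    moreover have "finite ?F" by simp
    ultimately have "params ?K (r - card B)" unfolding params_def using varB[of "C - insert i B"] by blast
    moreover have "graded ?K" by (rule graded_add_form[OF K(2), where e = 1]) (use var_in_homog in blast)
    ultimately show "growth_le ?K (r - card B)" by (intro params_imp_growth) simp_all
  qed
  then have "params K (r - card B)" by (rule growth_imp_params[OF K])
  then have "params J (r - card B + card (var ` B :: ('x, 'k) mpoly set))"
    unfolding K_def by (intro params_add_forms varB) simp_all
  moreover have "r - card B + card (var ` B :: ('x, 'k) mpoly set) \<le> r"
    using card_image_le[of B "var :: 'x \<Rightarrow> ('x, 'k) mpoly"] B by simp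
  ultimately have "params J r" by (rule params_mono)
  then show False using params_imp_growth[OF J(1,2)] growth by blast
qed

text \<open>A pure power of \<open>x\<^sub>i\<close> is a term of an element of the first ideal, but of no element of the second one.\<close>

lemma restricted_ideals_differ:
  assumes B: "card B \<le> r" "i \<notin> B" "i \<in> B'"
  shows "restricted_ideal B J \<noteq> restricted_ideal B' J"
proof
  assume eq: "restricted_ideal B J = restricted_ideal B' J"
  \<comment> \<open>Only pure powers of variable \<open>i\<close> and the constant term
    survive.\<close>
  define \<rho> :: "('x, 'k) mpoly \<Rightarrow> ('x, 'k) mpoly" where "\<rho> = restrict_vars (- {i})"
  have iB: "B \<subseteq> - {i}" using B(2) by blast
  have "Suc r \<le> card (- {i})" using lt by (simp add: Compl_eq_Diff_UNIV card_Diff_singleton)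
  \<comment> \<open>Since \<open>C\<close> has \<open>r + 1\<close> elements and avoids
    \<open>i\<close>, a pure power of variable \<open>i\<close> lies in the ideal generated by
    \<open>J\<close> and the variables of \<open>C\<close>; \<open>lt\<close> leaves room for such a
    \<open>C\<close>.\<close>
  then obtain C where C: "B \<subseteq> C" "C \<subseteq> - {i}" "card C = Suc r"
    by (rule extend_to_card[OF le_SucI[OF B(1)] iB])
  obtain N where N: "homog N \<subseteq> idl.span (J \<union> var ` C)"
    using good C(3) unfolding good_coordinates_def by blast
  have \<rho>\<rho>: "\<rho> (restrict_vars B'' f) = terms_satisfying (\<lambda>\<nu>. \<nu> \<in> supported (- (- {i})) \<and> \<nu> \<in> supported (- B'')) f" for B'' f
    unfolding \<rho>_def restrict_vars_eq terms_satisfying_terms_satisfying ..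
  have pB: "\<rho> (restrict_vars B f) = \<rho> f" for f
    unfolding \<rho>\<rho> unfolding \<rho>_def restrict_vars_eq
    by (rule terms_satisfying_cong) (use B(2) in \<open>auto simp: supported_def\<close>)
  \<comment> \<open>\<open>\<rho>\<close> kills the variables of \<open>C\<close>, and it does not
    distinguish an element of \<open>J\<close> from its restriction because \<open>i\<close> is not
    in \<open>B\<close>.\<close>
  have lift: "\<exists>e\<in>restricted_ideal B J. \<rho> x = \<rho> e" if "x \<in> idl.span (J \<union> var ` C)" for x
    using that
  proof (induction rule: idl.span_induct_alt)
    case base
    then show ?case by (intro bexI[of _ 0]) (simp_all add: restricted_ideal_def idl.span_zero)
  next
    case (step c x y)
    obtain e where e: "e \<in> restricted_ideal B J" "\<rho> y = \<rho> e" using step(2) by blast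
    have "\<exists>e'\<in>restricted_ideal B J. \<rho> x = \<rho> e'"
    proof (cases "x \<in> J")
      case True
      then have "restrict_vars B x \<in> restricted_ideal B J"
        unfolding restricted_ideal_def by (intro idl.span_base) blast
      then show ?thesis using pB[of x] by metis
    next
      case False
      then obtain j where "j \<in> C" "x = var j" using step(1) by blast
      then have "\<rho> x = \<rho> 0" using C(2) by (auto simp: \<rho>_def restrict_vars_var)
      moreover have "0 \<in> restricted_ideal B J" by (simp add: restricted_ideal_def idl.span_zero)
      ultimately show ?thesis by blast
    qed
    then obtain e' where e': "e' \<in> restricted_ideal B J" "\<rho> x = \<rho> e'" by blast
    have "\<rho> (c * x + y) = \<rho> (c * e' + e)"
      using e(2) e'(2) unfolding \<rho>_def restrict_vars_add restrict_vars_mult by simp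
    moreover have "c * e' + e \<in> restricted_ideal B J"
      using e(1) e'(1) unfolding restricted_ideal_def by (intro idl.span_add idl.span_scale)
    ultimately show ?case by blast
  qed
  let ?m = "monomial (single i N) :: ('x, 'k) mpoly"
  have "?m \<in> idl.span (J \<union> var ` C)" by (rule subsetD[OF N]) simp
  then obtain e where e: "e \<in> restricted_ideal B' J" "\<rho> ?m = \<rho> e" using lift eq by blast
  \<comment> \<open>As \<open>i\<close> belongs to \<open>B'\<close>, only the constant term of a
    generator could survive, and it is 0 because \<open>J\<close> is proper and graded.\<close>
  have "\<rho> x = 0" if "x \<in> restricted_ideal B' J" for x
    using that unfolding restricted_ideal_def
  proof (induction rule: idl.span_induct_alt)
    case base
    then show ?case by (simp add: \<rho>_def)
  next
    case (step c x y)
    obtain f where f: "f \<in> J" "x = restrict_vars B' f" using step(1) by blast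
    have "\<rho> x = 0"
      unfolding f(2) \<rho>\<rho>
    proof (rule terms_satisfying_none)
      fix \<nu> assume nu: "\<nu> \<in> keys f"
      have "lookup f 0 = 0"
        using proper_graded_subset_irrelevant[OF J] f(1) eval_0_eq_lookup[of f]
        unfolding irrelevant_ideal_def by auto
      then have "\<nu> \<noteq> 0" using nu by (auto simp: in_keys_iff)
      show "\<not> (\<nu> \<in> supported (- (- {i})) \<and> \<nu> \<in> supported (- B'))"
      proof
        assume "\<nu> \<in> supported (- (- {i})) \<and> \<nu> \<in> supported (- B')"
        then have "lookup \<nu> j = 0" for j
          using B(3) by (cases "j = i") (auto simp: supported_def)
        then have "\<nu> = 0" by (intro poly_mapping_eqI) simp
        then show False using \<open>\<nu> \<noteq> 0\<close> by blast
      qed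
    qed
    then show ?case using step(2) unfolding \<rho>_def restrict_vars_add restrict_vars_mult by simp
  qed
  then have "\<rho> ?m = 0" using e by simp
  moreover have "single i N \<in> supported (- (- {i}))"
    by (auto simp: supported_def lookup_single when_def)
  then have "\<rho> ?m = ?m" unfolding \<rho>_def restrict_vars_monomial by simp
  ultimately show False by simp
qed

lemma tropical_variety_iff: "\<omega> \<in> tropical_variety J \<longleftrightarrow> card (- argmin_vars \<omega>) \<le> r"
proof
  assume T: "\<omega> \<in> tropical_variety J"
  show "card (- argmin_vars \<omega>) \<le> r"
  proof (rule ccontr)
    assume "\<not> ?thesis"
    then have c: "Suc r \<le> card (- argmin_vars \<omega>)" by simp
    obtain i where "i \<in> argmin_vars \<omega>" using argmin_vars_nonempty by blast
    then have "i \<notin> - argmin_vars \<omega>" by simp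
    then obtain N where "monomial (single i N) \<in> restricted_ideal (- argmin_vars \<omega>) J"
      using power_in_restricted_ideal[OF c] by blast
    then show False
      using T restricted_ideal_subset_initial_ideal[OF J(2), of \<omega>] unfolding tropical_variety_def by blast
  qed
next
  assume "card (- argmin_vars \<omega>) \<le> r"
  then show "\<omega> \<in> tropical_variety J"
    using no_monomial_restricted_ideal initial_ideal_eq_restricted_ideal by (simp add: tropical_variety_def)
qed

lemma same_initial_ideal_iff:
  assumes "card (- argmin_vars \<omega>) \<le> r"
  shows "initial_ideal \<omega>' J = initial_ideal \<omega> J \<longleftrightarrow> argmin_vars \<omega>' = argmin_vars \<omega>"
proof
  assume eq: "initial_ideal \<omega>' J = initial_ideal \<omega> J"
  have "\<omega> \<in> tropical_variety J" using assms tropical_variety_iff by blast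
  \<comment> \<open>Membership depends only on the initial ideal, and it supplies the bound on the
    number of nonminimal coordinates of \<open>\<omega>'\<close>.\<close>
  then have "\<omega>' \<in> tropical_variety J" using eq by (simp add: tropical_variety_def)
  then have c': "card (- argmin_vars \<omega>') \<le> r" using tropical_variety_iff by blast
  have eq': "restricted_ideal (- argmin_vars \<omega>') J = restricted_ideal (- argmin_vars \<omega>) J"
    using eq unfolding initial_ideal_eq_restricted_ideal[OF assms] initial_ideal_eq_restricted_ideal[OF c'] .
  show "argmin_vars \<omega>' = argmin_vars \<omega>"
  proof (rule ccontr)
    assume "argmin_vars \<omega>' \<noteq> argmin_vars \<omega>"
    then consider i where "i \<in> argmin_vars \<omega>'" "i \<notin> argmin_vars \<omega>" | i where "i \<in> argmin_vars \<omega>" "i \<notin> argmin_vars \<omega>'"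
      by blast
    then show False
    proof cases
      case 1
      then show False using restricted_ideals_differ[OF c', of i "- argmin_vars \<omega>"] eq' by simp
    next
      case 2
      then show False using restricted_ideals_differ[OF assms, of i "- argmin_vars \<omega>'"] eq' by simp
    qed
  qed
next
  assume eq: "argmin_vars \<omega>' = argmin_vars \<omega>"
  show "initial_ideal \<omega>' J = initial_ideal \<omega> J"
    using initial_ideal_eq_restricted_ideal[of \<omega>'] initial_ideal_eq_restricted_ideal[OF assms] assms
    unfolding eq by simp
qed

end

section \<open>The fan W\<close>

lemma W_cone_iff: "\<omega> \<in> W_cone A \<longleftrightarrow> A \<subseteq> argmin_vars \<omega>"
proof -
  have fin: "finite (range (\<lambda>k. \<omega> $ k))" "range (\<lambda>k. \<omega> $ k) \<noteq> {}" by simp_all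
  have "\<omega> $ i = (MIN k. \<omega> $ k) \<longleftrightarrow> (\<forall>k. \<omega> $ i \<le> \<omega> $ k)" for i
  proof
    assume "\<omega> $ i = (MIN k. \<omega> $ k)"
    then show "\<forall>k. \<omega> $ i \<le> \<omega> $ k" using Min_le[OF fin(1)] by simp
  next
    assume "\<forall>k. \<omega> $ i \<le> \<omega> $ k"
    then show "\<omega> $ i = (MIN k. \<omega> $ k)" by (intro Min_eqI[symmetric]) auto
  qed
  then show ?thesis unfolding W_cone_def argmin_vars_def by auto
qed

lemma closed_W_cone: "closed (W_cone A :: (real ^ 'x::finite) set)"
proof -
  have "W_cone A = (\<Inter>i\<in>A. \<Inter>k. {\<omega> :: real ^ 'x. \<omega> $ i \<le> \<omega> $ k})"
    unfolding set_eq_iff W_cone_iff argmin_vars_def by blast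
  moreover have "closed {\<omega> :: real ^ 'x. \<omega> $ i \<le> \<omega> $ k}" for i k
    by (intro closed_Collect_le continuous_intros)
  ultimately show ?thesis by (simp add: closed_INT)
qed

lemma closure_argmin_class:
  fixes A :: "'x::finite set"
  assumes "A \<noteq> {}"
  shows "closure {\<omega> :: real ^ 'x. argmin_vars \<omega> = A} = W_cone A"
proof
  show "closure {\<omega> :: real ^ 'x. argmin_vars \<omega> = A} \<subseteq> W_cone A"
    by (rule closure_minimal[OF _ closed_W_cone]) (auto simp: W_cone_iff)
  show "W_cone A \<subseteq> closure {\<omega> :: real ^ 'x. argmin_vars \<omega> = A}"
  proof
    fix \<omega> :: "real ^ 'x" assume w: "\<omega> \<in> W_cone A"
    \<comment> \<open>Moving along \<open>v\<close> raises exactly the coordinates outside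
      \<open>A\<close>, so that the minimum is attained on \<open>A\<close> only; small multiples of
      \<open>v\<close> stay close to \<open>\<omega>\<close>.\<close>
    define v :: "real ^ 'x" where "v = (\<chi> i. if i \<in> A then 0 else 1)"
    have am: "argmin_vars (\<omega> + e *\<^sub>R v) = A" if e: "0 < e" for e
    proof -
      have le: "\<omega> $ i \<le> \<omega> $ k" if "i \<in> A" for i k
        using w that by (auto simp: W_cone_iff argmin_vars_def)
      have "i \<in> argmin_vars (\<omega> + e *\<^sub>R v) \<longleftrightarrow> i \<in> A" for i
      proof
        assume "i \<in> A"
        then show "i \<in> argmin_vars (\<omega> + e *\<^sub>R v)"
          using le[of i] e by (auto simp: argmin_vars_def v_def add_increasing2)
      next
        assume i: "i \<in> argmin_vars (\<omega> + e *\<^sub>R v)"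
        obtain j where j: "j \<in> A" using assms by blast
        have "\<omega> $ i + e * v $ i \<le> \<omega> $ j + e * v $ j" using i by (simp add: argmin_vars_def)
        then show "i \<in> A" using le[OF j, of i] j e by (simp add: v_def split: if_splits)
      qed
      then show ?thesis by blast
    qed
    show "\<omega> \<in> closure {\<omega> :: real ^ 'x. argmin_vars \<omega> = A}"
      unfolding closure_approachable
    proof (intro allI impI)
      fix \<epsilon> :: real assume eps: "0 < \<epsilon>"
      define e where "e = \<epsilon> / (norm v + 1)"
      have nv: "0 < norm v + 1" using norm_ge_zero[of v] by linarith
      have e0: "0 < e" unfolding e_def using eps nv by simp
      have "dist (\<omega> + e *\<^sub>R v) \<omega> = e * norm v" using e0 by (simp add: dist_norm)
      also have "\<dots> < e * (norm v + 1)" using e0 by simp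
      also have "\<dots> = \<epsilon>" unfolding e_def using nv by simp
      finally show "\<exists>y\<in>{\<omega>. argmin_vars \<omega> = A}. dist y \<omega> < \<epsilon>" using am[OF e0] by blast
    qed
  qed
qed

lemma argmin_vars_indicator:
  fixes A :: "'x::finite set"
  assumes "A \<noteq> {}"
  shows "argmin_vars ((\<chi> i. if i \<in> A then 0 else 1) :: real ^ 'x) = A"
  using assms by (auto simp: argmin_vars_def)

text \<open>The all-ones vector and the unit vectors outside \<open>A\<close> lie in the cone and
  form a basis of its span: a point is its minimum times the first plus its excesses times the
  others.\<close>

lemma dim_W_cone:
  fixes A :: "'x::finite set"
  assumes A: "A \<noteq> {}"
  shows "dim (W_cone A :: (real ^ 'x) set) = Suc (card (- A))"
proof -
  define E :: "(real ^ 'x) set" where "E = (\<lambda>j. axis j 1) ` (- A)"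
  define u :: "real ^ 'x" where "u = (\<chi> i. 1)"
  have inj: "inj_on (\<lambda>j. axis j (1::real) :: real ^ 'x) (- A)"
    by (auto simp: inj_on_def axis_eq_axis)
  have sub: "subspace {v :: real ^ 'x. \<forall>i\<in>A. v $ i = 0}" by (auto simp: subspace_def)
  have "E \<subseteq> {v. \<forall>i\<in>A. v $ i = 0}" by (auto simp: E_def axis_def)
  then have spE: "span E \<subseteq> {v. \<forall>i\<in>A. v $ i = 0}" using sub by (rule span_minimal)
  have "E \<subseteq> Basis" by (auto simp: E_def Basis_vec_def)
  then have "independent E" using independent_Basis independent_mono by blast
  moreover have "u \<notin> span E" using spE A by (auto simp: u_def)
  ultimately have ind: "independent (insert u E)" by (intro independent_insertI)
  have "u \<notin> E" using \<open>u \<notin> span E\<close> span_base by blast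
  then have card: "card (insert u E) = Suc (card (- A))"
    using card_image[OF inj] by (simp add: E_def)
  show ?thesis
  proof (rule dim_unique[OF _ _ ind card])
    show "insert u E \<subseteq> W_cone A"
      by (auto simp: W_cone_iff argmin_vars_def u_def E_def axis_def)
    show "W_cone A \<subseteq> span (insert u E)"
    proof
      fix \<omega> :: "real ^ 'x" assume w: "\<omega> \<in> W_cone A"
      obtain i where i: "i \<in> A" using A by blast
      have eqi: "\<omega> $ k = \<omega> $ i" if "k \<in> A" for k
        using w i that by (auto simp: W_cone_iff argmin_vars_def intro: order_antisym)
      have "\<omega> = \<omega> $ i *\<^sub>R u + (\<Sum>j\<in>- A. (\<omega> $ j - \<omega> $ i) *\<^sub>R axis j 1)"
      proof (rule vec_eq_iff[THEN iffD2], rule allI)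
        fix k
        have "(\<Sum>j\<in>- A. (\<omega> $ j - \<omega> $ i) *\<^sub>R axis j 1) $ k = (\<Sum>j\<in>- A. if j = k then \<omega> $ j - \<omega> $ i else 0)"
          unfolding sum_component by (rule sum.cong) (auto simp: axis_def)
        also have "\<dots> = (if k \<in> A then 0 else \<omega> $ k - \<omega> $ i)" by simp
        finally show "\<omega> $ k = (\<omega> $ i *\<^sub>R u + (\<Sum>j\<in>- A. (\<omega> $ j - \<omega> $ i) *\<^sub>R axis j 1)) $ k"
          using eqi[of k] by (simp add: u_def)
      qed
      also have "\<dots> \<in> span (insert u E)"
        by (intro span_add span_scale span_sum span_base) (auto simp: E_def)
      finally show "\<omega> \<in> span (insert u E)" .
    qed
  qed
qed

section \<open>The tropical fan in good coordinates\<close>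

context good_ideal
begin

lemma closure_initial_class:
  assumes "card (- argmin_vars \<omega>) \<le> r"
  shows "closure {\<omega>'. initial_ideal \<omega>' J = initial_ideal \<omega> J} = W_cone (argmin_vars \<omega>)"
  unfolding same_initial_ideal_iff[OF assms] by (rule closure_argmin_class[OF argmin_vars_nonempty])

theorem tropical_fan_eq_W_skeleton: "tropical_fan J = W_skeleton (Suc r)"
proof
  show "tropical_fan J \<subseteq> W_skeleton (Suc r)"
  proof
    fix \<sigma> assume "\<sigma> \<in> tropical_fan J"
    then obtain \<omega> where s: "\<sigma> = closure {\<omega>'. initial_ideal \<omega>' J = initial_ideal \<omega> J}" "\<sigma> \<subseteq> tropical_variety J"
      unfolding tropical_fan_def groebner_fan_def by blast
    \<comment> \<open>A class lies in its closure, so a cone contained in the tropical variety has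
      its defining weight there.\<close>
    have "\<omega> \<in> \<sigma>" unfolding s(1) by (rule subsetD[OF closure_subset]) simp
    then have c: "card (- argmin_vars \<omega>) \<le> r" using s(2) tropical_variety_iff by blast
    have "\<sigma> = W_cone (argmin_vars \<omega>)" unfolding s(1) by (rule closure_initial_class[OF c])
    then show "\<sigma> \<in> W_skeleton (Suc r)"
      using c dim_W_cone[OF argmin_vars_nonempty[of \<omega>]] argmin_vars_nonempty[of \<omega>]
      unfolding W_skeleton_def W_fan_def by auto
  qed
  show "W_skeleton (Suc r) \<subseteq> tropical_fan J"
  proof
    fix \<sigma> :: "(real ^ 'x) set" assume "\<sigma> \<in> W_skeleton (Suc r)"
    then obtain A where A: "\<sigma> = W_cone A" "A \<noteq> {}" "dim \<sigma> \<le> Suc r"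
      unfolding W_skeleton_def W_fan_def by blast
    \<comment> \<open>The dimension of the cone is one more than the number of nonminimal
      coordinates, hence \<open>Suc r\<close> turns into \<open>r\<close>.\<close>
    have c: "card (- A) \<le> r" using A(3) dim_W_cone[OF A(2)] unfolding A(1) by simp
    let ?\<omega> = "(\<chi> i. if i \<in> A then 0 else 1) :: real ^ 'x"
    have am: "argmin_vars ?\<omega> = A" by (rule argmin_vars_indicator[OF A(2)])
    have "closure {\<omega>'. initial_ideal \<omega>' J = initial_ideal ?\<omega> J} = \<sigma>"
      using closure_initial_class[of ?\<omega>] c unfolding am A(1) by blast
    then have "\<sigma> \<in> groebner_fan J" unfolding groebner_fan_def by blast
    moreover have "\<sigma> \<subseteq> tropical_variety J"
    proof
      fix \<omega> assume "\<omega> \<in> \<sigma>"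
      then have "- argmin_vars \<omega> \<subseteq> - A" unfolding A(1) W_cone_iff by blast
      then have "card (- argmin_vars \<omega>) \<le> card (- A)" by (intro card_mono) simp_all
      then show "\<omega> \<in> tropical_variety J" using c tropical_variety_iff by simp
    qed
    ultimately show "\<sigma> \<in> tropical_fan J" unfolding tropical_fan_def by blast
  qed
qed

end

text \<open>Two nonempty open sets share a matrix, and its tropical fan equals both candidates. This
  gives the definite description in \<open>generic_tropical_variety\<close> its meaning.\<close>

lemma is_generic_tropical_variety_unique:
  fixes I :: "('x::finite, 'k::field_char_0) mpoly set"
  assumes "is_generic_tropical_variety I F" "is_generic_tropical_variety I F'"
  shows "F = F'"
proof -
  obtain U where U: "zariski_open_GL U" "U \<noteq> {}" "\<And>g. g \<in> U \<Longrightarrow> tropical_fan (gl_action g ` I) = F"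
    using assms(1) unfolding is_generic_tropical_variety_def by blast
  obtain V where V: "zariski_open_GL V" "V \<noteq> {}" "\<And>g. g \<in> V \<Longrightarrow> tropical_fan (gl_action g ` I) = F'"
    using assms(2) unfolding is_generic_tropical_variety_def by blast
  obtain g where "g \<in> U" "g \<in> V" using zariski_open_meet[OF U(1,2) V(1,2)] by blast
  then show ?thesis using U(3) V(3) by blast
qed

text \<open>The first conjunct records that the definite description denotes an actual generic fan,
  without which the equation alone would say less.\<close>

theorem corollary4p7:
  fixes I :: "('n::finite, 'k::{alg_closed_field, field_char_0}) mpoly set"
    and m :: nat
  assumes "ideal I mpoly_ring"
    and "I \<noteq> {0}"
    and "graded I"
    and "cohen_macaulay I \<or> almost_cohen_macaulay I"
    and "ideal_dim I = enat m"
    and "0 < m"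
  shows "is_generic_tropical_variety I (generic_tropical_variety I)
    \<and> generic_tropical_variety I = W_skeleton m"
proof -
  obtain r where m: "m = Suc r" using assms(6) by (metis gr0_implies_Suc)
  have I: "idl.subspace I" "graded I" using assms(1,3) by (simp_all add: ideal_type_algebra_iff)
  note dim = ideal_dim_params[OF I assms(5,6)]
  have growth: "\<not> growth_le I r" using dim(3) m by simp
  have lt: "Suc r < CARD('n)" using dim_less_card[OF I(1) assms(2) dim(1,3)] m by simp
  \<comment> \<open>Both alternatives give depth at least \<open>r = m - 1\<close>; under
    \<open>cohen_macaulay\<close> it is even \<open>m\<close>.\<close>
  have depth: "enat r \<le> ideal_depth I"
    using assms(4)
  proof
    assume "cohen_macaulay I"
    then show ?thesis using assms(5) m by (simp add: cohen_macaulay_def)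
  next
    assume "almost_cohen_macaulay I"
    then have "ideal_depth I + 1 = enat (Suc r)" using assms(5) m by (simp add: almost_cohen_macaulay_def)
    then show ?thesis by (cases "ideal_depth I") (simp_all add: one_enat_def)
  qed
  obtain U where U: "zariski_open_GL U" "U \<noteq> {}" "\<And>g. g \<in> U \<Longrightarrow> good_coordinates r (gl_action g ` I)"
    using generic_good_coordinates[OF I dim(1) _ depth] dim(2) lt m by auto
  have fan: "tropical_fan (gl_action g ` I) = W_skeleton m" if g: "g \<in> U" for g
  proof -
    have inv: "invertible g" using g U(1) unfolding zariski_open_GL_def by blast
    have "good_ideal (gl_action g ` I) r"
    proof
      show "idl.subspace (gl_action g ` I)" by (rule subspace_gl_action[OF inv I(1)])
      show "graded (gl_action g ` I)" by (rule graded_gl_action[OF I(2)])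
      show "1 \<notin> gl_action g ` I"
      proof
        assume "1 \<in> gl_action g ` I"
        then obtain f where f: "f \<in> I" "gl_action g f = 1" by auto
        then have "f = gl_action (matrix_inv g) 1" using gl_action_inverse(1)[OF inv, of f] by simp
        then show False using f(1) dim(1) by (simp add: gl_action_1)
      qed
      show "\<not> growth_le (gl_action g ` I) r"
        using growth unfolding growth_le_def ahilb_gl_action[OF inv I(1)] .
      show "good_coordinates r (gl_action g ` I)" by (rule U(3)[OF g])
    qed (rule lt)
    then show ?thesis unfolding m by (rule good_ideal.tropical_fan_eq_W_skeleton)
  qed
  have gen: "is_generic_tropical_variety I (W_skeleton m)"
    unfolding is_generic_tropical_variety_def using U(1,2) fan by blast
  have "generic_tropical_variety I = W_skeleton m"
    unfolding generic_tropical_variety_def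
    by (rule the_equality, rule gen, rule is_generic_tropical_variety_unique[OF _ gen])
  then show ?thesis using gen by simp
qed

end
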